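(* Let $H$ be a fixed simple graph with $v$ vertices and $e$ edges, let $t$ be a fixed integer, and let $q$ range over odd prime powers. Let $X_H(\mathrm{NG}(q,t))$ be the number of vertex-labeled copies of $H$ in $\mathrm{NG}(q,t)$. (1) If $H$ is $3$-degenerate and $t\geq 4$, then $X_H(\mathrm{NG}(q,t))=\Theta(q^{tv-e})$ as $q\to\infty$. (2) If $H$ is $3$-degenerate and $t\geq 5$, or $H$ is $2$-degenerate and $t\geq 3$, then $|X_H(\mathrm{NG}(q,t))-q^{tv-e}|\leq O(q^{tv-e-1/2})$ as $q\to\infty$.
   Context: For a prime power $q$ and integer $t\geq 2$, $N:\mathbb{F}_{q^{t-1}}\to\mathbb{F}_q$ is the norm $N(A)=A^{1+q+\cdots+q^{t-2}}$. The projective norm graph $\mathrm{NG}(q,t)$ has vertex set $\mathbb{F}_{q^{t-1}}\times\mathbb{F}_q^*$, and distinct vertices $(A,a)$, $(B,b)$ are adjacent iff $N(A+B)=ab$. A vertex-labeled copy of $H$ is an injective map $\varphi:V(H)\to V(\mathrm{NG}(q,t))$ such that $\varphi(x)\varphi(y)$ is an edge whenever $xy\in E(H)$. A graph is $r$-degenerate if every nonempty subgraph has a vertex of degree at most $r$. *)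

theory Defs
  imports
    "HOL-Algebra.Subrings"
    "HOL-Number_Theory.Prime_Powers"
    "HOL-Library.Landau_Symbols"
begin

type_synonym 'v ugraph = "'v set \<times> 'v set set"

abbreviation verts :: "'v ugraph \<Rightarrow> 'v set" where
  "verts G \<equiv> fst G"

abbreviation edges :: "'v ugraph \<Rightarrow> 'v set set" where
  "edges G \<equiv> snd G"

definition simple_graph :: "'v ugraph \<Rightarrow> bool" where
  "simple_graph G \<longleftrightarrow> finite (verts G) \<and> (\<forall>e\<in>edges G. e \<subseteq> verts G \<and> card e = 2)"

definition subgraph :: "'v ugraph \<Rightarrow> 'v ugraph \<Rightarrow> bool" where
  "subgraph S G \<longleftrightarrow> simple_graph S \<and> verts S \<subseteq> verts G \<and> edges S \<subseteq> edges G"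

definition vertex_degree :: "'v ugraph \<Rightarrow> 'v \<Rightarrow> nat" where
  "vertex_degree G x = card {e \<in> edges G. x \<in> e}"

definition degenerate :: "nat \<Rightarrow> 'v ugraph \<Rightarrow> bool" where
  "degenerate r G \<longleftrightarrow>
     (\<forall>S. subgraph S G \<and> verts S \<noteq> {} \<longrightarrow> (\<exists>x\<in>verts S. vertex_degree S x \<le> r))"

text \<open>
  Maps out of the vertex set of \<open>H\<close> are taken extensional, so that each of them is counted
  exactly once.
\<close>

definition labeled_copies :: "'v ugraph \<Rightarrow> 'w ugraph \<Rightarrow> ('v \<Rightarrow> 'w) set" where
  "labeled_copies H G =
     {\<phi> \<in> verts H \<rightarrow>\<^sub>E verts G.
        inj_on \<phi> (verts H) \<and> (\<forall>x y. {x, y} \<in> edges H \<longrightarrow> {\<phi> x, \<phi> y} \<in> edges G)}"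

definition num_copies :: "'v ugraph \<Rightarrow> 'w ugraph \<Rightarrow> nat" where
  "num_copies H G = card (labeled_copies H G)"

text \<open>
  The pair \<open>(L, k)\<close> plays the role of the extension of the field with \<open>q\<close> elements by the
  field with \<open>q ^ (t - 1)\<close> elements; it is determined by \<open>q\<close> and \<open>t\<close> up to isomorphism.
\<close>

definition finite_field_ext :: "nat \<Rightarrow> nat \<Rightarrow> 'a ring \<Rightarrow> 'a set \<Rightarrow> bool" where
  "finite_field_ext q t L k \<longleftrightarrow>
     field L \<and> subfield k L \<and> card (carrier L) = q ^ (t - 1) \<and> card k = q"

definition field_norm :: "nat \<Rightarrow> nat \<Rightarrow> 'a ring \<Rightarrow> 'a \<Rightarrow> 'a" where
  "field_norm q t L A = A [^]\<^bsub>L\<^esub> (\<Sum>i<t - 1. q ^ i)"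

definition proj_norm_graph :: "nat \<Rightarrow> nat \<Rightarrow> 'a ring \<Rightarrow> 'a set \<Rightarrow> ('a \<times> 'a) ugraph" where
  "proj_norm_graph q t L k =
     (let V = carrier L \<times> (k - {\<zero>\<^bsub>L\<^esub>})
      in (V, {{(A, a), (B, b)} | A a B b.
                (A, a) \<in> V \<and> (B, b) \<in> V \<and> (A, a) \<noteq> (B, b) \<and>
                field_norm q t L (A \<oplus>\<^bsub>L\<^esub> B) = a \<otimes>\<^bsub>L\<^esub> b}))"

definition odd_prime_powers :: "nat set" where
  "odd_prime_powers = {q. primepow q \<and> odd q}"

text \<open>The limit \<open>q \<rightarrow> \<infinity>\<close> along odd prime powers.\<close>

definition at_top_opp :: "nat filter" where
  "at_top_opp = inf at_top (principal odd_prime_powers)"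

end

theory Submission
  imports Defs "HOL-Computational_Algebra.Polynomial"
begin

text \<open>
  Write \<open>K = \<bbbF>\<^sub>q\<close>, \<open>n = t - 1\<close>. After the substitution \<open>Y = 1/(A + X)\<close>, the common neighbours of three vertices
  with distinct first coordinates are the \<open>W\<close> in the extension of degree \<open>n\<close> with \<open>N(W) = c\<close>, \<open>N(W + 1) = d\<close>
  (up to one excluded value), for some nonzero \<open>c\<close>, \<open>d\<close>; let \<open>S\<^sub>n(c,d)\<close> be their number. For \<open>n \<ge> 5\<close> the second
  moment of \<open>S\<^sub>n\<close> over all \<open>(c,d)\<close>, which can be computed exactly, already gives \<open>S\<^sub>n = q^(n-2) + O(q^(n/2))\<close>
  for each \<open>(c,d)\<close>. For \<open>n = 3, 4\<close> one compares \<open>S\<^sub>n\<close> with the number \<open>T\<^sub>n\<close> of \<open>x \<in> K^n\<close> satisfying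
  \<open>\<Prod>x\<^sub>i = c\<close>, \<open>\<Prod>(x\<^sub>i + 1) = d\<close> (elementary cases of the Hasse-Davenport relation): \<open>S\<^sub>3 \<ge> T\<^sub>3\<close> by classifying the
  factorizations of cubics, and \<open>S\<^sub>4 = 2q\<^sup>2 - 4q + 14 - T\<^sub>4\<close> by passing through the quadratic subextension.
  Finally \<open>T\<^sub>4\<close> is a sum of values of \<open>T\<^sub>3\<close>, and \<open>T\<^sub>3\<close> counts the points of a curve \<open>w\<^sup>2 = f(z)\<close> with \<open>f\<close> a quartic
  that can be a square only if \<open>c = 1\<close>; if it is not a square, Stepanov's method gives
  \<open>T\<^sub>3 = q + O(\<surd>q)\<close>. Copies of \<open>H\<close> are counted by adding the vertices one at a time in a degeneracy order;
  for the lower bound only embeddings with distinct first coordinates are counted.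
\<close>

section \<open>Finite fields inside a commutative ring\<close>

text \<open>The second moment stops working exactly at n = 4, where its error q^(n/2) reaches the
  main term q^(n-2); hence the comparison with the split counts. In T_4 the quartic can be a square
  for at most one of the summands T_3, which is harmless after summation. For n = 3 nothing averages
  the exceptional case out, so only the order of magnitude q is obtained; this is the gap between
  the claims for t = 4 and t \<ge> 5. A 2-degenerate graph involves at most two norm equations at a
  time, and for these the size of the norm fibres suffices. Two vertices with equal first and
  different second coordinates have no common neighbour, so no lower bound can hold for arbitrary
  sets of vertices; asking for distinct first coordinates loses only a fraction O(q^(-1/2)). The
  given fields are records on an arbitrary type, while the polynomials used live over a ring class.
  All fields are therefore placed inside one commutative ring of characteristic 0 with zero
  divisors, where their common unit \<open>e\<close> is not 1. This explains the factors
  \<open>e\<close> and the constant concern with membership in \<open>K\<close>.\<close>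

hide_const (open) up_ring.monom up_ring.coeff

text \<open>Only \<open>x\<close> has to be killed by \<open>p\<close>, since every middle binomial
  term contains a factor \<open>x\<close>. This matters because the ambient ring need not have
  characteristic p.\<close>

lemma prime_dvd_add_power:
  fixes x y :: "'r::comm_ring_1"
  assumes p: "prime (p::nat)" and px: "of_nat p * x = 0"
  shows "(x + y) ^ p = x ^ p + y ^ p"
proof -
  have p0: "p > 0" using p by (rule prime_gt_0_nat)
  have z: "of_nat (p choose i) * x ^ i * y ^ (p - i) = 0" if i: "i \<in> {1..<p}" for i
  proof -
    have "p dvd (p choose i)" using i p by (intro dvd_choose_prime) auto
    then obtain m where m: "p choose i = p * m" by auto
    obtain j where j: "i = Suc j" using i by (cases i) auto
    have "of_nat (p choose i) * x ^ i = of_nat m * x ^ j * (of_nat p * x)"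
      unfolding m unfolding j by (simp add: algebra_simps)
    then show ?thesis using px by simp
  qed
  have "(x + y) ^ p = (\<Sum>i\<le>p. of_nat (p choose i) * x ^ i * y ^ (p - i))"
    by (rule binomial_ring)
  also have "{..p} = insert 0 (insert p {1..<p})" using p0 by auto
  also have "(\<Sum>i\<in>insert 0 (insert p {1..<p}). of_nat (p choose i) * x ^ i * y ^ (p - i))
      = y ^ p + (x ^ p + (\<Sum>i\<in>{1..<p}. of_nat (p choose i) * x ^ i * y ^ (p - i)))"
    using p0 by (subst sum.insert; simp)+
  also have "(\<Sum>i\<in>{1..<p}. of_nat (p choose i) * x ^ i * y ^ (p - i)) = 0"
    using z by (intro sum.neutral) auto
  finally show ?thesis by simp
qed

lemma prime_power_add_power:
  fixes x y :: "'r::comm_ring_1"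
  assumes p: "prime (p::nat)" and px: "of_nat p * x = 0"
  shows "(x + y) ^ (p ^ k) = x ^ (p ^ k) + y ^ (p ^ k)"
proof (induction k)
  case 0
  show ?case by simp
next
  case (Suc k)
  have 1: "of_nat p * x ^ (p ^ k) = 0"
  proof -
    have "p ^ k > 0" using p by (simp add: prime_gt_0_nat)
    then obtain j where "p ^ k = Suc j" by (cases "p ^ k") auto
    then show ?thesis using px by (simp add: mult.assoc[symmetric])
  qed
  have "(x + y) ^ (p ^ Suc k) = ((x + y) ^ (p ^ k)) ^ p"
    by (simp add: power_mult[symmetric] mult.commute)
  also have "\<dots> = x ^ (p ^ Suc k) + y ^ (p ^ Suc k)"
    unfolding Suc prime_dvd_add_power[OF p 1] by (simp add: power_mult[symmetric] mult.commute)
  finally show ?case .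
qed

lemma const_power: "[:x::'r::comm_ring_1:] ^ n = [:x ^ n:]"
  by (induction n) auto

definition coeffs_in :: "'r::comm_ring_1 set \<Rightarrow> 'r poly \<Rightarrow> bool" where
  "coeffs_in K p \<longleftrightarrow> (\<forall>i. Polynomial.coeff p i \<in> K)"

text \<open>A monic linear factor is regular even over a ring with zero divisors: the top
  coefficient of the product is that of \<open>u\<close>.\<close>

lemma linear_mult_eq_0:
  fixes u :: "'r::comm_ring_1 poly"
  assumes "[:- a, 1:] * u = 0" shows "u = 0"
proof (rule ccontr)
  assume u: "u \<noteq> 0"
  have "coeff ([:- a, 1:] * u) (Suc (degree u)) = coeff u (degree u)"
    by (simp add: coeff_eq_0)
  then show False using assms u by (metis coeff_0 leading_coeff_0_iff)
qed

lemma degree_linear_mult: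
  fixes u :: "'r::comm_ring_1 poly"
  assumes "u \<noteq> 0" shows "degree ([:- a, 1:] * u) = Suc (degree u)"
proof (rule antisym)
  have "coeff ([:- a, 1:] * u) (Suc (degree u)) = coeff u (degree u)"
    by (simp add: coeff_eq_0)
  also have "\<dots> \<noteq> 0" using assms by simp
  finally show "Suc (degree u) \<le> degree ([:- a, 1:] * u)" by (rule le_degree)
  have "degree [:- a, 1:] \<le> 1" by simp
  then show "degree ([:- a, 1:] * u) \<le> Suc (degree u)"
    using degree_mult_le[of "[:- a, 1:]" u] by simp
qed

lemma linear_power_mult_cancel:
  fixes u :: "'r::comm_ring_1 poly"
  assumes "[:- a, 1:] ^ k * u = [:- a, 1:] ^ k * w" shows "u = w"
  using assms
proof (induction k arbitrary: u w)
  case (Suc k)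
  have "[:- a, 1:] ^ k * ([:- a, 1:] * u) = [:- a, 1:] ^ k * ([:- a, 1:] * w)"
    using Suc.prems by (simp only: power_Suc2 mult.assoc)
  then have "[:- a, 1:] * u = [:- a, 1:] * w" by (rule Suc.IH)
  then have "[:- a, 1:] * (u - w) = 0" by (simp add: right_diff_distrib)
  then show ?case using linear_mult_eq_0 by fastforce
qed simp

text \<open>
  A finite field sitting inside a commutative ring of the type class; its unit \<open>e\<close> need not be
  the unit of the ring.
\<close>

locale ring_subfield =
  fixes K :: "'r::comm_ring_1 set" and e :: 'r
  assumes fin: "finite K" and e_mem: "e \<in> K" and e_neq_0: "e \<noteq> 0"
    and diff_mem: "\<And>x y. x \<in> K \<Longrightarrow> y \<in> K \<Longrightarrow> x - y \<in> K"
    and mult_mem: "\<And>x y. x \<in> K \<Longrightarrow> y \<in> K \<Longrightarrow> x * y \<in> K"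
    and e_mult: "\<And>x. x \<in> K \<Longrightarrow> e * x = x"
    and inverse_ex: "\<And>x. x \<in> K \<Longrightarrow> x \<noteq> 0 \<Longrightarrow> \<exists>y\<in>K. x * y = e"
begin

lemma mult_e: "x \<in> K \<Longrightarrow> x * e = x"
  by (metis e_mult mult.commute)

lemma zero_mem: "0 \<in> K"
  using diff_mem[OF e_mem e_mem] by simp

lemma uminus_mem: "x \<in> K \<Longrightarrow> - x \<in> K"
  using diff_mem[OF zero_mem] by simp

lemma add_mem: "x \<in> K \<Longrightarrow> y \<in> K \<Longrightarrow> x + y \<in> K"
  using diff_mem[OF _ uminus_mem, of x y] by simp

lemma sum_mem: "(\<And>i. i \<in> I \<Longrightarrow> f i \<in> K) \<Longrightarrow> sum f I \<in> K"
  by (induction I rule: infinite_finite_induct) (auto simp: zero_mem add_mem)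

lemma of_nat_mult_mem: "x \<in> K \<Longrightarrow> of_nat n * x \<in> K"
  by (induction n) (auto simp: zero_mem add_mem algebra_simps)

lemma numeral_mult_mem: "x \<in> K \<Longrightarrow> numeral n * x \<in> K"
  using of_nat_mult_mem[of x "numeral n"] by simp

lemma power_mem: "x \<in> K \<Longrightarrow> n > 0 \<Longrightarrow> x ^ n \<in> K"
proof (induction n)
  case (Suc n)
  then show ?case by (cases n) (auto simp: mult_mem)
qed simp

lemma e_power_mem: "x \<in> K \<Longrightarrow> e * x ^ n \<in> K"
  by (cases "n = 0") (auto simp: e_mem power_mem mult_mem)

lemma e_power: "n > 0 \<Longrightarrow> e ^ n = e"
proof (induction n)
  case (Suc n)
  then show ?case by (cases n) (auto simp: e_mult[OF e_mem])
qed simp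

lemma mult_eq_0: "x \<in> K \<Longrightarrow> y \<in> K \<Longrightarrow> x * y = 0 \<longleftrightarrow> x = 0 \<or> y = 0"
proof (auto, rule ccontr)
  assume x: "x \<in> K" and y: "y \<in> K" and xy: "x * y = 0" and y0: "y \<noteq> 0" and x0: "x \<noteq> 0"
  obtain z where "z \<in> K" "x * z = e" using inverse_ex[OF x x0] by auto
  then have "y = x * z * y" using e_mult y by simp
  also have "\<dots> = z * (x * y)" by (simp add: algebra_simps)
  also have "\<dots> = 0" using xy by simp
  finally show False using y0 by simp
qed

lemma mult_left_cancel: "x \<in> K \<Longrightarrow> x \<noteq> 0 \<Longrightarrow> y \<in> K \<Longrightarrow> z \<in> K \<Longrightarrow> x * y = x * z \<longleftrightarrow> y = z"
proof
  assume *: "x \<in> K" "x \<noteq> 0" "y \<in> K" "z \<in> K" "x * y = x * z"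
  then have "x * (y - z) = 0" by (simp add: algebra_simps)
  then show "y = z" using * mult_eq_0[of x "y - z"] diff_mem by auto
qed simp

lemma power_eq_0: "x \<in> K \<Longrightarrow> n > 0 \<Longrightarrow> x ^ n = 0 \<longleftrightarrow> x = 0"
proof (induction n)
  case (Suc n)
  show ?case
  proof (cases "n = 0")
    case False
    then show ?thesis using Suc mult_eq_0[of x "x ^ n"] power_mem[of x n] by simp
  qed simp
qed simp

lemma prod_e_mem: "(\<And>i. i \<in> I \<Longrightarrow> f i \<in> K) \<Longrightarrow> e * prod f I \<in> K"
proof (induction I rule: infinite_finite_induct)
  case (insert i I)
  have "e * prod f (insert i I) = f i * (e * prod f I)"
    using insert by (simp add: mult.left_commute)
  then show ?case using insert mult_mem by (metis insertCI)
qed (auto simp: e_mem)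

lemma prod_e_neq_0: "(\<And>i. i \<in> I \<Longrightarrow> f i \<in> K \<and> f i \<noteq> 0) \<Longrightarrow> e * prod f I \<noteq> 0"
proof (induction I rule: infinite_finite_induct)
  case (insert i I)
  have "e * prod f (insert i I) = f i * (e * prod f I)"
    using insert by (simp add: mult.left_commute)
  then show ?case using insert mult_eq_0[of "f i" "e * prod f I"] prod_e_mem[of I f]
    by (metis insertCI)
qed (auto simp: e_neq_0)

definition inv_in :: "'r \<Rightarrow> 'r" where
  "inv_in x = (SOME y. y \<in> K \<and> x * y = e)"

lemma inv_in: assumes "x \<in> K" "x \<noteq> 0"
  shows "inv_in x \<in> K" "x * inv_in x = e" "inv_in x * x = e" "inv_in x \<noteq> 0"
proof -
  have "\<exists>y. y \<in> K \<and> x * y = e" using inverse_ex[OF assms] by auto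
  from someI_ex[OF this] show 1: "inv_in x \<in> K" "x * inv_in x = e" by (auto simp: inv_in_def)
  then show "inv_in x * x = e" "inv_in x \<noteq> 0" using e_neq_0 by (auto simp: mult.commute)
qed

text \<open>Multiplication by \<open>x\<close> permutes the nonzero elements, so their product can
  be cancelled. The factors \<open>e\<close> keep products inside \<open>K\<close>, which an empty
  product 1 would leave.\<close>

lemma power_card_minus_1: assumes x: "x \<in> K" "x \<noteq> 0"
  shows "x ^ (card K - 1) * e = e"
proof -
  let ?U = "K - {0}"
  let ?P = "e * \<Prod>?U"
  have P: "?P \<in> K" using prod_e_mem[of ?U "\<lambda>x. x"] by auto
  have P0: "?P \<noteq> 0" using prod_e_neq_0[of ?U "\<lambda>x. x"] by auto
  have img: "(*) x ` ?U = ?U"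
  proof
    show "(*) x ` ?U \<subseteq> ?U" using x by (auto simp: mult_mem mult_eq_0)
    show "?U \<subseteq> (*) x ` ?U"
    proof
      fix y assume y: "y \<in> ?U"
      have "y = x * (inv_in x * y)" using inv_in(2)[OF x] y e_mult by (simp add: mult.assoc[symmetric])
      moreover have "inv_in x * y \<in> ?U" using inv_in[OF x] y by (auto simp: mult_mem mult_eq_0)
      ultimately show "y \<in> (*) x ` ?U" by blast
    qed
  qed
  have inj: "inj_on ((*) x) ?U" using x by (auto simp: inj_on_def mult_left_cancel)
  have "\<Prod>?U = \<Prod>((*) x ` ?U)" using img by simp
  also have "\<dots> = (\<Prod>y\<in>?U. x * y)" using inj by (simp add: prod.reindex)
  also have "\<dots> = x ^ card ?U * \<Prod>?U" by (simp add: prod.distrib)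
  finally have "?P = e * (x ^ card ?U * \<Prod>?U)" by (rule arg_cong)
  also have "\<dots> = (e * e) * (x ^ card ?U * \<Prod>?U)" using e_mult[OF e_mem] by simp
  also have "\<dots> = ?P * (e * x ^ card ?U)" by (simp only: mult_ac)
  finally have "?P * (e * x ^ card ?U) = ?P * e" using mult_e[OF P] by simp
  then have "e * x ^ card ?U = e" using P P0 e_power_mem[OF x(1)] e_mem
    by (subst (asm) mult_left_cancel) auto
  moreover have "card ?U = card K - 1" using fin zero_mem by simp
  ultimately show ?thesis by (simp add: mult.commute)
qed

lemma card_gt_1: "card K > 1"
proof -
  have "card {0, e} \<le> card K" using fin zero_mem e_mem by (intro card_mono) auto
  then show ?thesis using e_neq_0 by auto
qed

lemma power_card: assumes x: "x \<in> K" shows "x ^ card K = x"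
proof (cases "x = 0")
  case False
  have "card K = Suc (card K - 1)" using card_gt_1 by simp
  then have "x ^ card K = x * x ^ (card K - 1)" by (metis power_Suc)
  also have "\<dots> = (x * e) * x ^ (card K - 1)" using mult_e[OF x] by simp
  also have "\<dots> = x * (x ^ (card K - 1) * e)" by (simp only: mult_ac)
  finally show ?thesis using power_card_minus_1[OF x False] mult_e[OF x] by simp
next
  case True
  have "card K > 0" using card_gt_1 by simp
  then show ?thesis using True by (simp add: zero_power)
qed

text \<open>Translation by \<open>e\<close> permutes \<open>K\<close> and adds \<open>card K\<close>
  copies of \<open>e\<close> to the sum of all elements.\<close>

lemma card_mult_e: "of_nat (card K) * e = 0"
proof -
  have img: "(+) e ` K = K"
  proof
    show "(+) e ` K \<subseteq> K" using e_mem add_mem by auto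
    show "K \<subseteq> (+) e ` K"
    proof
      fix y assume "y \<in> K"
      then have "y = e + (y - e)" "y - e \<in> K" using diff_mem e_mem by auto
      then show "y \<in> (+) e ` K" by blast
    qed
  qed
  have "\<Sum>K = \<Sum>((+) e ` K)" using img by simp
  also have "\<dots> = (\<Sum>y\<in>K. e + y)" by (simp add: sum.reindex)
  also have "\<dots> = of_nat (card K) * e + \<Sum>K" by (simp add: sum.distrib)
  finally show ?thesis by simp
qed

text \<open>The \<open>k\<close>-th power of \<open>of_nat p * e\<close> is
  \<open>of_nat (card K) * e = 0\<close>, and \<open>K\<close> has no nilpotent elements.\<close>

lemma prime_mult_eq_0: assumes "card K = p ^ k" "x \<in> K" shows "of_nat p * x = 0"
proof -
  have k: "k > 0" using card_gt_1 assms by (cases k) auto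
  have pe: "of_nat p * e \<in> K" using of_nat_mult_mem e_mem by auto
  have "(of_nat p * e) ^ k = of_nat (card K) * e"
    using assms(1) k e_power by (simp add: power_mult_distrib)
  then have "of_nat p * e = 0" using card_mult_e power_eq_0[OF pe k] by simp
  then have "of_nat p * e * x = 0" by simp
  then show ?thesis using e_mult[OF assms(2)] by (simp add: mult.assoc)
qed

lemma frobenius_add: assumes "prime p" "card K = p ^ k" "x \<in> K"
  shows "(x + y) ^ (p ^ m) = x ^ (p ^ m) + y ^ (p ^ m)"
  using prime_power_add_power[OF assms(1) prime_mult_eq_0[OF assms(2,3)]] .

section \<open>Polynomials with coefficients in the subfield\<close>

lemma coeffs_in_0: "coeffs_in K 0"
  by (simp add: coeffs_in_def zero_mem)

lemma coeffs_in_add: "coeffs_in K p \<Longrightarrow> coeffs_in K r \<Longrightarrow> coeffs_in K (p + r)"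
  by (simp add: coeffs_in_def add_mem)

lemma coeffs_in_diff: "coeffs_in K p \<Longrightarrow> coeffs_in K r \<Longrightarrow> coeffs_in K (p - r)"
  by (simp add: coeffs_in_def diff_mem)

lemma coeffs_in_mult: "coeffs_in K p \<Longrightarrow> coeffs_in K r \<Longrightarrow> coeffs_in K (p * r)"
  by (simp add: coeffs_in_def coeff_mult sum_mem mult_mem)

lemma coeffs_in_smult: "a \<in> K \<Longrightarrow> coeffs_in K r \<Longrightarrow> coeffs_in K (smult a r)"
  by (simp add: coeffs_in_def mult_mem)

lemma coeffs_in_sum: "(\<And>i. i \<in> I \<Longrightarrow> coeffs_in K (f i)) \<Longrightarrow> coeffs_in K (sum f I)"
  by (simp add: coeffs_in_def coeff_sum sum_mem)

lemma coeffs_in_pCons: "coeffs_in K (pCons a p) \<longleftrightarrow> a \<in> K \<and> coeffs_in K p"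
proof -
  have "(\<forall>i. coeff (pCons a p) i \<in> K) \<longleftrightarrow> a \<in> K \<and> (\<forall>i. coeff p i \<in> K)"
    by (metis coeff_pCons_0 coeff_pCons_Suc not0_implies_Suc)
  then show ?thesis by (simp add: coeffs_in_def)
qed

lemma coeffs_in_monom: "a \<in> K \<Longrightarrow> coeffs_in K (monom a n)"
  by (simp add: coeffs_in_def zero_mem)

lemma coeffs_in_monom_mult: "coeffs_in K r \<Longrightarrow> coeffs_in K (monom 1 n * r)"
  by (simp add: coeffs_in_def zero_mem coeff_monom_mult)

lemma coeffs_in_power: "coeffs_in K p \<Longrightarrow> n > 0 \<Longrightarrow> coeffs_in K (p ^ n)"
proof (induction n)
  case (Suc n)
  then show ?case by (cases n) (auto simp: coeffs_in_mult)
qed simp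

lemma smult_e: "coeffs_in K p \<Longrightarrow> smult e p = p"
  by (intro poly_eqI) (simp add: coeffs_in_def e_mult)

lemma poly_mem: "coeffs_in K p \<Longrightarrow> x \<in> K \<Longrightarrow> poly p x \<in> K"
  by (induction p) (auto simp: zero_mem coeffs_in_pCons add_mem mult_mem)

lemma lead_coeff_mem: "coeffs_in K p \<Longrightarrow> lead_coeff p \<in> K"
  by (simp add: coeffs_in_def)

lemma degree_mult_in: assumes "coeffs_in K p" "coeffs_in K r" "p \<noteq> 0" "r \<noteq> 0"
  shows "degree (p * r) = degree p + degree r"
    and "lead_coeff (p * r) = lead_coeff p * lead_coeff r" and "p * r \<noteq> 0"
proof -
  have "lead_coeff p * lead_coeff r \<noteq> 0"
    using assms lead_coeff_mem mult_eq_0 by (metis leading_coeff_0_iff)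
  then have 1: "coeff (p * r) (degree p + degree r) \<noteq> 0" by (simp add: coeff_mult_degree_sum)
  then have "degree p + degree r \<le> degree (p * r)" by (rule le_degree)
  then show 2: "degree (p * r) = degree p + degree r" using degree_mult_le[of p r] by simp
  show "p * r \<noteq> 0" using 1 by auto
  show "lead_coeff (p * r) = lead_coeff p * lead_coeff r"
    unfolding 2 by (simp add: coeff_mult_degree_sum)
qed

text \<open>Each coefficient of the quotient is a coefficient of the product plus \<open>a\<close>
  times the next higher one of the quotient; descend from above the degree, where the coefficient is
  0.\<close>

lemma coeffs_in_linear_quotient:
  assumes "coeffs_in K ([:- a, 1:] * g)" "a \<in> K" shows "coeffs_in K g"
proof -
  have step: "coeff g i \<in> K" if "coeff g (Suc i) \<in> K" for i
  proof -
    have "coeff ([:- a, 1:] * g) (Suc i) = coeff g i - a * coeff g (Suc i)" by simp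
    then have "coeff g i = coeff ([:- a, 1:] * g) (Suc i) + a * coeff g (Suc i)" by simp
    then show ?thesis using assms that by (metis add_mem mult_mem coeffs_in_def)
  qed
  have "coeff g (Suc (degree g) - j) \<in> K" for j
  proof (induction j)
    case 0
    show ?case by (simp add: coeff_eq_0 zero_mem)
  next
    case (Suc j)
    show ?case
    proof (cases "j \<le> degree g")
      case True
      then have "Suc (degree g) - j = Suc (Suc (degree g) - Suc j)" by simp
      then show ?thesis using Suc step by metis
    qed (use Suc in auto)
  qed
  moreover have "coeff g i \<in> K" if "i > degree g" for i using that by (simp add: coeff_eq_0 zero_mem)
  ultimately show ?thesis unfolding coeffs_in_def
    by (metis diff_diff_cancel le_SucI not_le_imp_less)
qed

text \<open>A substitute for coprimality of distinct linear factors: after removing \<open>k\<close>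
  factors X - b, evaluation at \<open>b\<close> leaves (b - a) h(b) = 0, and b - a is a nonzero
  element of the field.\<close>

lemma linear_power_dvd_cancel:
  assumes g: "coeffs_in K g" and ab: "a \<in> K" "b \<in> K" "a \<noteq> b"
    and d: "[:- b, 1:] ^ k dvd [:- a, 1:] * g"
  shows "[:- b, 1:] ^ k dvd g"
  using d
proof (induction k)
  case (Suc k)
  then have "[:- b, 1:] ^ k dvd g" by (metis power_Suc2 dvd_mult_left)
  then obtain h where h: "g = [:- b, 1:] ^ k * h" by (rule dvdE)
  have hK: "coeffs_in K h"
    using g unfolding h
  proof (induction k)
    case (Suc k)
    then have "coeffs_in K ([:- b, 1:] * ([:- b, 1:] ^ k * h))" by (simp only: power_Suc mult.assoc)
    then show ?case using Suc.IH coeffs_in_linear_quotient ab by blast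
  qed simp
  from Suc.prems obtain w where "[:- a, 1:] * g = [:- b, 1:] ^ Suc k * w" by (rule dvdE)
  moreover have "[:- b, 1:] ^ k * ([:- a, 1:] * h) = [:- a, 1:] * g"
    unfolding h by (rule mult.left_commute)
  ultimately have "[:- b, 1:] ^ k * ([:- a, 1:] * h) = [:- b, 1:] ^ k * ([:- b, 1:] * w)"
    by (simp only: power_Suc2 mult.assoc)
  then have "[:- a, 1:] * h = [:- b, 1:] * w" by (rule linear_power_mult_cancel)
  then have "poly ([:- a, 1:] * h) b = poly ([:- b, 1:] * w) b" by simp
  then have "(b - a) * poly h b = 0" by (simp add: algebra_simps)
  moreover have "b - a \<in> K" "b - a \<noteq> 0" "poly h b \<in> K" using ab hK diff_mem poly_mem by auto
  ultimately have "poly h b = 0" using mult_eq_0 by metis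
  then have "[:- b, 1:] dvd h" by (simp add: poly_eq_0_iff_dvd)
  then show ?case unfolding h power_Suc2 by (rule mult_dvd_mono[OF dvd_refl])
qed simp

text \<open>Linear factors are split off one at a time, lowering the prescribed multiplicity of that
  root by one and preserving the others. In Stepanov's method all \<open>m a\<close> are equal to
  one large number.\<close>

lemma sum_multiplicities_le_degree:
  assumes "coeffs_in K p" "p \<noteq> 0" "Z \<subseteq> K" "\<And>a. a \<in> Z \<Longrightarrow> [:- a, 1:] ^ m a dvd p"
  shows "(\<Sum>a\<in>Z. m a) \<le> degree p"
  using assms
proof (induction "degree p" arbitrary: p m rule: less_induct)
  case less
  have finZ: "finite Z" using less.prems(3) fin finite_subset by blast
  show ?case
  proof (cases "\<exists>a\<in>Z. m a > 0")
    case False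
    then show ?thesis by simp
  next
    case True
    then obtain a where a: "a \<in> Z" "m a > 0" by auto
    then have "[:- a, 1:] ^ 1 dvd p" using less.prems(4)[OF a(1)]
      using dvd_trans le_imp_power_dvd by (metis One_nat_def Suc_leI)
    then obtain g where g: "p = [:- a, 1:] * g" by (metis dvdE power_one_right)
    have aK: "a \<in> K" using a less.prems by auto
    have gK: "coeffs_in K g" using less.prems(1) coeffs_in_linear_quotient aK unfolding g by blast
    have g0: "g \<noteq> 0" using less.prems(2) g by auto
    have deg: "degree p = Suc (degree g)" unfolding g using g0 by (rule degree_linear_mult)
    let ?m = "m(a := m a - 1)"
    have "[:- b, 1:] ^ ?m b dvd g" if b: "b \<in> Z" for b
    proof (cases "b = a")
      case True
      obtain w where "p = [:- a, 1:] ^ m a * w" using less.prems(4)[OF a(1)] by (rule dvdE)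
      then have "p = [:- a, 1:] ^ Suc (m a - 1) * w" using a(2) by simp
      then have "[:- a, 1:] ^ 1 * g = [:- a, 1:] ^ 1 * ([:- a, 1:] ^ (m a - 1) * w)"
        unfolding g by (simp only: power_Suc power_one_right mult.assoc)
      then have "g = [:- a, 1:] ^ (m a - 1) * w" by (rule linear_power_mult_cancel)
      then show ?thesis using True by simp
    next
      case False
      then show ?thesis using linear_power_dvd_cancel[OF gK aK, of b] less.prems(3,4) b
        unfolding g by auto
    qed
    then have "(\<Sum>b\<in>Z. ?m b) \<le> degree g" using less.hyps[of g ?m] deg gK g0 less.prems(3) by auto
    moreover have "(\<Sum>b\<in>Z. m b) = Suc (\<Sum>b\<in>Z. ?m b)"
      using a finZ by (simp add: sum.remove[of Z a])
    ultimately show ?thesis using deg by simp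
  qed
qed

lemma card_roots_le: assumes "coeffs_in K p" "p \<noteq> 0"
  shows "card {x \<in> K. poly p x = 0} \<le> degree p"
  using sum_multiplicities_le_degree[OF assms, of "{x \<in> K. poly p x = 0}" "\<lambda>_. 1"]
  by (auto simp: poly_eq_0_iff_dvd)

text \<open>Ordinary long division; the leading coefficient of \<open>r\<close> is inverted inside
  \<open>K\<close>, relative to \<open>e\<close>.\<close>

lemma poly_division:
  assumes "coeffs_in K s" "coeffs_in K r" "r \<noteq> 0"
  shows "\<exists>g. coeffs_in K g \<and> (s - g * r = 0 \<or> degree (s - g * r) < degree r)"
  using assms(1)
proof (induction "degree s" arbitrary: s rule: less_induct)
  case less
  show ?case
  proof (cases "s = 0 \<or> degree s < degree r")
    case True
    then show ?thesis by (intro exI[of _ 0]) (auto simp: coeffs_in_0)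
  next
    case False
    define c where "c = lead_coeff s * inv_in (lead_coeff r)"
    have lr: "lead_coeff r \<in> K" "lead_coeff r \<noteq> 0" using assms lead_coeff_mem by auto
    have cK: "c \<in> K" unfolding c_def using lr inv_in less.prems lead_coeff_mem mult_mem by auto
    define u where "u = monom c (degree s - degree r)"
    have uK: "coeffs_in K u" unfolding u_def using cK by (rule coeffs_in_monom)
    let ?s = "s - u * r"
    have sK: "coeffs_in K ?s" using less.prems uK assms coeffs_in_diff coeffs_in_mult by blast
    have "coeff (u * r) (degree s) = c * lead_coeff r"
      unfolding u_def using False by (simp add: coeff_monom_mult)
    also have "\<dots> = lead_coeff s"
      unfolding c_def using inv_in[OF lr] mult_e lead_coeff_mem[OF less.prems] by (simp add: mult.assoc)
    finally have top: "coeff ?s (degree s) = 0" by simp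
    have "degree (u * r) \<le> degree s"
      using degree_mult_le[of u r] degree_monom_le[of c "degree s - degree r"] False
      unfolding u_def by linarith
    then have le: "degree ?s \<le> degree s" by (simp add: degree_diff_le)
    show ?thesis
    proof (cases "degree ?s < degree s")
      case True
      from less.hyps[OF this sK] obtain g where
        g: "coeffs_in K g" "?s - g * r = 0 \<or> degree (?s - g * r) < degree r" by auto
      have "s - (u + g) * r = ?s - g * r" by (simp add: algebra_simps)
      then show ?thesis using g(2) coeffs_in_add[OF uK g(1)] by metis
    next
      case F: False
      then have "degree ?s = degree s" using le by simp
      then have "?s = 0" using top by (metis leading_coeff_0_iff)
      then show ?thesis using uK by (intro exI[of _ u]) simp
    qed
  qed
qed

text \<open>
  Descent on \<open>degree r\<close>: the pair \<open>(s - g r, f r - g s)\<close> with \<open>g = s div r\<close> is a smaller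
  solution of \<open>f r\<^sup>2 = s\<^sup>2\<close>.
\<close>

lemma square_of_rational_square:
  assumes "coeffs_in K f" "coeffs_in K r" "coeffs_in K s" "r \<noteq> 0" "f * r\<^sup>2 = s\<^sup>2"
  shows "\<exists>g. coeffs_in K g \<and> f = g\<^sup>2"
  using assms(2-)
proof (induction "degree r" arbitrary: r s rule: less_induct)
  case less
  from poly_division[OF less.prems(2,1,3)] obtain g where
    g: "coeffs_in K g" "s - g * r = 0 \<or> degree (s - g * r) < degree r" by auto
  show ?case
  proof (cases "s - g * r = 0")
    case True
    then have "s = g * r" by simp
    then have 0: "(f - g\<^sup>2) * (r * r) = 0" using less.prems(4) by (simp add: power2_eq_square algebra_simps)
    have 1: "coeffs_in K (f - g\<^sup>2)" using assms(1) g coeffs_in_diff coeffs_in_power by auto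
    have 2: "coeffs_in K (r * r)" "r * r \<noteq> 0" using less.prems degree_mult_in coeffs_in_mult by auto
    have "f - g\<^sup>2 = 0" using degree_mult_in(3)[OF 1 2(1) _ 2(2)] 0 by auto
    then show ?thesis using g by auto
  next
    case False
    let ?r = "s - g * r" and ?s = "f * r - g * s"
    have "f * ?r\<^sup>2 - ?s\<^sup>2 = (g\<^sup>2 - f) * (f * r\<^sup>2 - s\<^sup>2)"
      by (simp add: power2_eq_square algebra_simps)
    then have "f * ?r\<^sup>2 = ?s\<^sup>2" using less.prems(4) by simp
    moreover have "coeffs_in K ?r" "coeffs_in K ?s"
      using less.prems assms(1) g coeffs_in_diff coeffs_in_mult by auto
    ultimately show ?thesis using less.hyps[of ?r ?s] g False by auto
  qed
qed

end

section \<open>Stepanov's method\<close>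

lemma diff_dvd_power_diff: "(x::'r::comm_ring_1) - y dvd x ^ n - y ^ n"
  by (metis power_diff_sumr2 dvd_triv_left)

lemma pcompose_power: "pcompose (p ^ n) r = pcompose p r ^ n"
  by (induction n) (simp_all add: pcompose_1 pcompose_mult)

text \<open>In a bivariate polynomial the outer variable x is the point of expansion and the inner
  variable Y the displacement. Thus \<open>const_coeffs p\<close> is p(x) and
  \<open>taylor p\<close> below is p(x + Y).\<close>

definition const_coeffs :: "'r::comm_ring_1 poly \<Rightarrow> 'r poly poly" where
  "const_coeffs p = map_poly (\<lambda>c. [:c:]) p"

definition taylor :: "'r::comm_ring_1 poly \<Rightarrow> 'r poly poly" where
  "taylor p = pcompose (const_coeffs p) [:[:0, 1:], 1:]"

lemma coeff_const_coeffs: "coeff (const_coeffs p) n = [:coeff p n:]"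
  by (simp add: const_coeffs_def coeff_map_poly)

lemma poly_const_coeffs: "poly (const_coeffs p) u = pcompose p u"
  by (simp add: const_coeffs_def pcompose_altdef)

lemma degree_const_coeffs: "degree (const_coeffs p) \<le> degree p"
  by (rule degree_le) (simp add: coeff_const_coeffs coeff_eq_0)

lemma const_coeffs_diff: "const_coeffs (p - r) = const_coeffs p - const_coeffs r"
  by (intro poly_eqI) (simp add: coeff_const_coeffs)

lemma taylor_diff: "taylor (p - r) = taylor p - taylor r"
  by (simp add: taylor_def const_coeffs_diff pcompose_diff)

lemma poly_taylor: "poly (taylor p) [:a:] = pcompose p [:a, 1:]"
  by (simp add: taylor_def poly_pcompose poly_const_coeffs)

lemma degree_taylor: "degree (taylor p) \<le> degree p"
proof -
  have "degree [:[:0, 1:], 1::'r::comm_ring_1 poly:] \<le> 1" by simp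
  then have "degree (taylor p) \<le> degree (const_coeffs p) * 1"
    unfolding taylor_def by (intro order.trans[OF degree_pcompose_le] mult_le_mono2)
  then show ?thesis using degree_const_coeffs[of p] by simp
qed

lemma taylor_0: "taylor 0 = 0"
  by (simp add: taylor_def const_coeffs_def)

lemma taylor_pCons: "taylor (pCons a p) = [:[:a:]:] + smult [:0, 1:] (taylor p) + pCons 0 (taylor p)"
  by (simp add: taylor_def const_coeffs_def map_poly_pCons pcompose_pCons)

definition coeffs2_in :: "'r::comm_ring_1 set \<Rightarrow> 'r poly poly \<Rightarrow> bool" where
  "coeffs2_in K P \<longleftrightarrow> (\<forall>i. coeffs_in K (coeff P i))"

context ring_subfield
begin

lemma coeffs2_in_0: "coeffs2_in K 0"
  by (simp add: coeffs2_in_def coeffs_in_0)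

lemma coeffs2_in_add: "coeffs2_in K P \<Longrightarrow> coeffs2_in K Q \<Longrightarrow> coeffs2_in K (P + Q)"
  by (simp add: coeffs2_in_def coeffs_in_add)

lemma coeffs2_in_diff: "coeffs2_in K P \<Longrightarrow> coeffs2_in K Q \<Longrightarrow> coeffs2_in K (P - Q)"
  by (simp add: coeffs2_in_def coeffs_in_diff)

lemma coeffs2_in_mult: "coeffs2_in K P \<Longrightarrow> coeffs2_in K Q \<Longrightarrow> coeffs2_in K (P * Q)"
  by (simp add: coeffs2_in_def coeff_mult coeffs_in_sum coeffs_in_mult)

text \<open>The factor \<open>P\<close> absorbs the case \<open>n = 0\<close>, where the power is 1
  and may have its coefficient outside \<open>K\<close>.\<close>

lemma coeffs2_in_mult_power: "coeffs2_in K P \<Longrightarrow> coeffs2_in K Q \<Longrightarrow> coeffs2_in K (P * Q ^ n)"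
proof (induction n)
  case (Suc n)
  then have "coeffs2_in K (P * Q ^ n * Q)" using coeffs2_in_mult[of "P * Q ^ n" Q] by auto
  then show ?case by (simp only: power_Suc2 mult.assoc)
qed simp

lemma coeffs2_in_power: "coeffs2_in K P \<Longrightarrow> n > 0 \<Longrightarrow> coeffs2_in K (P ^ n)"
  using coeffs2_in_mult_power[of P P "n - 1"] by (cases n) auto

lemma coeffs2_in_sum: "(\<And>i. i \<in> I \<Longrightarrow> coeffs2_in K (f i)) \<Longrightarrow> coeffs2_in K (sum f I)"
  by (simp add: coeffs2_in_def coeff_sum coeffs_in_sum)

lemma coeffs2_in_of_nat_mult: "coeffs2_in K P \<Longrightarrow> coeffs2_in K (of_nat n * P)"
  by (induction n) (auto simp: coeffs2_in_0 coeffs2_in_add algebra_simps)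

lemma coeffs2_in_smult: "coeffs_in K p \<Longrightarrow> coeffs2_in K P \<Longrightarrow> coeffs2_in K (smult p P)"
  by (simp add: coeffs2_in_def coeffs_in_mult)

lemma coeffs2_in_monom_mult: "coeffs2_in K P \<Longrightarrow> coeffs2_in K (monom 1 n * P)"
  by (simp add: coeffs2_in_def coeff_monom_mult coeffs_in_0)

lemma coeffs2_in_const_coeffs: "coeffs_in K p \<Longrightarrow> coeffs2_in K (const_coeffs p)"
  by (simp add: coeffs2_in_def coeff_const_coeffs coeffs_in_pCons coeffs_in_0)
     (simp add: coeffs_in_def)

lemma coeffs2_in_taylor: "coeffs_in K p \<Longrightarrow> coeffs2_in K (taylor p)"
proof (induction p)
  case 0
  show ?case by (simp add: taylor_0 coeffs2_in_0)
next
  case (pCons a p)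
  then have a: "a \<in> K" and p: "coeffs2_in K (taylor p)" by (auto simp: coeffs_in_pCons)
  have "coeffs2_in K [:[:a:]:]"
    using a by (auto simp: coeffs2_in_def coeffs_in_0 coeffs_in_pCons coeff_pCons split: nat.splits)
  moreover have "coeffs2_in K (smult [:0, 1:] (taylor p))"
    using p by (simp add: coeffs2_in_def coeffs_in_pCons zero_mem)
  moreover have "coeffs2_in K (pCons 0 (taylor p))"
    using p by (auto simp: coeffs2_in_def coeffs_in_0 coeff_pCons split: nat.splits)
  ultimately show ?case unfolding taylor_pCons by (intro coeffs2_in_add)
qed

end

lemma linear_power_dvd_if_taylor:
  fixes p :: "'r::comm_ring_1 poly"
  assumes "monom 1 n dvd pcompose p [:a, 1:]"
  shows "[:- a, 1:] ^ n dvd p"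
proof -
  obtain w where w: "pcompose p [:a, 1:] = monom 1 n * w" using assms by (rule dvdE)
  have "pcompose (pcompose p [:a, 1:]) [:- a, 1:] = pcompose p (pcompose [:a, 1:] [:- a, 1:])"
    by (rule pcompose_assoc[symmetric])
  also have "pcompose [:a, 1:] [:- a, 1:] = [:0, 1:]" by (simp add: pcompose_pCons)
  finally have "p = pcompose (monom 1 n) [:- a, 1:] * pcompose w [:- a, 1:]"
    unfolding w by (simp add: pcompose_mult)
  moreover have "pcompose (monom 1 n) [:- a, 1:] = [:- a, 1:] ^ n"
    by (induction n) (simp_all add: monom_0 monom_Suc pcompose_pCons)
  ultimately show ?thesis by (metis dvd_triv_left)
qed

text \<open>
  The auxiliary polynomial of Stepanov's method is
  \<open>h = (\<Sum>j<J. X^(q j) (r\<^sub>j + s\<^sub>j f^g))\<close> with \<open>g = (q - 1) / 2\<close> and \<open>deg r\<^sub>j, deg s\<^sub>j < B\<close>.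
  At a point \<open>a\<close> with \<open>f(a)^g = \<epsilon>\<close> its Taylor expansion in \<open>Y = X - a\<close>, multiplied by \<open>f(a)^l\<close>,
  agrees modulo \<open>Y^l\<close> with the value at \<open>x = a\<close> of a polynomial in \<open>x\<close> and \<open>Y\<close>
  (\<open>stepanov_taylor\<close>, outer variable \<open>x\<close>, inner variable \<open>Y\<close>) whose degree in \<open>x\<close> is small.
\<close>

definition stepanov_part :: "nat \<Rightarrow> (nat \<times> nat \<times> bool \<Rightarrow> 'r::comm_ring_1) \<Rightarrow> bool \<Rightarrow> nat \<Rightarrow> 'r poly" where
  "stepanov_part B \<sigma> b j = (\<Sum>i<B. monom (\<sigma> (j, i, b)) i)"

definition stepanov_poly ::
  "nat \<Rightarrow> nat \<Rightarrow> nat \<Rightarrow> nat \<Rightarrow> 'r::comm_ring_1 poly \<Rightarrow> (nat \<times> nat \<times> bool \<Rightarrow> 'r) \<Rightarrow> 'r poly" where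
  "stepanov_poly q g J B f \<sigma> =
     (\<Sum>j<J. monom 1 (q * j) * (stepanov_part B \<sigma> True j + stepanov_part B \<sigma> False j * f ^ g))"

text \<open>Put \<delta> = f(x + Y) - f(x), a multiple of Y. In f(x)^l (f(x) + \<delta>)^g the terms
  with \<delta>^i, i \<ge> l, vanish modulo Y^l, and from the others the common factor f(x)^g can be
  taken out, which is the constant \<open>\<epsilon>\<close> at the relevant points. What remains is
  this sum. Multiplication by f(x)^l is what avoids negative powers of f.\<close>

definition stepanov_power :: "nat \<Rightarrow> nat \<Rightarrow> 'r::comm_ring_1 poly \<Rightarrow> 'r poly poly" where
  "stepanov_power g l f =
     (\<Sum>i<l. of_nat (g choose i) * (const_coeffs f ^ (l - i) * (taylor f - const_coeffs f) ^ i))"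

definition stepanov_taylor ::
  "nat \<Rightarrow> nat \<Rightarrow> nat \<Rightarrow> nat \<Rightarrow> 'r::comm_ring_1 \<Rightarrow> 'r poly \<Rightarrow> (nat \<times> nat \<times> bool \<Rightarrow> 'r) \<Rightarrow> 'r poly poly" where
  "stepanov_taylor g l J B \<epsilon> f \<sigma> =
     (\<Sum>j<J. monom 1 j * (const_coeffs f ^ l * taylor (stepanov_part B \<sigma> True j)
        + smult [:\<epsilon>:] (taylor (stepanov_part B \<sigma> False j) * stepanov_power g l f)))"

lemma coeff_stepanov_part: "coeff (stepanov_part B \<sigma> b j) i = (if i < B then \<sigma> (j, i, b) else 0)"
  by (simp add: stepanov_part_def coeff_sum if_distrib[of "\<lambda>x. coeff x i"])

lemma degree_stepanov_part: "B > 0 \<Longrightarrow> degree (stepanov_part B \<sigma> b j) \<le> B - 1"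
  by (rule degree_le) (auto simp: coeff_stepanov_part)

lemma stepanov_part_diff:
  assumes "\<And>i. i < B \<Longrightarrow> \<sigma> (j, i, b) = \<rho> (j, i, b) - \<rho>' (j, i, b)"
  shows "stepanov_part B \<sigma> b j = stepanov_part B \<rho> b j - stepanov_part B \<rho>' b j"
  by (intro poly_eqI) (simp add: coeff_stepanov_part assms)

lemma stepanov_taylor_diff:
  assumes "\<And>j i b. j < J \<Longrightarrow> i < B \<Longrightarrow> \<sigma> (j, i, b) = \<rho> (j, i, b) - \<rho>' (j, i, b)"
  shows "stepanov_taylor g l J B \<epsilon> f \<sigma> = stepanov_taylor g l J B \<epsilon> f \<rho> - stepanov_taylor g l J B \<epsilon> f \<rho>'"
  unfolding stepanov_taylor_def sum_subtractf[symmetric]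
proof (intro sum.cong refl)
  fix j assume "j \<in> {..<J}"
  then have *: "stepanov_part B \<sigma> b j = stepanov_part B \<rho> b j - stepanov_part B \<rho>' b j" for b
    using assms by (intro stepanov_part_diff) auto
  show "monom 1 j * (const_coeffs f ^ l * taylor (stepanov_part B \<sigma> True j)
        + smult [:\<epsilon>:] (taylor (stepanov_part B \<sigma> False j) * stepanov_power g l f))
    = monom 1 j * (const_coeffs f ^ l * taylor (stepanov_part B \<rho> True j)
        + smult [:\<epsilon>:] (taylor (stepanov_part B \<rho> False j) * stepanov_power g l f))
    - monom 1 j * (const_coeffs f ^ l * taylor (stepanov_part B \<rho>' True j)
        + smult [:\<epsilon>:] (taylor (stepanov_part B \<rho>' False j) * stepanov_power g l f))"
    unfolding * taylor_diff by (simp add: algebra_simps smult_diff_right)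
qed

lemma degree_stepanov_power:
  assumes "degree f \<le> d" shows "degree (stepanov_power g l f) \<le> d * l"
  unfolding stepanov_power_def
proof (rule degree_sum_le)
  fix i assume i: "i \<in> {..<l}"
  have 1: "degree (const_coeffs f) \<le> d" using degree_const_coeffs assms le_trans by blast
  have 2: "degree (taylor f - const_coeffs f) \<le> d"
    using degree_taylor[of f] 1 assms by (intro degree_diff_le) auto
  have "degree (const_coeffs f ^ (l - i) * (taylor f - const_coeffs f) ^ i)
      \<le> degree (const_coeffs f ^ (l - i)) + degree ((taylor f - const_coeffs f) ^ i)"
    by (rule degree_mult_le)
  also have "\<dots> \<le> d * (l - i) + d * i"
    using 1 2 by (meson add_mono degree_power_le le_trans mult_le_mono1)
  also have "\<dots> = d * l" using i by (simp add: add_mult_distrib2[symmetric])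
  finally have "degree (const_coeffs f ^ (l - i) * (taylor f - const_coeffs f) ^ i) \<le> d * l" .
  then show "degree (of_nat (g choose i) * (const_coeffs f ^ (l - i) * (taylor f - const_coeffs f) ^ i)) \<le> d * l"
    using degree_mult_le[of "of_nat (g choose i)" "const_coeffs f ^ (l - i) * (taylor f - const_coeffs f) ^ i"]
    by simp
qed simp

text \<open>The saving of the method: since a^q = a, the factor X^(q j) has turned into x^j, and f^g
  has turned into a constant times a polynomial of degree at most d l in x. Hence few linear
  conditions on the coefficients force a high order of vanishing at all points at once.\<close>

lemma degree_stepanov_taylor:
  fixes f :: "'r::comm_ring_1 poly"
  assumes "degree f \<le> d" "B > 0" "J > 0"
  shows "degree (stepanov_taylor g l J B \<epsilon> f \<sigma>) < J + d * l + B"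
proof -
  have "degree (stepanov_taylor g l J B \<epsilon> f \<sigma>) \<le> (J - 1) + (d * l + (B - 1))"
    unfolding stepanov_taylor_def
  proof (rule degree_sum_le)
    fix j assume j: "j \<in> {..<J}"
    let ?R = "taylor (stepanov_part B \<sigma> True j)" and ?S = "taylor (stepanov_part B \<sigma> False j)"
    have t: "degree (taylor (stepanov_part B \<sigma> b j)) \<le> B - 1" for b
      using degree_taylor degree_stepanov_part assms(2) le_trans by blast
    have "degree (const_coeffs f ^ l) \<le> d * l"
      using degree_power_le[of "const_coeffs f" l] degree_const_coeffs[of f] assms(1)
      by (meson le_trans mult_le_mono1)
    then have 1: "degree (const_coeffs f ^ l * ?R) \<le> d * l + (B - 1)"
      using degree_mult_le[of "const_coeffs f ^ l" ?R] t[of True] by linarith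
    have "degree (?S * stepanov_power g l f) \<le> d * l + (B - 1)"
      using degree_mult_le[of ?S "stepanov_power g l f"] t[of False] degree_stepanov_power[OF assms(1), of g l]
      by linarith
    then have 2: "degree (smult [:\<epsilon>:] (?S * stepanov_power g l f)) \<le> d * l + (B - 1)"
      using degree_smult_le le_trans by blast
    have "degree (const_coeffs f ^ l * ?R + smult [:\<epsilon>:] (?S * stepanov_power g l f)) \<le> d * l + (B - 1)"
      using 1 2 by (rule degree_add_le)
    moreover have "degree (monom (1::'r poly) j) \<le> J - 1" using degree_monom_le[of "1::'r poly" j] j by auto
    ultimately show "degree (monom 1 j * (const_coeffs f ^ l * ?R + smult [:\<epsilon>:] (?S * stepanov_power g l f)))
        \<le> (J - 1) + (d * l + (B - 1))"
      by (intro order.trans[OF degree_mult_le] add_mono)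
  qed simp
  then show ?thesis using assms by linarith
qed

context ring_subfield
begin

lemma coeffs_in_stepanov_part:
  assumes "\<And>i. i < B \<Longrightarrow> \<sigma> (j, i, b) \<in> K"
  shows "coeffs_in K (stepanov_part B \<sigma> b j)"
  using assms by (simp add: coeffs_in_def coeff_stepanov_part zero_mem)

lemma coeffs2_in_stepanov_power:
  assumes "coeffs_in K f" shows "coeffs2_in K (stepanov_power g l f)"
  unfolding stepanov_power_def using assms
  by (intro coeffs2_in_sum coeffs2_in_of_nat_mult coeffs2_in_mult_power coeffs2_in_power
      coeffs2_in_diff coeffs2_in_taylor coeffs2_in_const_coeffs) auto

lemma coeffs2_in_stepanov_taylor:
  assumes "coeffs_in K f" "\<epsilon> \<in> K" "l > 0" "\<And>j i b. j < J \<Longrightarrow> i < B \<Longrightarrow> \<sigma> (j, i, b) \<in> K"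
  shows "coeffs2_in K (stepanov_taylor g l J B \<epsilon> f \<sigma>)"
  unfolding stepanov_taylor_def using assms
  by (intro coeffs2_in_sum coeffs2_in_monom_mult coeffs2_in_add coeffs2_in_mult coeffs2_in_power
      coeffs2_in_smult coeffs2_in_taylor coeffs2_in_const_coeffs coeffs_in_stepanov_part
      coeffs2_in_stepanov_power) (auto simp: coeffs_in_pCons coeffs_in_0)

lemma coeffs_in_stepanov_poly:
  assumes "coeffs_in K f" "g > 0" "\<And>j i b. j < J \<Longrightarrow> i < B \<Longrightarrow> \<sigma> (j, i, b) \<in> K"
  shows "coeffs_in K (stepanov_poly q g J B f \<sigma>)"
  unfolding stepanov_poly_def using assms
  by (intro coeffs_in_sum coeffs_in_monom_mult coeffs_in_add coeffs_in_mult coeffs_in_power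
      coeffs_in_stepanov_part) auto

text \<open>Two congruences modulo Y^l are combined term by term: one for the powers of X^q
  (\<open>Xq\<close>), one for f^g (\<open>FG\<close>).\<close>

lemma stepanov_taylor_expansion:
  assumes p: "prime p" "card K = p ^ k" and f: "coeffs_in K f" and a: "a \<in> K"
    and \<epsilon>: "poly f a ^ g = \<epsilon>" and l: "l \<le> g" "l \<le> card K"
  shows "monom 1 l dvd smult (poly f a ^ l) (pcompose (stepanov_poly (card K) g J B f \<sigma>) [:a, 1:])
     - poly (stepanov_taylor g l J B \<epsilon> f \<sigma>) [:a:]"
proof -
  let ?q = "card K"
  define \<phi> where "\<phi> = [:poly f a:]"
  define F where "F = pcompose f [:a, 1:]"
  define \<delta> where "\<delta> = F - \<phi>"
  define G where "G = (\<Sum>i<l. of_nat (g choose i) * (\<phi> ^ (l - i) * \<delta> ^ i))"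
  define R where "R b j = pcompose (stepanov_part B \<sigma> b j) [:a, 1:]" for b j
  define W :: "'r poly" where "W = monom 1 l"
  have "poly \<delta> 0 = 0" unfolding \<delta>_def F_def \<phi>_def by (simp add: poly_pcompose)
  then have "[:0, 1:] dvd \<delta>" by (simp add: poly_eq_0_iff_dvd)
  then have \<delta>_dvd: "monom 1 i dvd \<delta> ^ i" for i
    using dvd_power_same[of "[:0, 1:]" \<delta> i] by (simp add: monom_altdef)
  have G: "poly (stepanov_power g l f) [:a:] = G"
    unfolding stepanov_power_def G_def
    by (simp add: poly_sum poly_const_coeffs poly_taylor pcompose_pCons_0 \<delta>_def F_def \<phi>_def)
  have \<phi>g: "\<phi> ^ g = [:\<epsilon>:]" unfolding \<phi>_def using \<epsilon> by (simp add: const_power)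
  \<comment> \<open>The binomial expansion around the value f(a): the tail from \<open>l\<close> on
    is divisible by Y^l because \<delta> is divisible by Y.\<close>
  have FG: "W dvd \<phi> ^ l * F ^ g - [:\<epsilon>:] * G"
  proof -
    have "F = \<delta> + \<phi>" by (simp add: \<delta>_def)
    then have "\<phi> ^ l * F ^ g = (\<Sum>i\<le>g. \<phi> ^ l * (of_nat (g choose i) * \<delta> ^ i * \<phi> ^ (g - i)))"
      by (simp add: binomial_ring sum_distrib_left)
    also have "{..g} = {..<l} \<union> {l..g}" using l by auto
    also have "(\<Sum>i\<in>{..<l} \<union> {l..g}. \<phi> ^ l * (of_nat (g choose i) * \<delta> ^ i * \<phi> ^ (g - i)))
       = (\<Sum>i<l. \<phi> ^ l * (of_nat (g choose i) * \<delta> ^ i * \<phi> ^ (g - i)))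
       + (\<Sum>i\<in>{l..g}. \<phi> ^ l * (of_nat (g choose i) * \<delta> ^ i * \<phi> ^ (g - i)))"
      by (rule sum.union_disjoint) auto
    also have "(\<Sum>i<l. \<phi> ^ l * (of_nat (g choose i) * \<delta> ^ i * \<phi> ^ (g - i))) = [:\<epsilon>:] * G"
      unfolding G_def sum_distrib_left \<phi>g[symmetric]
    proof (intro sum.cong refl)
      fix i assume "i \<in> {..<l}"
      then have eq: "\<phi> ^ l * \<phi> ^ (g - i) = \<phi> ^ g * \<phi> ^ (l - i)"
        using l by (simp add: power_add[symmetric] add.commute)
      have "\<phi> ^ l * (of_nat (g choose i) * \<delta> ^ i * \<phi> ^ (g - i)) =
          (\<phi> ^ l * \<phi> ^ (g - i)) * (of_nat (g choose i) * \<delta> ^ i)"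
        by (simp only: mult_ac)
      also have "\<dots> = (\<phi> ^ g * \<phi> ^ (l - i)) * (of_nat (g choose i) * \<delta> ^ i)"
        unfolding eq ..
      finally show "\<phi> ^ l * (of_nat (g choose i) * \<delta> ^ i * \<phi> ^ (g - i)) =
          \<phi> ^ g * (of_nat (g choose i) * (\<phi> ^ (l - i) * \<delta> ^ i))"
        by (simp only: mult_ac)
    qed
    finally have "\<phi> ^ l * F ^ g - [:\<epsilon>:] * G
      = (\<Sum>i\<in>{l..g}. \<phi> ^ l * (of_nat (g choose i) * \<delta> ^ i * \<phi> ^ (g - i)))" by simp
    moreover have "W dvd (\<Sum>i\<in>{l..g}. \<phi> ^ l * (of_nat (g choose i) * \<delta> ^ i * \<phi> ^ (g - i)))"
    proof (rule dvd_sum)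
      fix i assume "i \<in> {l..g}"
      then have "[:0, 1:] ^ l dvd [:0, 1::'r:] ^ i" by (intro le_imp_power_dvd) auto
      then have "W dvd \<delta> ^ i" using \<delta>_dvd[of i] unfolding W_def
        by (metis dvd_trans monom_altdef smult_1_left)
      then show "W dvd \<phi> ^ l * (of_nat (g choose i) * \<delta> ^ i * \<phi> ^ (g - i))"
        by (intro dvd_mult dvd_mult2)
    qed
    ultimately show ?thesis by simp
  qed
  have lin: "pcompose (monom 1 n) [:a, 1:] = [:a, 1:] ^ n" for n
    by (induction n) (simp_all add: monom_0 monom_Suc pcompose_pCons)
  \<comment> \<open>By the Frobenius identity (a + Y)^q = a + Y^q, and Y^q is a multiple of Y^l as l
    \<le> q.\<close>
  have Xq: "W dvd [:a, 1:] ^ (?q * j) - [:a ^ j:]" for j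
  proof -
    have "of_nat p * [:a:] = 0" using prime_mult_eq_0[OF p(2) a] by (simp add: of_nat_poly mult.commute)
    then have "([:a:] + [:0, 1:]) ^ ?q = [:a:] ^ ?q + [:0, 1:] ^ ?q"
      unfolding p(2) by (rule prime_power_add_power[OF p(1)])
    then have *: "[:a, 1:] ^ ?q = [:a:] + monom 1 ?q"
      using power_card[OF a] by (simp add: const_power monom_altdef)
    have "monom 1 ?q dvd ([:a, 1:] ^ ?q) ^ j - [:a:] ^ j"
      using diff_dvd_power_diff[of "[:a, 1:] ^ ?q" "[:a:]" j] unfolding * by simp
    moreover have "W dvd monom 1 ?q"
      unfolding W_def using l by (simp add: monom_altdef le_imp_power_dvd)
    ultimately show ?thesis using dvd_trans by (auto simp: power_mult const_power)
  qed
  have fl: "[:poly f a ^ l:] = \<phi> ^ l" unfolding \<phi>_def by (simp add: const_power)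
  have "smult (poly f a ^ l) (pcompose (stepanov_poly ?q g J B f \<sigma>) [:a, 1:])
     = \<phi> ^ l * (\<Sum>j<J. [:a, 1:] ^ (?q * j) * (R True j + R False j * F ^ g))"
    unfolding stepanov_poly_def pcompose_sum fl[symmetric]
    by (simp add: pcompose_mult pcompose_add lin R_def F_def pcompose_power)
  also have "\<dots> = (\<Sum>j<J. [:a, 1:] ^ (?q * j) * (\<phi> ^ l * R True j + R False j * (\<phi> ^ l * F ^ g)))"
    unfolding sum_distrib_left by (intro sum.cong refl) (simp add: algebra_simps)
  finally have 1: "smult (poly f a ^ l) (pcompose (stepanov_poly ?q g J B f \<sigma>) [:a, 1:])
     = (\<Sum>j<J. [:a, 1:] ^ (?q * j) * (\<phi> ^ l * R True j + R False j * (\<phi> ^ l * F ^ g)))" .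
  have 2: "poly (stepanov_taylor g l J B \<epsilon> f \<sigma>) [:a:]
     = (\<Sum>j<J. [:a ^ j:] * (\<phi> ^ l * R True j + R False j * ([:\<epsilon>:] * G)))"
    unfolding stepanov_taylor_def poly_sum
    by (intro sum.cong refl) (simp add: poly_monom poly_const_coeffs poly_taylor pcompose_pCons_0
        G R_def \<phi>_def[symmetric] const_power)
  show ?thesis
    unfolding 1 2 sum_subtractf[symmetric] W_def[symmetric]
  proof (rule dvd_sum)
    fix j assume "j \<in> {..<J}"
    let ?P = "[:a, 1:] ^ (?q * j)" and ?A = "[:a ^ j:]"
    have "?P * (\<phi> ^ l * R True j + R False j * (\<phi> ^ l * F ^ g)) - ?A * (\<phi> ^ l * R True j + R False j * ([:\<epsilon>:] * G))
      = (?P - ?A) * (\<phi> ^ l * R True j + R False j * (\<phi> ^ l * F ^ g)) + ?A * R False j * (\<phi> ^ l * F ^ g - [:\<epsilon>:] * G)"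
      by (simp only: algebra_simps)
    then show "W dvd ?P * (\<phi> ^ l * R True j + R False j * (\<phi> ^ l * F ^ g)) - ?A * (\<phi> ^ l * R True j + R False j * ([:\<epsilon>:] * G))"
      using Xq[of j] FG by (simp only: dvd_add dvd_mult dvd_mult2)
  qed
qed

end

text \<open>The j-th block starts at degree q j, so if all blocks below \<open>j0\<close> vanish,
  only block \<open>j0\<close> is visible in the degrees from q j0 to q j0 + q - 1.\<close>

lemma coeff_stepanov_poly_lowest:
  assumes "j0 < J" "i < q" "\<And>j. j < j0 \<Longrightarrow> stepanov_part B \<sigma> True j + stepanov_part B \<sigma> False j * f ^ g = 0"
  shows "coeff (stepanov_poly q g J B f \<sigma>) (q * j0 + i)
    = coeff (stepanov_part B \<sigma> True j0 + stepanov_part B \<sigma> False j0 * f ^ g) i"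
proof -
  define w where "w j = stepanov_part B \<sigma> True j + stepanov_part B \<sigma> False j * f ^ g" for j
  have "coeff (stepanov_poly q g J B f \<sigma>) (q * j0 + i) = (\<Sum>j<J. coeff (monom 1 (q * j) * w j) (q * j0 + i))"
    by (simp add: stepanov_poly_def coeff_sum w_def)
  also have "\<dots> = (\<Sum>j<J. if j = j0 then coeff (w j0) i else 0)"
  proof (intro sum.cong refl)
    fix j assume "j \<in> {..<J}"
    consider "j < j0" | "j = j0" | "j > j0" by linarith
    then show "coeff (monom 1 (q * j) * w j) (q * j0 + i) = (if j = j0 then coeff (w j0) i else 0)"
    proof cases
      case 1
      then show ?thesis using assms(3)[of j] by (simp add: w_def)
    next
      case 2
      then show ?thesis by (simp add: coeff_monom_mult)
    next
      case 3
      then have "q * Suc j0 \<le> q * j" by (intro mult_le_mono2) simp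
      then show ?thesis using 3 assms(2) by (simp add: coeff_monom_mult)
    qed
  qed
  also have "\<dots> = coeff (w j0) i" using assms(1) by simp
  finally show ?thesis by (simp add: w_def)
qed

section \<open>Nonvanishing of the auxiliary polynomial and choice of its coefficients\<close>

context ring_subfield
begin

text \<open>Write f = f0 + X f'. The Frobenius identity, applied to this sum alone, gives f^q = f0 +
  X^q f'^q.\<close>

lemma power_card_poly:
  assumes p: "prime p" "card K = p ^ k" and f: "coeffs_in K f"
  shows "monom 1 (card K) dvd f ^ card K - [:poly f 0:]"
proof -
  obtain f0 f' where ff: "f = pCons f0 f'" by (cases f)
  have f0: "f0 \<in> K" using f by (simp add: ff coeffs_in_pCons)
  have "of_nat p * [:f0:] = 0" using prime_mult_eq_0[OF p(2) f0] by (simp add: of_nat_poly mult.commute)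
  then have "([:f0:] + [:0, 1:] * f') ^ card K = [:f0:] ^ card K + ([:0, 1:] * f') ^ card K"
    unfolding p(2) by (rule prime_power_add_power[OF p(1)])
  moreover have "f = [:f0:] + [:0, 1:] * f'" by (simp add: ff)
  ultimately have "f ^ card K = [:f0:] + [:0, 1:] ^ card K * f' ^ card K"
    using power_card[OF f0] by (metis const_power power_mult_distrib)
  then have "f ^ card K - [:poly f 0:] = monom 1 (card K) * f' ^ card K"
    by (simp add: ff monom_altdef)
  then show ?thesis by (metis dvd_triv_left)
qed

text \<open>Multiplying by the conjugate (r - s f^g) f and using 2 g + 1 = q gives r^2 f = s^2 f^q =
  f(0) s^2 modulo X^q. Both sides have degree below q, so they are equal, and since f(0) = c^2 this
  reads f r^2 = (c s)^2. As f is not a square, r = 0 and therefore s = 0.\<close>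

lemma stepanov_pair_eq_0:
  assumes p: "prime p" "card K = p ^ k" and q: "card K = 2 * g + 1"
    and f: "coeffs_in K f" "poly f 0 = c\<^sup>2" "c \<in> K" "c \<noteq> 0" "\<not> (\<exists>g. coeffs_in K g \<and> f = g\<^sup>2)"
    and r: "coeffs_in K r" "2 * degree r + degree f < card K"
    and s: "coeffs_in K s" "2 * degree s < card K"
    and d: "monom 1 (card K) dvd r + s * f ^ g"
  shows "r = 0 \<and> s = 0"
proof -
  let ?W = "monom (1::'r) (card K)"
  have "r\<^sup>2 * f - smult (c\<^sup>2) (s\<^sup>2) = (r + s * f ^ g) * (r - s * f ^ g) * f + s\<^sup>2 * (f ^ card K - [:c\<^sup>2:])"
    unfolding q by (simp add: power2_eq_square algebra_simps power_add mult_2_right)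
  moreover have "?W dvd f ^ card K - [:c\<^sup>2:]" using power_card_poly[OF p f(1)] f(2) by simp
  ultimately have W: "?W dvd r\<^sup>2 * f - smult (c\<^sup>2) (s\<^sup>2)" using d by (simp only: dvd_add dvd_mult dvd_mult2)
  have "degree (r\<^sup>2 * f) < card K"
    using degree_mult_le[of "r\<^sup>2" f] degree_power_le[of r 2] r(2) by linarith
  moreover have "degree (smult (c\<^sup>2) (s\<^sup>2)) < card K"
    using degree_smult_le[of "c\<^sup>2" "s\<^sup>2"] degree_power_le[of s 2] s(2) by linarith
  ultimately have deg: "degree (r\<^sup>2 * f - smult (c\<^sup>2) (s\<^sup>2)) < card K" by (rule degree_diff_less)
  have "r\<^sup>2 * f - smult (c\<^sup>2) (s\<^sup>2) = 0"
  proof (rule poly_eqI)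
    fix i
    show "coeff (r\<^sup>2 * f - smult (c\<^sup>2) (s\<^sup>2)) i = coeff 0 i"
    proof (cases "i < card K")
      case True
      then show ?thesis using W unfolding monom_1_dvd_iff' by (simp only: coeff_0)
    next
      case False
      then have "degree (r\<^sup>2 * f - smult (c\<^sup>2) (s\<^sup>2)) < i" using deg by linarith
      then show ?thesis by (simp only: coeff_eq_0 coeff_0)
    qed
  qed
  then have eq: "f * r\<^sup>2 = (smult c s)\<^sup>2" by (simp add: power2_eq_square mult.commute)
  have cs: "coeffs_in K (smult c s)" using f s by (simp add: coeffs_in_smult)
  have r0: "r = 0" using square_of_rational_square[OF f(1) r(1) cs _ eq] f(5) by blast
  have "smult c s = 0"
  proof (rule ccontr)
    assume "smult c s \<noteq> 0"
    then have "smult c s * smult c s \<noteq> 0" using degree_mult_in(3)[OF cs cs] by blast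
    then show False using eq r0 by (simp add: power2_eq_square)
  qed
  have "coeff s i = 0" for i
  proof -
    have "c * coeff s i = 0" using \<open>smult c s = 0\<close> by (metis coeff_0 coeff_smult)
    then show ?thesis using mult_eq_0[of c "coeff s i"] f s by (simp add: coeffs_in_def)
  qed
  then show ?thesis using r0 by (simp add: poly_eq_iff)
qed

text \<open>If the whole sum vanished, then block by block from below each block would be divisible
  by X^q, hence zero by \<open>stepanov_pair_eq_0\<close>, and with it all its coefficients.\<close>

lemma stepanov_poly_neq_0:
  assumes p: "prime p" "card K = p ^ k" and q: "card K = 2 * g + 1"
    and f: "coeffs_in K f" "poly f 0 = c\<^sup>2" "c \<in> K" "c \<noteq> 0" "\<not> (\<exists>g. coeffs_in K g \<and> f = g\<^sup>2)"
    and B: "B > 0" "2 * (B - 1) + degree f < card K"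
    and \<sigma>: "\<And>j i b. j < J \<Longrightarrow> i < B \<Longrightarrow> \<sigma> (j, i, b) \<in> K"
    and nz: "j < J" "i < B" "\<sigma> (j, i, b) \<noteq> 0"
  shows "stepanov_poly (card K) g J B f \<sigma> \<noteq> 0"
proof
  assume h: "stepanov_poly (card K) g J B f \<sigma> = 0"
  have all: "stepanov_part B \<sigma> True j = 0 \<and> stepanov_part B \<sigma> False j = 0" if "j < J" for j
    using that
  proof (induction j rule: less_induct)
    case (less j)
    have "monom 1 (card K) dvd stepanov_part B \<sigma> True j + stepanov_part B \<sigma> False j * f ^ g"
      unfolding monom_1_dvd_iff'
    proof (intro allI impI)
      fix i assume "i < card K"
      then show "coeff (stepanov_part B \<sigma> True j + stepanov_part B \<sigma> False j * f ^ g) i = 0"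
        using coeff_stepanov_poly_lowest[of j J i "card K" B \<sigma> f g] less h by simp
    qed
    moreover have "coeffs_in K (stepanov_part B \<sigma> b j)" for b
      using coeffs_in_stepanov_part \<sigma> less by auto
    moreover have "2 * degree (stepanov_part B \<sigma> b j) + degree f < card K" for b
      using degree_stepanov_part[OF B(1), of \<sigma> b j] B(2) by linarith
    ultimately show ?case
      by (intro stepanov_pair_eq_0[OF p q f]) (auto dest: add_lessD1)
  qed
  have "coeff (stepanov_part B \<sigma> b j) i = \<sigma> (j, i, b)" using nz by (simp add: coeff_stepanov_part)
  moreover have "stepanov_part B \<sigma> b j = 0" using all[OF nz(1)] by (cases b) auto
  ultimately show False using nz by simp
qed

text \<open>Counting replaces linear algebra: there are (card K)^(2 J B) choices of coefficients but
  at most (card K)^(l D) values of the conditions. The conditions are additive, so the difference of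
  two colliding choices satisfies them with value 0.\<close>

lemma ex_stepanov_coeffs:
  assumes f: "coeffs_in K f" "degree f \<le> d" and \<epsilon>: "\<epsilon> \<in> K" and l: "l > 0" and JB: "J > 0" "B > 0"
    and count: "l * (J + d * l + B) < 2 * J * B"
  obtains \<sigma> where "\<And>j i b. j < J \<Longrightarrow> i < B \<Longrightarrow> \<sigma> (j, i, b) \<in> K"
    "\<exists>j<J. \<exists>i<B. \<exists>b. \<sigma> (j, i, b) \<noteq> 0"
    "\<And>m k. k < l \<Longrightarrow> coeff (coeff (stepanov_taylor g l J B \<epsilon> f \<sigma>) m) k = 0"
proof -
  define D where "D = J + d * l + B"
  define I where "I = {..<J} \<times> {..<B} \<times> (UNIV :: bool set)"
  define C where "C = {..<l} \<times> {..<D}"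
  define \<Phi> where "\<Phi> \<rho> = (\<lambda>(k, m)\<in>C. coeff (coeff (stepanov_taylor g l J B \<epsilon> f \<rho>) m) k)" for \<rho>
  have card_I: "card I = 2 * J * B" and fin_I: "finite I" by (simp_all add: I_def card_cartesian_product)
  have card_C: "card C = l * D" and fin_C: "finite C" by (simp_all add: C_def)
  have "\<Phi> ` (I \<rightarrow>\<^sub>E K) \<subseteq> C \<rightarrow>\<^sub>E K"
  proof
    fix y assume "y \<in> \<Phi> ` (I \<rightarrow>\<^sub>E K)"
    then obtain \<rho> where \<rho>: "\<rho> \<in> I \<rightarrow>\<^sub>E K" "y = \<Phi> \<rho>" by auto
    then have "coeffs2_in K (stepanov_taylor g l J B \<epsilon> f \<rho>)"
      using f \<epsilon> l by (intro coeffs2_in_stepanov_taylor) (auto simp: I_def PiE_def Pi_def)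
    then show "y \<in> C \<rightarrow>\<^sub>E K" unfolding \<rho> \<Phi>_def by (auto simp: coeffs2_in_def coeffs_in_def)
  qed
  then have "card (\<Phi> ` (I \<rightarrow>\<^sub>E K)) \<le> card K ^ (l * D)"
    using fin_C fin card_mono[of "C \<rightarrow>\<^sub>E K"] by (simp add: finite_PiE card_PiE card_C)
  also have "\<dots> < card K ^ (2 * J * B)"
    using count card_gt_1 unfolding D_def by (intro power_strict_increasing) auto
  also have "\<dots> = card (I \<rightarrow>\<^sub>E K)" using fin_I by (simp add: card_PiE card_I)
  finally have "\<not> inj_on \<Phi> (I \<rightarrow>\<^sub>E K)" using pigeonhole by blast
  then obtain \<rho> \<rho>' where \<rho>: "\<rho> \<in> I \<rightarrow>\<^sub>E K" "\<rho>' \<in> I \<rightarrow>\<^sub>E K" "\<rho> \<noteq> \<rho>'" "\<Phi> \<rho> = \<Phi> \<rho>'"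
    by (auto simp: inj_on_def)
  define \<sigma> where "\<sigma> i = \<rho> i - \<rho>' i" for i
  obtain i where i: "i \<in> I" "\<rho> i \<noteq> \<rho>' i" using \<rho> by (metis PiE_ext)
  show thesis
  proof (rule that[of \<sigma>])
    show mem: "\<sigma> (j, i, b) \<in> K" if "j < J" "i < B" for j i b
      unfolding \<sigma>_def using \<rho> that by (intro diff_mem) (auto simp: I_def PiE_def Pi_def)
    show "\<exists>j<J. \<exists>i<B. \<exists>b. \<sigma> (j, i, b) \<noteq> 0" using i by (auto simp: I_def \<sigma>_def)
    show "coeff (coeff (stepanov_taylor g l J B \<epsilon> f \<sigma>) m) k = 0" if k: "k < l" for m k
    proof (cases "m < D")
      case True
      then have "(k, m) \<in> C" using k by (simp add: C_def)
      then have "coeff (coeff (stepanov_taylor g l J B \<epsilon> f \<rho>) m) k = coeff (coeff (stepanov_taylor g l J B \<epsilon> f \<rho>') m) k"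
        using fun_cong[OF \<rho>(4), of "(k, m)"] by (simp add: \<Phi>_def)
      moreover have "stepanov_taylor g l J B \<epsilon> f \<sigma> = stepanov_taylor g l J B \<epsilon> f \<rho> - stepanov_taylor g l J B \<epsilon> f \<rho>'"
        by (intro stepanov_taylor_diff) (simp add: \<sigma>_def)
      ultimately show ?thesis by simp
    next
      case False
      then have "degree (stepanov_taylor g l J B \<epsilon> f \<sigma>) < m"
        using degree_stepanov_taylor[OF f(2) JB(2,1), of g l \<epsilon> \<sigma>] unfolding D_def by linarith
      then show ?thesis by (simp add: coeff_eq_0)
    qed
  qed
qed

lemma degree_stepanov_poly_le:
  fixes f :: "'r poly"
  assumes "degree f \<le> d" "B > 0" "J > 0"
  shows "degree (stepanov_poly q g J B f \<sigma>) \<le> q * (J - 1) + (B - 1) + d * g"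
  unfolding stepanov_poly_def
proof (rule degree_sum_le)
  fix j assume j: "j \<in> {..<J}"
  have t: "degree (stepanov_part B \<sigma> b j) \<le> B - 1" for b
    using degree_stepanov_part assms(2) by blast
  have "degree (f ^ g) \<le> d * g"
    using degree_power_le[of f g] assms(1) by (meson le_trans mult_le_mono1)
  then have "degree (stepanov_part B \<sigma> False j * f ^ g) \<le> (B - 1) + d * g"
    using degree_mult_le[of "stepanov_part B \<sigma> False j" "f ^ g"] t[of False] by linarith
  then have 1: "degree (stepanov_part B \<sigma> True j + stepanov_part B \<sigma> False j * f ^ g) \<le> (B - 1) + d * g"
    using t[of True] by (intro degree_add_le) auto
  have "q * j \<le> q * (J - 1)" using j by (intro mult_le_mono2) auto
  then have 2: "degree (monom (1::'r) (q * j)) \<le> q * (J - 1)"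
    using degree_monom_le[of "1::'r" "q * j"] by linarith
  show "degree (monom 1 (q * j) * (stepanov_part B \<sigma> True j + stepanov_part B \<sigma> False j * f ^ g))
      \<le> q * (J - 1) + (B - 1) + d * g"
    using degree_mult_le[of "monom (1::'r) (q * j)" "stepanov_part B \<sigma> True j + stepanov_part B \<sigma> False j * f ^ g"] 1 2
    by linarith
qed simp

text \<open>The auxiliary polynomial vanishes to order 2 n at every point counted, and its degree is
  at most q n + 3 q. So the count is at most q/2 + 3 q/(2 n), and the best \<open>n\<close> is of
  order sqrt q.\<close>

lemma stepanov_bound_nat:
  assumes p: "prime p" "card K = p ^ k" and q: "card K = 2 * g + 1"
    and f: "coeffs_in K f" "degree f = 4" "poly f 0 = c\<^sup>2" "c \<in> K" "c \<noteq> 0" "\<not> (\<exists>g. coeffs_in K g \<and> f = g\<^sup>2)"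
    and n: "n > 0" "25 * n\<^sup>2 \<le> card K"
  shows "2 * n * card {a \<in> K. poly f a ^ g = \<epsilon> \<and> poly f a \<noteq> 0} \<le> card K * n + 3 * card K"
proof -
  let ?q = "card K" and ?Z = "{a \<in> K. poly f a ^ g = \<epsilon> \<and> poly f a \<noteq> 0}"
  \<comment> \<open>\<open>B\<close> is the largest value with 2 (B - 1) + 4 < q. With these choices
    the counting inequality reduces to 18 n^2 + 2 n < 2 B = q - 3, which 25 n^2 \<le> q
    guarantees.\<close>
  define l J B where "l = 2 * n" and "J = n + 1" and "B = g - 1"
  have n2: "n \<le> n\<^sup>2" by (simp add: power2_eq_square)
  have g: "g \<ge> 12" using n q n2 by linarith
  have B: "B > 0" "2 * (B - 1) + degree f < ?q" using g q f unfolding B_def by auto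
  have "l * (J + 4 * l + B) = 18 * n\<^sup>2 + 2 * n + 2 * n * B"
    unfolding l_def J_def by (simp add: power2_eq_square algebra_simps)
  moreover have "2 * J * B = 2 * n * B + 2 * B" unfolding J_def by (simp add: algebra_simps)
  moreover have "2 * B + 3 = ?q" using q g unfolding B_def by simp
  moreover have "1 \<le> n\<^sup>2" using n n2 by linarith
  ultimately have count: "l * (J + 4 * l + B) < 2 * J * B" using n n2 by linarith
  have l: "l > 0" "l \<le> g" "l \<le> ?q" using n n2 q unfolding l_def by linarith+
  show ?thesis
  \<comment> \<open>If there is a point in \<open>?Z\<close>, then \<open>\<epsilon>\<close> is a
    power of a value of f and so belongs to \<open>K\<close>.\<close>
  proof (cases "?Z = {}")
    case True
    then show ?thesis by (simp only: card.empty mult_0_right le0)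
  next
    case False
    then obtain a where "a \<in> K" "poly f a ^ g = \<epsilon>" by auto
    then have \<epsilon>: "\<epsilon> \<in> K" using f poly_mem power_mem g by auto
    have f4: "degree f \<le> 4" and J: "J > 0" using f by (simp_all add: J_def)
    obtain \<sigma> where \<sigma>: "\<And>j i b. j < J \<Longrightarrow> i < B \<Longrightarrow> \<sigma> (j, i, b) \<in> K"
      "\<exists>j<J. \<exists>i<B. \<exists>b. \<sigma> (j, i, b) \<noteq> 0"
      "\<And>m k. k < l \<Longrightarrow> coeff (coeff (stepanov_taylor g l J B \<epsilon> f \<sigma>) m) k = 0"
      by (rule ex_stepanov_coeffs[OF f(1) f4 \<epsilon> l(1) J B(1) count, of g]) (rule that)
    let ?h = "stepanov_poly ?q g J B f \<sigma>"
    have hK: "coeffs_in K ?h" using coeffs_in_stepanov_poly[OF f(1), of g J B \<sigma>] \<sigma>(1) g by auto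
    have h0: "?h \<noteq> 0" using \<sigma>(2) stepanov_poly_neq_0[OF p q f(1,3-6) B, where \<sigma> = \<sigma> and J = J] \<sigma>(1) by blast
    have "[:- a, 1:] ^ l dvd ?h" if a: "a \<in> ?Z" for a
    proof (rule linear_power_dvd_if_taylor)
      have aK: "a \<in> K" "poly f a ^ g = \<epsilon>" using a by auto
      let ?w = "poly f a ^ l" and ?H = "stepanov_taylor g l J B \<epsilon> f \<sigma>"
      have w: "?w \<in> K" "?w \<noteq> 0" using a f l poly_mem power_mem power_eq_0 by auto
      \<comment> \<open>By the choice of \<open>\<sigma>\<close> each coefficient with respect to x
        is already divisible by Y^l, so no evaluation at a point of \<open>K\<close> can destroy
        this.\<close>
      have "monom 1 l dvd poly ?H [:a:]"
        unfolding monom_1_dvd_iff' using \<sigma>(3) by (simp add: poly_altdef coeff_sum const_power)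
      with stepanov_taylor_expansion[OF p f(1) aK l(2,3), of J B \<sigma>]
      have "monom 1 l dvd smult ?w (pcompose ?h [:a, 1:])" by (simp only: dvd_diff_left_iff)
      then have "monom 1 l dvd smult (inv_in ?w) (smult ?w (pcompose ?h [:a, 1:]))" by (rule dvd_smult)
      also have "smult (inv_in ?w) (smult ?w (pcompose ?h [:a, 1:])) = pcompose (smult e ?h) [:a, 1:]"
        using inv_in(3)[OF w] by (simp add: pcompose_smult)
      finally show "monom 1 l dvd pcompose ?h [:a, 1:]" using smult_e[OF hK] by simp
    qed
    then have "(\<Sum>a\<in>?Z. l) \<le> degree ?h" by (intro sum_multiplicities_le_degree[OF hK h0]) auto
    also have "degree ?h \<le> ?q * (J - 1) + (B - 1) + 4 * g"
      using degree_stepanov_poly_le[of f 4 B J ?q g \<sigma>] f B unfolding J_def by auto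
    also have "\<dots> \<le> ?q * n + 3 * ?q" unfolding J_def using q B_def by simp
    finally show ?thesis by (simp add: l_def mult_ac)
  qed
qed

end

section \<open>Split norm equations\<close>

context ring_subfield
begin

lemma power_card_minus_1_eq: "x \<in> K \<Longrightarrow> x \<noteq> 0 \<Longrightarrow> x ^ (card K - 1) = e"
  using power_card_minus_1[of x] mult_e[OF power_mem[of x "card K - 1"]] card_gt_1 by simp

lemma card_power_roots_le:
  assumes "m > 0" "c \<in> K"
  shows "card {x \<in> K. x ^ m = c} \<le> m"
proof -
  let ?p = "monom e m - [:c:]"
  have c0: "coeffs_in K ?p" using assms e_mem
    by (intro coeffs_in_diff coeffs_in_monom) (auto simp: coeffs_in_pCons coeffs_in_0)
  have "coeff ?p m = e" using assms by (simp add: coeff_pCons split: nat.splits)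
  then have n0: "?p \<noteq> 0" using e_neq_0 by (metis coeff_0)
  have "degree ?p \<le> m" by (intro degree_diff_le degree_monom_le) simp
  moreover have "{x \<in> K. poly ?p x = 0} = {x \<in> K. x ^ m = c}"
    using e_mult power_mem assms(1) by (auto simp: poly_monom)
  ultimately show ?thesis using card_roots_le[OF c0 n0] by simp
qed

text \<open>No generator of the multiplicative group is used: the m m' nonzero elements are covered
  by at most m' fibres of the m-th power map, each of size at most m, so both bounds are
  attained.\<close>

lemma power_fibres:
  assumes "card K - 1 = m * m'"
  shows "card {c \<in> K. c ^ m' = e} = m'"
    and "\<And>c. c \<in> K \<Longrightarrow> c ^ m' = e \<Longrightarrow> card {x \<in> K. x ^ m = c} = m"
proof -
  have m: "m > 0" "m' > 0" using assms card_gt_1 by (auto intro: Nat.gr0I)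
  let ?V = "{c \<in> K. c ^ m' = e}"
  let ?F = "\<lambda>c. {x \<in> K. x ^ m = c}"
  have V: "finite ?V" "card ?V \<le> m'" using fin card_power_roots_le[OF m(2) e_mem] by auto
  have F: "card (?F c) \<le> m" if "c \<in> K" for c using card_power_roots_le m(1) that by blast
  have "K - {0} \<subseteq> (\<Union>c\<in>?V. ?F c)"
  proof
    fix x assume x: "x \<in> K - {0}"
    then have "(x ^ m) ^ m' = e" using power_card_minus_1_eq[of x] assms by (simp add: power_mult)
    then show "x \<in> (\<Union>c\<in>?V. ?F c)" using x m power_mem by auto
  qed
  then have "m * m' \<le> card (\<Union>c\<in>?V. ?F c)"
    using assms fin zero_mem card_mono[of "\<Union>c\<in>?V. ?F c" "K - {0}"] V by simp
  also have "\<dots> \<le> (\<Sum>c\<in>?V. card (?F c))" using V(1) by (rule card_UN_le)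
  finally have tot: "m * m' \<le> (\<Sum>c\<in>?V. card (?F c))" .
  also have "\<dots> \<le> (\<Sum>c\<in>?V. m)" using F by (intro sum_mono) auto
  finally have "m' \<le> card ?V" using m by (simp add: mult.commute)
  then show Vm: "card ?V = m'" using V by simp
  fix c assume c: "c \<in> K" "c ^ m' = e"
  show "card (?F c) = m"
  proof (rule ccontr)
    assume "card (?F c) \<noteq> m"
    then have "card (?F c) < m" using F[OF c(1)] by simp
    then have "(\<Sum>c\<in>?V. card (?F c)) < (\<Sum>c\<in>?V. m)"
      using F c V(1) by (intro sum_strict_mono_ex1) auto
    then show False using tot Vm by (simp add: mult.commute)
  qed
qed

text \<open>These are the norm equations of the split algebras K^2, K^3, K^4; the cardinalities are
  the numbers T_2, T_3, T_4 in the notation of the overview.\<close>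

definition split2 :: "'r \<Rightarrow> 'r \<Rightarrow> ('r \<times> 'r) set" where
  "split2 a b = {(x, y). x \<in> K \<and> y \<in> K \<and> x * y = a \<and> (x + e) * (y + e) = b}"

definition split3 :: "'r \<Rightarrow> 'r \<Rightarrow> ('r \<times> 'r \<times> 'r) set" where
  "split3 a b = {(z, x, y). z \<in> K \<and> x \<in> K \<and> y \<in> K \<and> z * (x * y) = a \<and> (z + e) * ((x + e) * (y + e)) = b}"

definition split4 :: "'r \<Rightarrow> 'r \<Rightarrow> ('r \<times> 'r \<times> 'r \<times> 'r) set" where
  "split4 a b = {(w, z, x, y). w \<in> K \<and> z \<in> K \<and> x \<in> K \<and> y \<in> K
     \<and> w * (z * (x * y)) = a \<and> (w + e) * ((z + e) * ((x + e) * (y + e))) = b}"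

lemma mult_eq_iff_inv: "x \<in> K \<Longrightarrow> x \<noteq> 0 \<Longrightarrow> y \<in> K \<Longrightarrow> a \<in> K \<Longrightarrow> x * y = a \<longleftrightarrow> y = inv_in x * a"
proof
  assume *: "x \<in> K" "x \<noteq> 0" "y \<in> K" "x * y = a"
  have "inv_in x * a = (inv_in x * x) * y" using * by (simp add: mult.assoc)
  then show "y = inv_in x * a" using inv_in[OF *(1,2)] e_mult *(3) by simp
next
  assume *: "x \<in> K" "x \<noteq> 0" "a \<in> K" "y = inv_in x * a"
  have "x * y = (x * inv_in x) * a" using * by (simp add: mult.assoc)
  then show "x * y = a" using inv_in[OF *(1,2)] e_mult *(3) by simp
qed

lemma plus_e_neq_0: "x \<noteq> - e \<Longrightarrow> x + e \<noteq> 0"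
  by (metis add_eq_0_iff2)

lemma card_split_step:
  assumes "a \<in> K" "b \<in> K" "a \<noteq> 0" "b \<noteq> 0" "finite T"
    and T: "\<And>t. t \<in> T \<Longrightarrow> f t \<in> K \<and> g t \<in> K"
  shows "card {(z, t). z \<in> K \<and> t \<in> T \<and> z * f t = a \<and> (z + e) * g t = b}
    = (\<Sum>z\<in>K - {0, - e}. card {t \<in> T. f t = inv_in z * a \<and> g t = inv_in (z + e) * b})"
proof -
  have "{(z, t). z \<in> K \<and> t \<in> T \<and> z * f t = a \<and> (z + e) * g t = b}
    = Sigma (K - {0, - e}) (\<lambda>z. {t \<in> T. f t = inv_in z * a \<and> g t = inv_in (z + e) * b})"
    (is "?A = ?B")
  proof (rule Set.set_eqI)
    fix zt :: "'r \<times> 'a"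
    obtain z t where zt: "zt = (z, t)" by (cases zt)
    have "z \<in> K \<and> t \<in> T \<and> z * f t = a \<and> (z + e) * g t = b \<longleftrightarrow>
       z \<in> K - {0, - e} \<and> t \<in> T \<and> f t = inv_in z * a \<and> g t = inv_in (z + e) * b" (is "?L \<longleftrightarrow> ?R")
    proof (cases "z \<in> K \<and> z \<noteq> 0 \<and> z \<noteq> - e \<and> t \<in> T")
      case True
      then have "z + e \<in> K" "z + e \<noteq> 0" using add_mem e_mem plus_e_neq_0 by auto
      then show ?thesis using True T assms(1,2) mult_eq_iff_inv[of z "f t" a] mult_eq_iff_inv[of "z + e" "g t" b]
        by auto
    next
      case False
      then show ?thesis using assms(3,4) by auto
    qed
    then show "zt \<in> ?A \<longleftrightarrow> zt \<in> ?B" unfolding zt by auto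
  qed
  then show ?thesis using fin assms(5) by simp
qed

lemma finite_split2: "finite (split2 a b)"
  by (rule finite_subset[of _ "K \<times> K"]) (auto simp: split2_def fin)

lemma card_split3:
  assumes "a \<in> K" "b \<in> K" "a \<noteq> 0" "b \<noteq> 0"
  shows "card (split3 a b) = (\<Sum>z\<in>K - {0, - e}. card (split2 (inv_in z * a) (inv_in (z + e) * b)))"
proof -
  have 1: "split3 a b = {(z, t). z \<in> K \<and> t \<in> K \<times> K \<and> z * (case t of (x, y) \<Rightarrow> x * y) = a
      \<and> (z + e) * (case t of (x, y) \<Rightarrow> (x + e) * (y + e)) = b}"
    by (auto simp: split3_def)
  have 2: "split2 u v = {t \<in> K \<times> K. (case t of (x, y) \<Rightarrow> x * y) = u
      \<and> (case t of (x, y) \<Rightarrow> (x + e) * (y + e)) = v}" for u v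
    by (auto simp: split2_def)
  show ?thesis unfolding 1 2 using assms fin mult_mem add_mem e_mem
    by (intro card_split_step) auto
qed

lemma card_split4:
  assumes "a \<in> K" "b \<in> K" "a \<noteq> 0" "b \<noteq> 0"
  shows "card (split4 a b) = (\<Sum>w\<in>K - {0, - e}. card (split3 (inv_in w * a) (inv_in (w + e) * b)))"
proof -
  have 1: "split4 a b = {(z, t). z \<in> K \<and> t \<in> K \<times> K \<times> K \<and> z * (case t of (w, x, y) \<Rightarrow> w * (x * y)) = a
      \<and> (z + e) * (case t of (w, x, y) \<Rightarrow> (w + e) * ((x + e) * (y + e))) = b}"
    by (auto simp: split4_def)
  have 2: "split3 u v = {t \<in> K \<times> K \<times> K. (case t of (w, x, y) \<Rightarrow> w * (x * y)) = u
      \<and> (case t of (w, x, y) \<Rightarrow> (w + e) * ((x + e) * (y + e))) = v}" for u v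
    by (auto simp: split3_def)
  show ?thesis unfolding 1 2 using assms fin mult_mem add_mem e_mem
    by (intro card_split_step) auto
qed

end

section \<open>Odd characteristic and the quartic attached to a pair (c, d)\<close>

locale odd_ring_subfield = ring_subfield K e
  for K :: "'r::comm_ring_1 set" and e :: 'r +
  fixes p k :: nat
  assumes prime_p: "prime p" and card_K: "card K = p ^ k" and odd_K: "odd (card K)"
begin

lemma two_neq_0: "2 * e \<noteq> 0"
proof
  assume 2: "2 * e = 0"
  obtain g where g: "card K = 2 * g + 1" using odd_K by (rule oddE)
  have "of_nat (card K) * e = of_nat g * (2 * e) + e" unfolding g by (simp add: algebra_simps)
  then show False using card_mult_e 2 e_neq_0 by simp
qed

lemma two_mult_eq_0: "x \<in> K \<Longrightarrow> 2 * x = 0 \<longleftrightarrow> x = 0"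
proof
  assume x: "x \<in> K" "2 * x = 0"
  have "2 * e * x = 0" using x e_mult[of x] by (simp add: mult.assoc)
  then show "x = 0" using mult_eq_0[OF numeral_mult_mem[OF e_mem] x(1)] two_neq_0 by auto
qed simp

lemma two_mult_cancel: "x \<in> K \<Longrightarrow> y \<in> K \<Longrightarrow> 2 * x = 2 * y \<longleftrightarrow> x = y"
  using two_mult_eq_0[of "x - y"] diff_mem by (simp add: right_diff_distrib)

lemma four_mult_cancel: assumes "x \<in> K" "y \<in> K" shows "4 * x = 4 * y \<longleftrightarrow> x = y"
proof -
  have eq: "4 * z = 2 * (2 * z)" for z :: 'r by simp
  show ?thesis
    unfolding eq two_mult_cancel[OF numeral_mult_mem[OF assms(1)] numeral_mult_mem[OF assms(2)]]
    using assms by (rule two_mult_cancel)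
qed

lemma square_eq_iff: "x \<in> K \<Longrightarrow> y \<in> K \<Longrightarrow> x * x = y * y \<longleftrightarrow> x = y \<or> x = - y"
proof -
  assume xy: "x \<in> K" "y \<in> K"
  have "x * x = y * y \<longleftrightarrow> (x - y) * (x + y) = 0" by (auto simp: algebra_simps)
  then show ?thesis using mult_eq_0[OF diff_mem[OF xy] add_mem[OF xy]] by (auto simp: eq_neg_iff_add_eq_0)
qed

text \<open>Fix z and let z x y = c, (z + e) (x + e) (y + e) = d. Then x and y are the roots of a
  quadratic over \<open>K\<close>, and this quartic in z is its discriminant multiplied by (z (z +
  e))^2. Its constant term is a square, as the nonvanishing argument in Stepanov's method
  requires.\<close>

definition disc_poly :: "'r \<Rightarrow> 'r \<Rightarrow> 'r poly" where
  "disc_poly c d = (let \<alpha> = e + c - d in [:c\<^sup>2, 2 * (\<alpha> * c) - 4 * c, \<alpha>\<^sup>2 - 6 * c, 2 * \<alpha> - 4 * c, e:])"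

lemma poly_disc_poly:
  assumes "c \<in> K" "d \<in> K" "z \<in> K"
  shows "poly (disc_poly c d) z = (z * z + (e + c - d) * z + c)\<^sup>2 - 4 * (c * z * (z + e)\<^sup>2)"
proof -
  have e: "e * z = z" "e * c = c" "e * e = e" "\<And>x. e * (z * x) = z * x" "\<And>x. e * (c * x) = c * x"
     "\<And>x. e * (e * x) = e * x" "z * e = z" "c * e = c"
    using assms e_mult e_mem mult_e by (auto simp: mult.assoc[symmetric])
  show ?thesis
    unfolding disc_poly_def Let_def by (simp add: power2_eq_square algebra_simps e)
qed

lemma coeffs_in_disc_poly: "c \<in> K \<Longrightarrow> d \<in> K \<Longrightarrow> coeffs_in K (disc_poly c d)"
  unfolding disc_poly_def Let_def
  by (auto simp: coeffs_in_pCons coeffs_in_0 power2_eq_square intro!: diff_mem mult_mem add_mem e_mem numeral_mult_mem)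

lemma degree_disc_poly: "degree (disc_poly c d) = 4"
  unfolding disc_poly_def Let_def using e_neq_0 by simp

lemma poly_disc_poly_0: "poly (disc_poly c d) 0 = c\<^sup>2"
  unfolding disc_poly_def Let_def by simp

text \<open>A square root is quadratic with leading coefficient e or -e. After a change of sign the
  cubic coefficient gives the linear term \<alpha> - 2 c, and the constant term is c or -c. The
  linear coefficient then yields c = e in the case c, and d = 0, which is excluded, in the case
  -c.\<close>

lemma disc_poly_square:
  assumes cd: "c \<in> K" "d \<in> K" "c \<noteq> 0" "d \<noteq> 0" and g: "coeffs_in K g" "disc_poly c d = g\<^sup>2"
  shows "c = e"
proof -
  have "g \<noteq> 0" using g degree_disc_poly[of c d] by auto
  then have deg: "degree g = 2" using g degree_disc_poly[of c d] degree_mult_in(1)[of g g] by (simp add: power2_eq_square)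
  obtain \<gamma> g1 where g1: "g = pCons \<gamma> g1" by (cases g)
  obtain \<beta> g2 where g2: "g1 = pCons \<beta> g2" by (cases g1)
  have "degree g2 = 0" using deg by (auto simp: g1 g2 split: if_splits)
  then obtain \<mu> where "g2 = [:\<mu>:]" by (rule degree_eq_zeroE)
  then have g_eq: "g = [:\<gamma>, \<beta>, \<mu>:]" by (simp add: g1 g2)
  have K: "\<gamma> \<in> K" "\<beta> \<in> K" "\<mu> \<in> K" using g(1) by (auto simp: g_eq coeffs_in_pCons)
  define \<alpha> where "\<alpha> = e + c - d"
  have \<alpha>K: "\<alpha> \<in> K" unfolding \<alpha>_def using cd e_mem add_mem diff_mem by auto
  have eqs: "c * c = \<gamma> * \<gamma>" "2 * (\<alpha> * c) - 4 * c = 2 * (\<beta> * \<gamma>)"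
      "2 * \<alpha> - 4 * c = 2 * (\<beta> * \<mu>)" "e = \<mu> * \<mu>"
    using g(2) unfolding disc_poly_def Let_def \<alpha>_def[symmetric] g_eq
    by (auto simp: power2_eq_square algebra_simps)
  \<comment> \<open>The coefficients \<open>\<gamma>'\<close>, \<open>\<beta>'\<close> are those of
    the square root normalised to leading coefficient \<open>e\<close>.\<close>
  have key: "c = e" if K': "\<gamma>' \<in> K" "\<beta>' \<in> K" "c * c = \<gamma>' * \<gamma>'" "2 * (\<alpha> * c) - 4 * c = 2 * (\<beta>' * \<gamma>')"
    "2 * \<alpha> - 4 * c = 2 * \<beta>'" for \<gamma>' \<beta>'
  proof -
    have "2 * (\<alpha> - 2 * c) = 2 * \<beta>'" using K'(5) by (simp add: algebra_simps)
    then have \<beta>: "\<beta>' = \<alpha> - 2 * c" using two_mult_cancel \<alpha>K cd numeral_mult_mem diff_mem K' by metis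
    from square_eq_iff[OF cd(1) K'(1)] K'(3) have "\<gamma>' = c \<or> \<gamma>' = - c" by (metis minus_minus)
    then show ?thesis
    proof
      assume "\<gamma>' = c"
      then have "4 * (c * c) = 4 * (c * e)" using K'(4) mult_e[OF cd(1)] unfolding \<beta> by (simp add: algebra_simps)
      then have "c * c = c * e" using four_mult_cancel[of "c * c" "c * e"] mult_mem cd e_mem by auto
      then show ?thesis using mult_left_cancel[of c c e] cd e_mem by auto
    next
      assume "\<gamma>' = - c"
      then have "4 * (c * \<alpha>) = 4 * (c * (e + c))" using K'(4) mult_e[OF cd(1)] unfolding \<beta> by (simp add: algebra_simps)
      then have "c * \<alpha> = c * (e + c)" using four_mult_cancel[of "c * \<alpha>" "c * (e + c)"] mult_mem cd e_mem add_mem \<alpha>K by auto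
      then have "\<alpha> = e + c" using mult_left_cancel[of c \<alpha> "e + c"] cd e_mem add_mem \<alpha>K by auto
      then show ?thesis using cd(4) unfolding \<alpha>_def by simp
    qed
  qed
  from eqs(4) have "e * e = \<mu> * \<mu>" using e_mult e_mem by simp
  then have "\<mu> = e \<or> \<mu> = - e" using square_eq_iff[OF K(3) e_mem] by auto
  then show ?thesis
  proof
    assume "\<mu> = e"
    then show ?thesis using key[of \<gamma> \<beta>] eqs(1-3) K mult_e[OF K(2)] by simp
  next
    assume "\<mu> = - e"
    then show ?thesis using key[of "- \<gamma>" "- \<beta>"] eqs(1-3) mult_e[OF K(2)] uminus_mem[OF K(1)] uminus_mem[OF K(2)]
      by simp
  qed
qed

lemma card_square_roots:
  assumes "v \<in> K" "card K = 2 * g + 1"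
  shows "v = 0 \<Longrightarrow> card {w \<in> K. w * w = v} = 1"
    and "v \<noteq> 0 \<Longrightarrow> v ^ g = e \<Longrightarrow> card {w \<in> K. w * w = v} = 2"
    and "v ^ g \<noteq> e \<Longrightarrow> v \<noteq> 0 \<Longrightarrow> {w \<in> K. w * w = v} = {}"
    and "v \<noteq> 0 \<Longrightarrow> v ^ g = e \<or> v ^ g = - e"
    and "card {w \<in> K. w * w = v} \<le> 2"
proof -
  have g: "g > 0" "card K - 1 = 2 * g" using assms(2) card_gt_1 by auto
  show "v = 0 \<Longrightarrow> card {w \<in> K. w * w = v} = 1"
  proof -
    assume "v = 0"
    then have "{w \<in> K. w * w = v} = {0}" using mult_eq_0 zero_mem by auto
    then show ?thesis by simp
  qed
  show "v \<noteq> 0 \<Longrightarrow> v ^ g = e \<Longrightarrow> card {w \<in> K. w * w = v} = 2"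
    using power_fibres(2)[OF g(2) assms(1)] by (simp add: power2_eq_square)
  show "{w \<in> K. w * w = v} = {}" if "v ^ g \<noteq> e" "v \<noteq> 0"
  proof -
    have False if w: "w \<in> K" "w * w = v" for w
    proof -
      have "w \<noteq> 0" using w \<open>v \<noteq> 0\<close> by auto
      then have "w ^ (2 * g) = e" using power_card_minus_1_eq w g by metis
      then show False using w \<open>v ^ g \<noteq> e\<close> by (simp add: power_mult power2_eq_square)
    qed
    then show ?thesis by auto
  qed
  show "v \<noteq> 0 \<Longrightarrow> v ^ g = e \<or> v ^ g = - e"
  proof -
    assume "v \<noteq> 0"
    then have "v ^ g * v ^ g = e * e" using power_card_minus_1_eq[OF assms(1)] g e_mult[OF e_mem]
      by (simp add: mult_2 power_add)
    then show ?thesis using square_eq_iff[OF power_mem[OF assms(1) g(1)] e_mem] by blast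
  qed
  show "card {w \<in> K. w * w = v} \<le> 2"
    using card_power_roots_le[of 2 v] assms(1) by (simp add: power2_eq_square)
qed

text \<open>Product and sum of x and y are prescribed, so the pair is determined by its difference,
  and w = u (x - y) with u = z (z + e) clears the denominators. The inverse map needs division by 2
  u.\<close>

lemma card_split2_disc:
  assumes cd: "c \<in> K" "d \<in> K" and z: "z \<in> K" "z \<noteq> 0" "z \<noteq> - e"
  shows "card (split2 (inv_in z * c) (inv_in (z + e) * d)) = card {w \<in> K. w * w = poly (disc_poly c d) z}"
proof -
  define u where "u = z * (z + e)"
  define A where "A = z * z + (e + c - d) * z + c"
  have z1: "z + e \<in> K" "z + e \<noteq> 0" using z add_mem e_mem plus_e_neq_0 by auto
  have u: "u \<in> K" "u \<noteq> 0" unfolding u_def using z z1 mult_mem mult_eq_0 by auto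
  have AK: "A \<in> K" unfolding A_def using cd z by (intro add_mem mult_mem diff_mem e_mem)
  have u2: "2 * u \<in> K" "2 * u \<noteq> 0" using u two_mult_eq_0 numeral_mult_mem by auto
  define h where "h = inv_in (2 * u)"
  have h: "h \<in> K" "2 * u * h = e" unfolding h_def using inv_in u2 by auto
  have E: "e * z = z" "z * e = z" "\<And>x. e * (z * x) = z * x" using z e_mult mult_e by (auto simp: mult.assoc[symmetric])
  have f: "poly (disc_poly c d) z = A * A - 4 * (c * (z * ((z + e) * (z + e))))"
    using poly_disc_poly[OF cd z(1)] by (simp add: A_def power2_eq_square mult.assoc)
  have split2_iff: "(x, y) \<in> split2 (inv_in z * c) (inv_in (z + e) * d)
     \<longleftrightarrow> x \<in> K \<and> y \<in> K \<and> z * (x * y) = c \<and> u * (x + y) = - A" for x y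
  proof (cases "x \<in> K \<and> y \<in> K")
    case True
    then have xy: "x \<in> K" "y \<in> K" by auto
    have E': "e * x = x" "e * y = y" "x * e = x" "y * e = y" "e * e = e" using xy e_mult mult_e e_mem by auto
    have 1: "x * y = inv_in z * c \<longleftrightarrow> z * (x * y) = c"
      using mult_eq_iff_inv[OF z(1,2), of "x * y" c] mult_mem xy cd by auto
    have 2: "(x + e) * (y + e) = inv_in (z + e) * d \<longleftrightarrow> (z + e) * ((x + e) * (y + e)) = d"
      using mult_eq_iff_inv[OF z1, of "(x + e) * (y + e)" d] mult_mem add_mem e_mem xy cd by auto
    have 3: "(z + e) * ((x + e) * (y + e)) = d \<longleftrightarrow> u * (x + y) = - A" if "z * (x * y) = c"
    proof -
      have "z * ((z + e) * ((x + e) * (y + e))) = z * (z * (x * y)) + z * (x * y) + u * (x + y) + z * z + z"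
        unfolding u_def by (simp add: algebra_simps E E')
      also have "\<dots> = z * c + c + u * (x + y) + z * z + z" using that by simp
      also have "\<dots> = u * (x + y) + A + z * d" unfolding A_def by (simp add: algebra_simps E)
      finally have eq: "z * ((z + e) * ((x + e) * (y + e))) = u * (x + y) + A + z * d" .
      have "(z + e) * ((x + e) * (y + e)) \<in> K" using xy z1 mult_mem add_mem e_mem by auto
      then have "(z + e) * ((x + e) * (y + e)) = d \<longleftrightarrow> z * ((z + e) * ((x + e) * (y + e))) = z * d"
        using mult_left_cancel[OF z(1,2) _ cd(2)] by simp
      also have "\<dots> \<longleftrightarrow> u * (x + y) = - A" unfolding eq by (simp add: eq_neg_iff_add_eq_0)
      finally show ?thesis .
    qed
    show ?thesis using xy 1 2 3 by (auto simp: split2_def)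
  qed (auto simp: split2_def)
  have uu: "u * u = z * (z * ((z + e) * (z + e)))" unfolding u_def by (simp only: mult_ac)
  show ?thesis
  proof (rule bij_betw_same_card[OF bij_betw_byWitness])
    let ?F = "\<lambda>(x, y). u * (x - y)" and ?G = "\<lambda>w. (h * (w - A), h * (- A - w))"
    show "\<forall>t\<in>split2 (inv_in z * c) (inv_in (z + e) * d). ?G (?F t) = t"
    proof clarify
      fix x y assume "(x, y) \<in> split2 (inv_in z * c) (inv_in (z + e) * d)"
      then have xy: "x \<in> K" "y \<in> K" "u * (x + y) = - A" using split2_iff by auto
      have "u * (x - y) - A = u * (x - y) + u * (x + y)" using xy by simp
      also have "\<dots> = 2 * u * x" by (simp add: algebra_simps)
      finally have a: "h * (u * (x - y) - A) = (2 * u * h) * x" by (simp only: mult_ac)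
      have "- A - u * (x - y) = u * (x + y) - u * (x - y)" using xy by simp
      also have "\<dots> = 2 * u * y" by (simp add: algebra_simps)
      finally have b: "h * (- A - u * (x - y)) = (2 * u * h) * y" by (simp only: mult_ac)
      show "h * (u * (x - y) - A) = x \<and> h * (- A - u * (x - y)) = y"
        unfolding a b h(2) using xy e_mult by simp
    qed
    show "\<forall>w\<in>{w \<in> K. w * w = poly (disc_poly c d) z}. ?F (?G w) = w"
    proof clarify
      fix w assume w: "w \<in> K"
      have "u * (h * (w - A) - h * (- A - w)) = (2 * u * h) * w" by (simp add: algebra_simps)
      then show "u * (h * (w - A) - h * (- A - w)) = w" using h(2) e_mult w by simp
    qed
    show "?F ` split2 (inv_in z * c) (inv_in (z + e) * d) \<subseteq> {w \<in> K. w * w = poly (disc_poly c d) z}"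
    proof clarify
      fix x y assume "(x, y) \<in> split2 (inv_in z * c) (inv_in (z + e) * d)"
      then have xy: "x \<in> K" "y \<in> K" "z * (x * y) = c" "u * (x + y) = - A" using split2_iff by auto
      have "u * (x - y) * (u * (x - y)) = (u * (x + y)) * (u * (x + y)) - 4 * (x * y * (u * u))"
        by (simp add: algebra_simps)
      also have "4 * (x * y * (u * u)) = 4 * ((z * (x * y)) * (z * ((z + e) * (z + e))))"
        unfolding uu by (simp only: mult_ac)
      finally have "u * (x - y) * (u * (x - y)) = poly (disc_poly c d) z"
        unfolding f xy(3,4) by simp
      then show "u * (x - y) \<in> K \<and> u * (x - y) * (u * (x - y)) = poly (disc_poly c d) z"
        using xy u mult_mem diff_mem by auto
    qed
    show "?G ` {w \<in> K. w * w = poly (disc_poly c d) z} \<subseteq> split2 (inv_in z * c) (inv_in (z + e) * d)"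
    proof (clarify)
      fix w assume w: "w \<in> K" "w * w = poly (disc_poly c d) z"
      have m: "h * (w - A) \<in> K" "h * (- A - w) \<in> K" using h w AK by (auto intro!: mult_mem diff_mem uminus_mem)
      have "u * (h * (w - A) + h * (- A - w)) = (2 * u * h) * (- A)" by (simp add: algebra_simps)
      then have s: "u * (h * (w - A) + h * (- A - w)) = - A" unfolding h(2) using e_mult[OF uminus_mem[OF AK]] by (rule trans)
      have m3: "z * ((w - A) * (- A - w)) \<in> K" using w z AK by (auto intro!: mult_mem diff_mem uminus_mem)
      have "(2 * u) * ((2 * u) * (z * (h * (w - A) * (h * (- A - w))))) = (2 * u * h) * ((2 * u * h) * (z * ((w - A) * (- A - w))))"
        by (simp only: mult_ac)
      also have "\<dots> = z * ((w - A) * (- A - w))" unfolding h(2) by (simp only: e_mult[OF m3])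
      also have "(w - A) * (- A - w) = A * A - w * w" by (simp add: algebra_simps)
      also have "\<dots> = 4 * (c * (z * ((z + e) * (z + e))))" unfolding w(2) f by simp
      also have "z * \<dots> = 4 * (u * u * c)" unfolding uu by (simp only: mult_ac)
      also have "\<dots> = (2 * u) * ((2 * u) * c)" by (simp add: algebra_simps)
      finally have eq: "(2 * u) * ((2 * u) * (z * (h * (w - A) * (h * (- A - w))))) = (2 * u) * ((2 * u) * c)" .
      have zK: "z * (h * (w - A) * (h * (- A - w))) \<in> K" using m z mult_mem by blast
      have "z * (h * (w - A) * (h * (- A - w))) = c"
        using eq unfolding mult_left_cancel[OF u2 mult_mem[OF u2(1) zK] mult_mem[OF u2(1) cd(1)]]
          mult_left_cancel[OF u2 zK cd(1)] .
      then show "(h * (w - A), h * (- A - w)) \<in> split2 (inv_in z * c) (inv_in (z + e) * d)"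
        using split2_iff m s by simp
    qed
  qed
qed

end

section \<open>Estimates for T_3 and T_4\<close>

context odd_ring_subfield
begin

lemma minus_e_mem: "- e \<in> K"
  using e_mem uminus_mem by blast

lemma card_punctured: "card (K - {0, - e}) = card K - 2"
  using fin zero_mem minus_e_mem e_neq_0 by (subst card_Diff_subset) auto

lemma punctured_inv:
  assumes "c \<in> K" "c \<noteq> 0" "z \<in> K - {0, - e}"
  shows "inv_in z * c \<in> K" "inv_in z * c \<noteq> 0" "inv_in (z + e) * c \<in> K" "inv_in (z + e) * c \<noteq> 0"
proof -
  have z: "z \<in> K" "z \<noteq> 0" "z + e \<in> K" "z + e \<noteq> 0" using assms plus_e_neq_0 add_mem e_mem by auto
  show "inv_in z * c \<in> K" "inv_in z * c \<noteq> 0" "inv_in (z + e) * c \<in> K" "inv_in (z + e) * c \<noteq> 0"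
    using inv_in[OF z(1,2)] inv_in[OF z(3,4)] assms mult_mem mult_eq_0 by auto
qed

lemma card_split3_disc:
  assumes "c \<in> K" "d \<in> K" "c \<noteq> 0" "d \<noteq> 0"
  shows "card (split3 c d) = (\<Sum>z\<in>K - {0, - e}. card {w \<in> K. w * w = poly (disc_poly c d) z})"
  unfolding card_split3[OF assms] using assms by (intro sum.cong refl card_split2_disc) auto

lemma disc_poly_mem: "c \<in> K \<Longrightarrow> d \<in> K \<Longrightarrow> z \<in> K \<Longrightarrow> poly (disc_poly c d) z \<in> K"
  using coeffs_in_disc_poly poly_mem by blast

lemma ex_half_card: obtains g where "card K = 2 * g + 1"
  using odd_K by (rule oddE)

lemma card_split3_le:
  assumes "c \<in> K" "d \<in> K" "c \<noteq> 0" "d \<noteq> 0"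
  shows "card (split3 c d) \<le> 2 * card K"
proof -
  obtain g where g: "card K = 2 * g + 1" by (rule ex_half_card)
  have "card (split3 c d) \<le> (\<Sum>z\<in>K - {0, - e}. 2)"
    unfolding card_split3_disc[OF assms] using assms disc_poly_mem card_square_roots(5)[OF _ g]
    by (intro sum_mono) auto
  then show ?thesis using card_punctured by simp
qed

text \<open>In the exceptional case the value of \<open>h\<close> is itself a square root at every
  admissible z. Only a lower bound is asked for here.\<close>

lemma card_split3_square_ge:
  assumes "c \<in> K" "d \<in> K" "c \<noteq> 0" "d \<noteq> 0" and h: "coeffs_in K h" "disc_poly c d = h\<^sup>2"
  shows "card K - 2 \<le> card (split3 c d)"
proof -
  have "(\<Sum>z\<in>K - {0, - e}. 1) \<le> card (split3 c d)"
    unfolding card_split3_disc[OF assms(1-4)]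
  proof (rule sum_mono)
    fix z assume z: "z \<in> K - {0, - e}"
    have "poly h z \<in> {w \<in> K. w * w = poly (disc_poly c d) z}"
      using poly_mem h z by (simp add: power2_eq_square)
    then have "card {w \<in> K. w * w = poly (disc_poly c d) z} > 0" using fin by (auto simp: card_gt_0_iff)
    then show "1 \<le> card {w \<in> K. w * w = poly (disc_poly c d) z}" by simp
  qed
  then show ?thesis using card_punctured by simp
qed

text \<open>Stepanov's method gives upper bounds only, but it applies to both \<epsilon> = e and
  \<epsilon> = -e; the bound for the nonsquare values, subtracted from q, is a lower bound for the
  square values. The at most four zeros of the quartic and the two excluded points 0 and -e account
  for the additive constants.\<close>

lemma card_split3_nonsquare_nat:
  assumes "c \<in> K" "d \<in> K" "c \<noteq> 0" "d \<noteq> 0"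
    and ns: "\<not> (\<exists>h. coeffs_in K h \<and> disc_poly c d = h\<^sup>2)"
    and n: "n > 0" "25 * n\<^sup>2 \<le> card K"
  shows "n * card (split3 c d) \<le> n * card K + 3 * card K + 4 * n"
    and "n * card K \<le> n * card (split3 c d) + 3 * card K + 12 * n"
proof -
  obtain g where g: "card K = 2 * g + 1" by (rule ex_half_card)
  let ?f = "disc_poly c d"
  define P M Z where "P = {a \<in> K. poly ?f a ^ g = e \<and> poly ?f a \<noteq> 0}"
    and "M = {a \<in> K. poly ?f a ^ g = - e \<and> poly ?f a \<noteq> 0}" and "Z = {a \<in> K. poly ?f a = 0}"
  define r where "r z = card {w \<in> K. w * w = poly ?f z}" for z
  have f: "coeffs_in K ?f" using assms coeffs_in_disc_poly by blast
  have P: "2 * n * card P \<le> card K * n + 3 * card K"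
    unfolding P_def using stepanov_bound_nat[OF prime_p card_K g f degree_disc_poly poly_disc_poly_0 _ _ ns n] assms by blast
  have M: "2 * n * card M \<le> card K * n + 3 * card K"
    unfolding M_def using stepanov_bound_nat[OF prime_p card_K g f degree_disc_poly poly_disc_poly_0 _ _ ns n] assms by blast
  have f0: "?f \<noteq> 0" using degree_disc_poly[of c d] by auto
  have Z: "card Z \<le> 4" unfolding Z_def using card_roots_le[OF f f0] degree_disc_poly by simp
  have finPMZ: "finite P" "finite M" "finite Z" unfolding P_def M_def Z_def using fin by auto
  have "K \<subseteq> P \<union> (M \<union> Z)"
    using card_square_roots(4)[OF _ g] disc_poly_mem assms unfolding P_def M_def Z_def by blast
  then have "card K \<le> card (P \<union> (M \<union> Z))" using finPMZ by (intro card_mono) auto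
  also have "\<dots> \<le> card P + (card M + card Z)"
    using card_Un_le[of P "M \<union> Z"] card_Un_le[of M Z] by linarith
  finally have cover: "card K \<le> card P + card M + 4" using Z by linarith
  have T: "card (split3 c d) = (\<Sum>z\<in>K - {0, - e}. r z)"
    unfolding r_def using card_split3_disc assms by blast
  have rP: "r z = 2" if "z \<in> P" for z
    using card_square_roots(2)[OF _ g, of "poly ?f z"] disc_poly_mem assms that unfolding P_def r_def by auto
  have rM: "r z = 0" if "z \<in> K" "z \<notin> P" "z \<notin> Z" for z
  proof -
    have "{w \<in> K. w * w = poly ?f z} = {}"
      using card_square_roots(3)[of "poly ?f z", OF _ g] disc_poly_mem assms that unfolding P_def Z_def by blast
    then show ?thesis unfolding r_def by (simp only: card.empty)
  qed
  have rZ: "r z = 1" if "z \<in> Z" for z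
    using card_square_roots(1)[OF _ g, of "poly ?f z"] that zero_mem unfolding Z_def r_def by auto
  have "card (split3 c d) \<le> (\<Sum>z\<in>P \<union> Z. r z)"
    unfolding T
  proof (rule order.trans)
    show "sum r (K - {0, - e}) \<le> sum r K" using fin by (intro sum_mono2) auto
    have "P \<union> Z \<subseteq> K" by (auto simp: P_def Z_def)
    then have "sum r K = sum r (P \<union> Z)" using fin rM by (intro sum.mono_neutral_right) blast+
    then show "sum r K \<le> sum r (P \<union> Z)" by simp
  qed
  also have "\<dots> = sum r P + sum r Z" using finPMZ by (intro sum.union_disjoint) (auto simp: P_def Z_def)
  also have "\<dots> = 2 * card P + card Z" using rP rZ by simp
  finally have up: "card (split3 c d) \<le> 2 * card P + 4" using Z by linarith
  have "sum r (P - {0, - e}) \<le> card (split3 c d)"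
    unfolding T using fin by (intro sum_mono2) (auto simp: P_def)
  moreover have "sum r (P - {0, - e}) = 2 * card (P - {0, - e})" using rP by simp
  moreover have "card P - card {0, - e} \<le> card (P - {0, - e})" by (rule diff_card_le_card_Diff) simp
  moreover have "card {0, - e} \<le> 2" by (simp add: card_insert_if)
  ultimately have lo: "2 * card P \<le> card (split3 c d) + 4" by linarith
  have "n * card (split3 c d) \<le> n * (2 * card P + 4)" using up by (intro mult_le_mono2)
  then show "n * card (split3 c d) \<le> n * card K + 3 * card K + 4 * n" using P by (simp add: algebra_simps)
  have "2 * n * card K \<le> 2 * n * (card P + card M + 4)" using cover by (intro mult_le_mono2)
  moreover have "n * (2 * card P) \<le> n * (card (split3 c d) + 4)" using lo by (intro mult_le_mono2)
  ultimately show "n * card K \<le> n * card (split3 c d) + 3 * card K + 12 * n" using M by (simp add: algebra_simps)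
qed

lemma card_split3_nonsquare:
  assumes "c \<in> K" "d \<in> K" "c \<noteq> 0" "d \<noteq> 0"
    and ns: "\<not> (\<exists>h. coeffs_in K h \<and> disc_poly c d = h\<^sup>2)"
  shows "\<bar>real (card (split3 c d)) - real (card K)\<bar> \<le> 42 * sqrt (real (card K))"
proof (cases "card K < 25")
  \<comment> \<open>For small q the trivial bound T_3 \<le> 2 q is enough, as sqrt q < 5.\<close>
  case True
  have "\<bar>real (card (split3 c d)) - real (card K)\<bar> \<le> real (card K)"
    using card_split3_le[OF assms(1-4)] by linarith
  also have "\<dots> = sqrt (real (card K)) * sqrt (real (card K))" by simp
  also have "\<dots> \<le> 42 * sqrt (real (card K))"
    using True by (intro mult_right_mono) (auto intro: real_le_lsqrt)
  finally show ?thesis .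
next
  case False
  define s where "s = sqrt (real (card K))"
  have ss: "s * s = real (card K)" unfolding s_def by simp
  have s5: "s \<ge> 5" unfolding s_def using False by (intro real_le_rsqrt) auto
  \<comment> \<open>The largest \<open>n\<close> with 25 n^2 \<le> q. Being a floor of a number at
    least 1 it loses at most a factor 2, so sqrt q \<le> 10 n; the constant 42 is 30 from 3 q \<le>
    30 n sqrt q plus 12 from the additive term.\<close>
  define n where "n = nat \<lfloor>s / 5\<rfloor>"
  have n1: "real n \<le> s / 5" "real n > s / 5 - 1" "n \<ge> 1" unfolding n_def using s5 by linarith+
  have n2: "real n \<ge> s / 10"
  proof (cases "s \<ge> 10")
    case True
    then show ?thesis using n1 by linarith
  next
    case False
    then show ?thesis using n1 by linarith
  qed
  have "real n ^ 2 \<le> (s / 5) ^ 2" using n1 by (intro power_mono) auto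
  then have "25 * real n ^ 2 \<le> real (card K)" using ss by (simp add: power2_eq_square)
  then have n3: "25 * n\<^sup>2 \<le> card K"
    by (metis (no_types, lifting) of_nat_le_iff of_nat_mult of_nat_numeral of_nat_power)
  have n0: "n > 0" using n1 by simp
  let ?T = "real (card (split3 c d))" and ?Q = "real (card K)"
  have "real (n * card (split3 c d)) \<le> real (n * card K + 3 * card K + 4 * n)"
    using card_split3_nonsquare_nat(1)[OF assms n0 n3] of_nat_le_iff by blast
  then have up: "n * (?T - ?Q) \<le> 3 * ?Q + 12 * n" by (simp add: algebra_simps)
  have "real (n * card K) \<le> real (n * card (split3 c d) + 3 * card K + 12 * n)"
    using card_split3_nonsquare_nat(2)[OF assms n0 n3] of_nat_le_iff by blast
  then have lo: "n * (?Q - ?T) \<le> 3 * ?Q + 12 * n" by (simp add: algebra_simps)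
  have "3 * ?Q \<le> n * (30 * s)"
  proof -
    have "s * s \<le> (10 * n) * s" using n2 s5 by (intro mult_right_mono) auto
    then show ?thesis using ss by (simp add: algebra_simps)
  qed
  moreover have "12 * real n \<le> n * (12 * s)" using s5 n0 by simp
  ultimately have "3 * ?Q + 12 * n \<le> n * (42 * s)" by (simp add: algebra_simps)
  then have "n * (?T - ?Q) \<le> n * (42 * s)" "n * (?Q - ?T) \<le> n * (42 * s)" using up lo by linarith+
  then have "?T - ?Q \<le> 42 * s" "?Q - ?T \<le> 42 * s" using n0 by simp_all
  then show ?thesis unfolding s_def by linarith
qed

text \<open>One-sided, but valid also when the quartic is a square; this is the form needed in
  degree three.\<close>

lemma card_split3_ge:
  assumes "c \<in> K" "d \<in> K" "c \<noteq> 0" "d \<noteq> 0"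
  shows "real (card (split3 c d)) \<ge> real (card K) - 42 * sqrt (real (card K))"
proof (cases "\<exists>h. coeffs_in K h \<and> disc_poly c d = h\<^sup>2")
  case True
  then have "card K - 2 \<le> card (split3 c d)" using card_split3_square_ge assms by blast
  moreover have "1 \<le> sqrt (real (card K))" using card_gt_1 by simp
  ultimately show ?thesis by linarith
next
  case False
  then show ?thesis using card_split3_nonsquare[OF assms False] by linarith
qed

text \<open>Fixing one coordinate w leaves T_3 at (c/w, d/(w + e)), whose quartic can be a square
  only if c/w = e, that is for the single value w = c. This costs at most q, and the two missing
  values of w cost 2 q; hence 45 = 42 + 1 + 2.\<close>

lemma card_split4_bound:
  assumes "c \<in> K" "d \<in> K" "c \<noteq> 0" "d \<noteq> 0"
  shows "\<bar>real (card (split4 c d)) - real (card K) ^ 2\<bar> \<le> 45 * (real (card K) * sqrt (real (card K)))"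
proof -
  let ?Q = "real (card K)" and ?s = "sqrt (real (card K))"
  let ?K = "K - {0, - e}"
  define T where "T w = real (card (split3 (inv_in w * c) (inv_in (w + e) * d)))" for w
  have s1: "1 \<le> ?s" using card_gt_1 by simp
  have Q: "?Q \<ge> 0" by simp
  have Qs: "?Q \<le> ?Q * ?s" using mult_left_mono[OF s1 Q] by simp
  have eq: "real (card (split4 c d)) = (\<Sum>w\<in>?K. T w)"
    unfolding T_def using card_split4[OF assms] by simp
  have cardK: "real (card ?K) = ?Q - 2" unfolding card_punctured using card_gt_1 by simp
  have each: "\<bar>T w - ?Q\<bar> \<le> 42 * ?s + (if w = c then ?Q else 0)" if w: "w \<in> ?K" for w
  proof -
    have m: "inv_in w * c \<in> K" "inv_in (w + e) * d \<in> K" "inv_in w * c \<noteq> 0" "inv_in (w + e) * d \<noteq> 0"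
      using punctured_inv w assms by auto
    show ?thesis
    proof (cases "w = c")
      case True
      have "\<bar>T w - ?Q\<bar> \<le> ?Q" unfolding T_def using card_split3_le[OF m] by linarith
      then show ?thesis using True s1 by (simp only: refl if_True)
    next
      case False
      have "inv_in w * c \<noteq> e"
      proof
        assume "inv_in w * c = e"
        then have "w * e = c" using mult_eq_iff_inv[of w e c] w assms e_mem by auto
        then show False using False mult_e w by auto
      qed
      then have "\<not> (\<exists>h. coeffs_in K h \<and> disc_poly (inv_in w * c) (inv_in (w + e) * d) = h\<^sup>2)"
        using disc_poly_square[OF m(1,2,3,4)] by blast
      then show ?thesis unfolding T_def using card_split3_nonsquare[OF m] False by auto
    qed
  qed
  have "\<bar>(\<Sum>w\<in>?K. T w) - (\<Sum>w\<in>?K. ?Q)\<bar> \<le> (\<Sum>w\<in>?K. \<bar>T w - ?Q\<bar>)"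
    unfolding sum_subtractf[symmetric] by (rule sum_abs)
  also have "\<dots> \<le> (\<Sum>w\<in>?K. 42 * ?s + (if w = c then ?Q else 0))" using each by (intro sum_mono)
  also have "\<dots> \<le> (?Q - 2) * (42 * ?s) + ?Q"
    using fin by (simp add: sum.distrib cardK)
  also have "\<dots> \<le> 42 * (?Q * ?s) + ?Q" using s1 by (simp add: algebra_simps)
  finally have "\<bar>(\<Sum>w\<in>?K. T w) - (\<Sum>w\<in>?K. ?Q)\<bar> \<le> 42 * (?Q * ?s) + ?Q" .
  moreover have "(\<Sum>w\<in>?K. ?Q) = ?Q ^ 2 - 2 * ?Q" by (simp add: cardK power2_eq_square algebra_simps)
  ultimately show ?thesis unfolding eq using Qs by linarith
qed

end

section \<open>Norm equations in a field extension\<close>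

lemma geometric_sum_nat: "q > 0 \<Longrightarrow> (\<Sum>i<n. q ^ i) * (q - 1) + 1 = (q::nat) ^ n"
proof (induction n)
  case (Suc n)
  obtain r where "q = Suc r" using Suc.prems by (cases q) auto
  then show ?case using Suc.IH[OF Suc.prems] by (simp add: algebra_simps)
qed simp

section \<open>Moments of the number of solutions of the norm equations\<close>

lemma sum_square_deviation:
  fixes f :: "'b \<Rightarrow> real"
  assumes "finite A" "A \<noteq> {}"
  shows "(\<Sum>x\<in>A. (f x - (\<Sum>x\<in>A. f x) / card A)\<^sup>2) = (\<Sum>x\<in>A. (f x)\<^sup>2) - (\<Sum>x\<in>A. f x)\<^sup>2 / card A"
proof -
  define S N where "S = (\<Sum>x\<in>A. f x)" and "N = real (card A)"
  have N: "N > 0" unfolding N_def using assms by (simp add: card_gt_0_iff)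
  have "(\<Sum>x\<in>A. (f x - S / N)\<^sup>2) = (\<Sum>x\<in>A. (f x)\<^sup>2 - 2 * (S / N) * f x + (S / N)\<^sup>2)"
    by (intro sum.cong refl) (simp add: power2_eq_square algebra_simps)
  also have "\<dots> = (\<Sum>x\<in>A. (f x)\<^sup>2) - (\<Sum>x\<in>A. 2 * (S / N) * f x) + N * (S / N)\<^sup>2"
    by (simp add: sum.distrib sum_subtractf N_def[symmetric])
  also have "(\<Sum>x\<in>A. 2 * (S / N) * f x) = 2 * (S / N) * S"
    unfolding S_def by (rule sum_distrib_left[symmetric])
  also have "(\<Sum>x\<in>A. (f x)\<^sup>2) - 2 * (S / N) * S + N * (S / N)\<^sup>2 = (\<Sum>x\<in>A. (f x)\<^sup>2) - S\<^sup>2 / N"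
    using N by (simp add: field_simps power2_eq_square)
  finally show ?thesis unfolding S_def N_def .
qed

text \<open>Here \<open>n\<close> is t - 1. No further structure of the extension is recorded: the
  map \<open>x ^ card K\<close> singles out \<open>K\<close> inside \<open>L\<close>, and the norm
  to \<open>K\<close> is a power map.\<close>

locale odd_field_ext = K: odd_ring_subfield K e p k + L: odd_ring_subfield L e p l
  for K L :: "'r::comm_ring_1 set" and e :: 'r and p k l :: nat +
  fixes n :: nat
  assumes K_le_L: "K \<subseteq> L" and card_L: "card L = card K ^ n" and n_pos: "n > 0"
begin

definition norm_exp :: nat where
  "norm_exp = (\<Sum>i<n. card K ^ i)"

text \<open>Its cardinality is S_n(c, d) in the notation of the overview.\<close>

definition norm_set :: "'r \<Rightarrow> 'r \<Rightarrow> 'r set" where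
  "norm_set c d = {W \<in> L. W ^ norm_exp = c \<and> (W + e) ^ norm_exp = d}"

lemma finite_norm_set: "finite (norm_set c d)"
  unfolding norm_set_def using L.fin by simp

lemma card_K_ge_3: "card K \<ge> 3"
proof -
  obtain g where "card K = 2 * g + 1" using K.odd_K by (rule oddE)
  then show ?thesis using K.card_gt_1 by simp
qed

lemma norm_exp_mult: "card L - 1 = norm_exp * (card K - 1)"
  using geometric_sum_nat[of "card K" n] K.card_gt_1 card_L unfolding norm_exp_def by simp

lemma norm_exp_pos: "norm_exp > 0"
  using norm_exp_mult L.card_gt_1 by (intro Nat.gr0I) auto

text \<open>Every element of \<open>K\<close> is fixed, and there are at most q fixed points: 0 and
  at most q - 1 roots of unity.\<close>

lemma mem_K_iff: assumes "x \<in> L" shows "x \<in> K \<longleftrightarrow> x ^ card K = x"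
proof -
  let ?R = "{x \<in> L. x ^ card K = x}"
  have "?R \<subseteq> insert 0 {x \<in> L. x ^ (card K - 1) = e}"
  proof
    fix x assume x: "x \<in> ?R"
    show "x \<in> insert 0 {x \<in> L. x ^ (card K - 1) = e}"
    proof (cases "x = 0")
      case False
      have s: "card K = Suc (card K - 1)" using K.card_gt_1 by simp
      have "x * x ^ (card K - 1) = x ^ card K" using s by (metis power_Suc)
      also have "\<dots> = x * e" using x L.mult_e by auto
      finally have "x * x ^ (card K - 1) = x * e" .
      moreover have "x ^ (card K - 1) \<in> L" using x K.card_gt_1 by (intro L.power_mem) auto
      ultimately have "x ^ (card K - 1) = e" using L.mult_left_cancel[of x] x False L.e_mem by blast
      then show ?thesis using x by auto
    qed simp
  qed
  then have "card ?R \<le> card (insert 0 {x \<in> L. x ^ (card K - 1) = e})"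
    using L.fin by (intro card_mono) auto
  also have "\<dots> \<le> Suc (card {x \<in> L. x ^ (card K - 1) = e})" by (rule card_insert_le_m1) auto
  also have "\<dots> \<le> card K" using L.card_power_roots_le[of "card K - 1" e] K.card_gt_1 L.e_mem by simp
  finally have le: "card ?R \<le> card K" .
  have "K \<subseteq> ?R" using K.power_card K_le_L by auto
  then have "K = ?R" using le L.fin by (intro card_seteq) auto
  then show ?thesis using assms by blast
qed

lemma norm_mem_K: assumes "x \<in> L" shows "x ^ norm_exp \<in> K"
proof (cases "x = 0")
  case True
  then show ?thesis using norm_exp_pos K.zero_mem by (simp add: zero_power)
next
  case False
  let ?y = "x ^ norm_exp"
  have y: "?y \<in> L" using L.power_mem[OF assms norm_exp_pos] .
  have "?y ^ (card K - 1) = e"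
    using L.power_card_minus_1_eq[OF assms False] unfolding norm_exp_mult power_mult .
  moreover have "card K = Suc (card K - 1)" using K.card_gt_1 by simp
  ultimately have "?y ^ card K = ?y" using L.mult_e[OF y] by (metis power_Suc)
  then show ?thesis using mem_K_iff[OF y] by simp
qed

lemma norm_eq_0: "x \<in> L \<Longrightarrow> x ^ norm_exp = 0 \<longleftrightarrow> x = 0"
  using L.power_eq_0 norm_exp_pos by blast

lemma card_norm_fibre: assumes "c \<in> K" "c \<noteq> 0" shows "card {x \<in> L. x ^ norm_exp = c} = norm_exp"
  using L.power_fibres(2)[OF norm_exp_mult, of c] K.power_card_minus_1_eq[OF assms] assms K_le_L by auto

lemma plus_e_mem: "x \<in> L \<Longrightarrow> x + e \<in> L"
  using L.add_mem L.e_mem by blast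

lemma norm_set_unique: "W \<in> norm_set c d \<Longrightarrow> W \<in> norm_set c' d' \<Longrightarrow> c = c' \<and> d = d'"
  by (auto simp: norm_set_def)

text \<open>The first moment: every W other than 0 and -e lies in exactly one class.\<close>

lemma norm_sets_partition:
  "(\<Sum>(c, d)\<in>(K - {0}) \<times> (K - {0}). card (norm_set c d)) = card L - 2"
proof -
  have "L - {0, - e} = (\<Union>(c, d)\<in>(K - {0}) \<times> (K - {0}). norm_set c d)"
  proof (intro equalityI subsetI)
    fix W assume "W \<in> L - {0, - e}"
    then have W: "W \<in> L" "W \<noteq> 0" "W + e \<in> L" "W + e \<noteq> 0" using plus_e_mem L.plus_e_neq_0 by auto
    then have "W \<in> norm_set (W ^ norm_exp) ((W + e) ^ norm_exp)" by (simp add: norm_set_def)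
    moreover have "W ^ norm_exp \<in> K - {0}" "(W + e) ^ norm_exp \<in> K - {0}"
      using W norm_mem_K norm_eq_0 by auto
    ultimately show "W \<in> (\<Union>(c, d)\<in>(K - {0}) \<times> (K - {0}). norm_set c d)" by blast
  next
    fix W assume "W \<in> (\<Union>(c, d)\<in>(K - {0}) \<times> (K - {0}). norm_set c d)"
    then show "W \<in> L - {0, - e}" using norm_exp_pos by (auto simp: norm_set_def zero_power)
  qed
  then have "card L - 2 = card (\<Union>(c, d)\<in>(K - {0}) \<times> (K - {0}). norm_set c d)"
    using L.card_punctured by simp
  also have "\<dots> = (\<Sum>(c, d)\<in>(K - {0}) \<times> (K - {0}). card (norm_set c d))"
    using K.fin finite_norm_set
    by (subst card_UN_disjoint) (auto simp: case_prod_unfold dest: norm_set_unique)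
  finally show ?thesis by simp
qed

text \<open>
  A pair \<open>(W, V)\<close> in the same norm class with \<open>V = u W\<close>, \<open>V + e = u' (W + e)\<close>, where \<open>u\<close>, \<open>u'\<close> have
  norm \<open>e\<close>, satisfies \<open>W (u - u') = u' - e\<close>: either \<open>W = V\<close>, or \<open>W\<close> is determined by \<open>(u, u')\<close>.
\<close>

lemma norm_sets_second_moment:
  "(\<Sum>(c, d)\<in>(K - {0}) \<times> (K - {0}). card (norm_set c d) ^ 2) \<le> card L + norm_exp\<^sup>2"
proof -
  let ?G = "(K - {0}) \<times> (K - {0})"
  define P where "P = (\<Union>(c, d)\<in>?G. norm_set c d \<times> norm_set c d)"
  define D where "D = (\<lambda>W. (W, W)) ` L"
  define U where "U = {x \<in> L. x ^ norm_exp = e}"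
  have "(\<Sum>(c, d)\<in>?G. card (norm_set c d) ^ 2) = (\<Sum>t\<in>?G. card ((\<lambda>(c, d). norm_set c d \<times> norm_set c d) t))"
    by (intro sum.cong refl) (auto simp: card_cartesian_product power2_eq_square)
  also have "\<dots> = card P"
    unfolding P_def using K.fin finite_norm_set
    by (subst card_UN_disjoint) (auto simp: case_prod_unfold dest: norm_set_unique)
  also have "P = (P - D) \<union> (P \<inter> D)" by blast
  also have "card ((P - D) \<union> (P \<inter> D)) \<le> card (P - D) + card (P \<inter> D)" by (rule card_Un_le)
  also have "card (P \<inter> D) \<le> card L"
  proof -
    have "card (P \<inter> D) \<le> card D" unfolding D_def using L.fin by (intro card_mono) auto
    also have "\<dots> \<le> card L" unfolding D_def using L.fin by (rule card_image_le)
    finally show ?thesis .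
  qed
  also have "card (P - D) \<le> card (U \<times> U)"
  proof (rule card_inj_on_le)
    let ?f = "\<lambda>(W, V). (L.inv_in W * V, L.inv_in (W + e) * (V + e))"
    have facts: "W \<in> L \<and> V \<in> L \<and> W \<noteq> 0 \<and> W + e \<noteq> 0 \<and> W + e \<in> L \<and> V + e \<in> L \<and> W \<noteq> V \<and>
        W ^ norm_exp = V ^ norm_exp \<and> (W + e) ^ norm_exp = (V + e) ^ norm_exp"
      if "(W, V) \<in> P - D" for W V
      using that norm_eq_0 plus_e_mem norm_exp_pos
      by (auto simp: P_def D_def norm_set_def zero_power)
    have U: "L.inv_in x * y \<in> U \<and> x * (L.inv_in x * y) = y"
      if "x \<in> L" "x \<noteq> 0" "y \<in> L" "x ^ norm_exp = y ^ norm_exp" for x y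
    proof -
      have m: "L.inv_in x * y \<in> L" using L.inv_in[OF that(1,2)] that L.mult_mem by auto
      have eq: "x * (L.inv_in x * y) = y" using L.mult_eq_iff_inv[OF that(1,2) m that(3)] by simp
      have "x ^ norm_exp * (L.inv_in x * y) ^ norm_exp = (x * (L.inv_in x * y)) ^ norm_exp"
        by (rule power_mult_distrib[symmetric])
      also have "\<dots> = x ^ norm_exp * e"
        unfolding eq using that(4) L.mult_e[OF L.power_mem[OF that(1) norm_exp_pos]] by simp
      finally have "x ^ norm_exp * (L.inv_in x * y) ^ norm_exp = x ^ norm_exp * e" .
      then have "(L.inv_in x * y) ^ norm_exp = e"
        using L.mult_left_cancel L.power_mem[OF that(1) norm_exp_pos] L.power_mem[OF m norm_exp_pos] norm_eq_0 that L.e_mem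
        by metis
      then show ?thesis using m eq by (simp add: U_def)
    qed
    show "inj_on ?f (P - D)"
    proof (rule inj_onI, clarify)
      fix W V W' V'
      assume a: "(W, V) \<in> P" "(W, V) \<notin> D" "(W', V') \<in> P" "(W', V') \<notin> D"
        and eq: "L.inv_in W * V = L.inv_in W' * V'" "L.inv_in (W + e) * (V + e) = L.inv_in (W' + e) * (V' + e)"
      define u u' where "u = L.inv_in W * V" and "u' = L.inv_in (W + e) * (V + e)"
      have f: "W \<in> L" "V \<in> L" "W \<noteq> 0" "W + e \<noteq> 0" "W + e \<in> L" "V + e \<in> L" "W \<noteq> V"
        "W' \<in> L" "V' \<in> L" "W' \<noteq> 0" "W' + e \<noteq> 0" "W' + e \<in> L" "V' + e \<in> L"
        using facts[of W V] facts[of W' V'] a by auto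
      have u: "u \<in> L" "u' \<in> L" "W * u = V" "(W + e) * u' = V + e" "W' * u = V'" "(W' + e) * u' = V' + e"
        using U[of W V] U[of "W + e" "V + e"] U[of W' V'] U[of "W' + e" "V' + e"] facts[of W V] facts[of W' V'] a eq
        unfolding u_def u'_def by (auto simp: U_def)
      have eu: "e * u' = u'" using L.e_mult u by auto
      have "W * (u - u') = u' - e" using u(3,4) eu by (simp add: algebra_simps)
      moreover have "W' * (u - u') = u' - e" using u(5,6) eu by (simp add: algebra_simps)
      ultimately have 0: "(u - u') * W = (u - u') * W'" by (simp add: mult.commute)
      have "u - u' \<noteq> 0"
      proof
        assume "u - u' = 0"
        then have "u' = e" "u = u'" using \<open>W * (u - u') = u' - e\<close> by auto
        then have "V = W" using u(3) L.mult_e f by auto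
        then show False using f by auto
      qed
      then have "W = W'" using 0 L.mult_left_cancel[of "u - u'" W W'] L.diff_mem u f by auto
      then show "W = W' \<and> V = V'" using u by auto
    qed
    show "?f ` (P - D) \<subseteq> U \<times> U"
    proof clarify
      fix W V assume "(W, V) \<in> P" "(W, V) \<notin> D"
      then have "(W, V) \<in> P - D" by blast
      from facts[OF this] show "L.inv_in W * V \<in> U \<and> L.inv_in (W + e) * (V + e) \<in> U" using U by blast
    qed
    show "finite (U \<times> U)" unfolding U_def using L.fin by simp
  qed
  also have "card (U \<times> U) = norm_exp\<^sup>2"
    using card_norm_fibre[OF K.e_mem K.e_neq_0] by (simp add: U_def card_cartesian_product power2_eq_square)
  finally show ?thesis by simp
qed

text \<open>The squared deviation of one class from the mean is at most the sum of all of them, that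
  is, the second moment minus its value for equal classes. The squares of q^n - 1 and q^n - 2 nearly
  cancel there, which leaves at most 2 q^n. The second summand bounds the distance of the mean from
  q^(n-2).\<close>

lemma card_norm_set_deviation:
  assumes "c \<in> K" "d \<in> K" "c \<noteq> 0" "d \<noteq> 0" "n \<ge> 2"
  shows "\<bar>real (card (norm_set c d)) - real (card K) ^ (n - 2)\<bar>
    \<le> sqrt (2 * real (card K) ^ n) + 7 * (real (card K) ^ (n - 1) / real (card K) ^ 2)"
proof -
  let ?G = "(K - {0}) \<times> (K - {0})"
  define q where "q = real (card K)"
  define f where "f = (\<lambda>(c, d). real (card (norm_set c d)))"
  define \<mu> where "\<mu> = (\<Sum>t\<in>?G. f t) / card ?G"
  have q3: "q \<ge> 3" unfolding q_def using card_K_ge_3 by simp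
  have cG: "real (card ?G) = (q - 1)\<^sup>2"
    using K.fin K.zero_mem K.card_gt_1 by (simp add: card_cartesian_product q_def power2_eq_square of_nat_diff)
  have L2: "card L \<ge> 2" using L.card_gt_1 by simp
  have qn: "real (card L) = q ^ n" unfolding card_L q_def by simp
  have "real (\<Sum>(c, d)\<in>?G. card (norm_set c d)) = q ^ n - 2"
    unfolding norm_sets_partition using L2 qn by (simp add: of_nat_diff)
  then have S1: "(\<Sum>t\<in>?G. f t) = q ^ n - 2" by (simp add: f_def case_prod_unfold)
  have "real (\<Sum>(c, d)\<in>?G. card (norm_set c d) ^ 2) \<le> real (card L + norm_exp\<^sup>2)"
    using norm_sets_second_moment of_nat_le_iff by blast
  then have S2: "(\<Sum>t\<in>?G. (f t)\<^sup>2) \<le> q ^ n + (real norm_exp)\<^sup>2" using qn by (simp add: f_def case_prod_unfold)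
  have "real norm_exp * (q - 1) = q ^ n - 1"
  proof -
    have "real (card L - 1) = real (norm_exp * (card K - 1))" using norm_exp_mult by simp
    then show ?thesis using K.card_gt_1 L2 qn by (simp add: q_def of_nat_diff)
  qed
  then have m: "real norm_exp = (q ^ n - 1) / (q - 1)" using q3 by (simp add: field_simps)
  have q1: "(q - 1)\<^sup>2 \<ge> 4" using power_mono[of 2 "q - 1" 2] q3 by simp
  have fin: "finite ?G" using K.fin by simp
  have cd: "(c, d) \<in> ?G" using assms by simp
  have "(f (c, d) - \<mu>)\<^sup>2 \<le> (\<Sum>t\<in>?G. (f t - \<mu>)\<^sup>2)"
    using fin cd by (intro member_le_sum) auto
  also have "\<dots> = (\<Sum>t\<in>?G. (f t)\<^sup>2) - (\<Sum>t\<in>?G. f t)\<^sup>2 / card ?G"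
    unfolding \<mu>_def using fin cd by (intro sum_square_deviation) auto
  also have "\<dots> \<le> q ^ n + ((q ^ n - 1)\<^sup>2 / (q - 1)\<^sup>2 - (q ^ n - 2)\<^sup>2 / (q - 1)\<^sup>2)"
    unfolding S1 cG using S2 m by (simp add: power_divide)
  also have "(q ^ n - 1)\<^sup>2 / (q - 1)\<^sup>2 - (q ^ n - 2)\<^sup>2 / (q - 1)\<^sup>2 = (2 * q ^ n - 3) / (q - 1)\<^sup>2"
    by (simp add: diff_divide_distrib[symmetric] power2_eq_square algebra_simps)
  also have "\<dots> \<le> (2 * q ^ n) / 4"
    using q1 q3 by (intro frac_le) auto
  also have "q ^ n + 2 * q ^ n / 4 \<le> 2 * q ^ n" using q3 by simp
  finally have "(f (c, d) - \<mu>)\<^sup>2 \<le> 2 * q ^ n" by simp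
  then have dev: "\<bar>f (c, d) - \<mu>\<bar> \<le> sqrt (2 * q ^ n)" by (metis real_sqrt_abs real_sqrt_le_iff)
  obtain j where j: "n = j + 2" using assms(5) by (metis add.commute le_Suc_ex)
  have "\<mu> - q ^ (n - 2) = (q ^ n - 2 - q ^ (n - 2) * (q - 1)\<^sup>2) / (q - 1)\<^sup>2"
    unfolding \<mu>_def S1 cG using q3 by (simp add: diff_divide_distrib)
  also have "q ^ n - 2 - q ^ (n - 2) * (q - 1)\<^sup>2 = 2 * q ^ (n - 1) - q ^ (n - 2) - 2"
    unfolding j by (simp add: power2_eq_square algebra_simps)
  finally have \<mu>: "\<mu> - q ^ (n - 2) = (2 * q ^ (n - 1) - q ^ (n - 2) - 2) / (q - 1)\<^sup>2" .
  have qj: "1 \<le> q ^ j" using q3 by simp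
  then have qj': "3 * q ^ j \<le> q * q ^ j" using q3 by simp
  have num: "\<bar>2 * q ^ (n - 1) - q ^ (n - 2) - 2\<bar> \<le> 2 * q ^ (n - 1)"
  proof -
    have "q ^ (n - 1) = q * q ^ j" "q ^ (n - 2) = q ^ j" unfolding j by simp_all
    then show ?thesis using qj qj' by linarith
  qed
  \<comment> \<open>From q \<ge> 3 one has q - 1 \<ge> 2 q / 3; the resulting constant 9/2 is
    rounded up to 7.\<close>
  have den: "4 / 9 * q\<^sup>2 \<le> (q - 1)\<^sup>2"
  proof -
    have "(2 / 3 * q)\<^sup>2 \<le> (q - 1)\<^sup>2" using q3 by (intro power_mono) auto
    then show ?thesis by (simp add: power_mult_distrib power_divide)
  qed
  have "\<bar>\<mu> - q ^ (n - 2)\<bar> = \<bar>2 * q ^ (n - 1) - q ^ (n - 2) - 2\<bar> / (q - 1)\<^sup>2"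
    unfolding \<mu> abs_divide by simp
  also have "\<dots> \<le> (2 * q ^ (n - 1)) / (4 / 9 * q\<^sup>2)" using num den q3 by (intro frac_le) auto
  also have "\<dots> \<le> 7 * (q ^ (n - 1) / q\<^sup>2)" using q3 by (simp add: field_simps)
  finally have "\<bar>\<mu> - q ^ (n - 2)\<bar> \<le> 7 * (q ^ (n - 1) / q\<^sup>2)" .
  then show ?thesis using dev unfolding f_def q_def by simp
qed

text \<open>The deviation times sqrt q is of order q^((n+1)/2), and n + 1 \<le> 2 (n - 2) holds
  precisely from n = 5 on. The constant is 2 + 7.\<close>

lemma card_norm_set_ge_5:
  assumes "c \<in> K" "d \<in> K" "c \<noteq> 0" "d \<noteq> 0" and n: "n \<ge> 5"
  shows "\<bar>real (card (norm_set c d)) - real (card K) ^ (n - 2)\<bar> * sqrt (real (card K))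
    \<le> 9 * real (card K) ^ (n - 2)"
proof -
  define q where "q = real (card K)"
  have q3: "q \<ge> 3" unfolding q_def using card_K_ge_3 by simp
  obtain j where j: "n = j + 5" using n by (metis add.commute le_Suc_ex)
  have "sqrt (2 * q ^ n) * sqrt q = sqrt (2 * q ^ (n + 1))" by (simp add: real_sqrt_mult[symmetric] mult_ac)
  also have "\<dots> \<le> sqrt ((2 * q ^ (n - 2))\<^sup>2)"
  proof (rule real_sqrt_le_mono)
    have "q ^ (n + 1) \<le> q ^ (2 * (n - 2))" using q3 n by (intro power_increasing) auto
    moreover have "0 \<le> q ^ (n + 1)" using q3 by simp
    moreover have "(2 * q ^ (n - 2))\<^sup>2 = 4 * q ^ (2 * (n - 2))" by (simp add: power_mult_distrib power_mult[symmetric] mult.commute)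
    ultimately show "2 * q ^ (n + 1) \<le> (2 * q ^ (n - 2))\<^sup>2" by linarith
  qed
  also have "\<dots> = 2 * q ^ (n - 2)" using q3 by (subst real_sqrt_abs) simp
  finally have 1: "sqrt (2 * q ^ n) * sqrt q \<le> 2 * q ^ (n - 2)" .
  have "sqrt q \<le> q" using q3 by (intro real_le_lsqrt) (auto simp: power2_eq_square)
  then have "q ^ (n - 1) / q\<^sup>2 * sqrt q \<le> q ^ (n - 1) / q\<^sup>2 * q" using q3 by (intro mult_left_mono) auto
  also have "\<dots> = q ^ (n - 2)" unfolding j using q3 by (simp add: field_simps power_add eval_nat_numeral)
  finally have 2: "7 * (q ^ (n - 1) / q\<^sup>2) * sqrt q \<le> 7 * q ^ (n - 2)" by simp
  have "\<bar>real (card (norm_set c d)) - q ^ (n - 2)\<bar> * sqrt q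
      \<le> (sqrt (2 * q ^ n) + 7 * (q ^ (n - 1) / q\<^sup>2)) * sqrt q"
    using card_norm_set_deviation[OF assms(1-4)] n q3 unfolding q_def by (intro mult_right_mono) auto
  also have "\<dots> = sqrt (2 * q ^ n) * sqrt q + 7 * (q ^ (n - 1) / q\<^sup>2) * sqrt q" by (simp add: algebra_simps)
  also have "\<dots> \<le> 9 * q ^ (n - 2)" using 1 2 by linarith
  finally show ?thesis unfolding q_def .
qed

end

section \<open>Degree two, and the intermediate field in degree four\<close>

context odd_field_ext
begin

lemma frobenius: assumes "x \<in> L" shows "(x + y) ^ card K = x ^ card K + y ^ card K"
  using L.frobenius_add[OF K.prime_p L.card_K assms, of y k] K.card_K by simp

lemma power_card_K_mem: "x \<in> L \<Longrightarrow> x ^ card K \<in> L"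
  using L.power_mem K.card_gt_1 by simp

text \<open>An element of \<open>norm_set u s\<close> has norm u and trace \<tau> = s - u - e; a
  pair in \<open>split2\<close> has product u and sum \<tau>. Completing the square with \<rho> =
  \<tau>/2 turns both into square roots V in \<open>L\<close> of the same v in \<open>K\<close>:
  those with V^q = -V and those with V^q = V. If v is nonzero it has two roots in \<open>L\<close>,
  each of exactly one kind; if v = 0 the root 0 is counted once on each side.\<close>

lemma quadratic_norm_set:
  assumes n: "n = 2" and us: "u \<in> K" "s \<in> K"
  shows "card (norm_set u s) + card (K.split2 u s) = 2"
proof -
  let ?q = "card K"
  define \<tau> where "\<tau> = s - u - e"
  define h where "h = K.inv_in (2 * e)"
  have h: "h \<in> K" "2 * h = e"
    unfolding h_def using K.inv_in[of "2 * e"] K.numeral_mult_mem K.e_mem K.two_neq_0 K.e_mult by (auto simp: mult.assoc)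
  have \<tau>K: "\<tau> \<in> K" unfolding \<tau>_def using us K.diff_mem K.e_mem by auto
  define \<rho> where "\<rho> = h * \<tau>"
  have \<rho>: "\<rho> \<in> K" "2 * \<rho> = \<tau>" unfolding \<rho>_def using h \<tau>K K.mult_mem K.e_mult by (auto simp: mult.assoc[symmetric])
  define v where "v = \<rho> * \<rho> - u"
  have vK: "v \<in> K" unfolding v_def using \<rho> us K.mult_mem K.diff_mem by auto
  have norm_exp: "W ^ norm_exp = W * W ^ ?q" for W :: 'r
    unfolding norm_exp_def by (simp add: n numeral_2_eq_2)
  define A B where "A = {V \<in> L. V * V = v \<and> V ^ ?q = - V}" and "B = {V \<in> L. V * V = v \<and> V ^ ?q = V}"
  have norm_set_eq: "W \<in> norm_set u s \<longleftrightarrow> W \<in> L \<and> W * W ^ ?q = u \<and> W + W ^ ?q = \<tau>" for W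
  proof (cases "W \<in> L")
    case True
    have E: "W * e = W" "e * W ^ ?q = W ^ ?q" "e * e = e"
      using True L.mult_e L.e_mult power_card_K_mem L.e_mem by auto
    have "(W + e) ^ ?q = W ^ ?q + e" using frobenius[OF True, of e] K.power_card[OF K.e_mem] by simp
    then have a: "(W + e) ^ norm_exp = W * W ^ ?q + (W + W ^ ?q) + e"
      unfolding norm_exp by (simp add: algebra_simps E)
    have b: "u + x + e = s \<longleftrightarrow> x = \<tau>" for x unfolding \<tau>_def by (auto simp: algebra_simps)
    have "W \<in> norm_set u s \<longleftrightarrow> W * W ^ ?q = u \<and> W * W ^ ?q + (W + W ^ ?q) + e = s"
      using True by (simp only: norm_set_def mem_Collect_eq a norm_exp[of W] simp_thms)
    then show ?thesis using True b[of "W + W ^ ?q"] by metis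
  qed (simp add: norm_set_def)
  have \<rho>q: "\<rho> ^ ?q = \<rho>" "(- \<rho>) ^ ?q = - \<rho>" using \<rho> K.power_card K.uminus_mem by auto
  have \<rho>L: "\<rho> \<in> L" "- \<rho> \<in> L" using \<rho> K_le_L L.uminus_mem by auto
  have "card (norm_set u s) = card A"
  proof (rule bij_betw_same_card[OF bij_betw_byWitness])
    show "\<forall>W\<in>norm_set u s. (W - \<rho>) + \<rho> = W" "\<forall>V\<in>A. (V + \<rho>) - \<rho> = V" by auto
    show "(\<lambda>W. W - \<rho>) ` norm_set u s \<subseteq> A"
    proof clarify
      fix W assume "W \<in> norm_set u s"
      then have W: "W \<in> L" "W * W ^ ?q = u" "W + W ^ ?q = \<tau>" using norm_set_eq by auto
      have Wq: "W ^ ?q = 2 * \<rho> - W" using W(3) \<rho>(2) by (simp add: algebra_simps)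
      have q: "(W - \<rho>) ^ ?q = - (W - \<rho>)" using frobenius[OF W(1), of "- \<rho>"] \<rho>q Wq by (simp add: algebra_simps)
      have "(W - \<rho>) * (W - \<rho>) = \<rho> * \<rho> - W * (2 * \<rho> - W)" by (simp add: algebra_simps)
      then have "(W - \<rho>) * (W - \<rho>) = v" using W(2) unfolding Wq v_def by simp
      then show "W - \<rho> \<in> A" using q W \<rho>L L.diff_mem by (auto simp: A_def)
    qed
    show "(\<lambda>V. V + \<rho>) ` A \<subseteq> norm_set u s"
    proof clarify
      fix V assume "V \<in> A"
      then have V: "V \<in> L" "V * V = v" "V ^ ?q = - V" by (auto simp: A_def)
      have "(V + \<rho>) ^ ?q = \<rho> - V" using frobenius[OF V(1), of \<rho>] \<rho>q V by simp
      moreover have "(V + \<rho>) * (\<rho> - V) = \<rho> * \<rho> - V * V" by (simp add: algebra_simps)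
      moreover have "(V + \<rho>) + (\<rho> - V) = \<tau>" using \<rho>(2) by (simp add: algebra_simps)
      moreover have "\<rho> * \<rho> - v = u" by (simp add: v_def)
      ultimately show "V + \<rho> \<in> norm_set u s"
        unfolding norm_set_eq using V(1,2) \<rho>L(1) L.add_mem by simp
    qed
  qed
  moreover have "card (K.split2 u s) = card B"
  proof (rule bij_betw_same_card[OF bij_betw_byWitness])
    have split2_iff: "(x, y) \<in> K.split2 u s \<longleftrightarrow> x \<in> K \<and> y \<in> K \<and> x * y = u \<and> x + y = \<tau>" for x y
    proof (cases "x \<in> K \<and> y \<in> K")
      case True
      then have E: "x * e = x" "e * x = x" "e * y = y" "y * e = y" "e * e = e"
        using K.mult_e K.e_mult K.e_mem by auto
      have "(x + e) * (y + e) = x * y + (x + y) + e" by (simp add: algebra_simps E)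
      moreover have "u + x + e = s \<longleftrightarrow> x = \<tau>" for x unfolding \<tau>_def by (auto simp: algebra_simps)
      ultimately show ?thesis using True by (auto simp: K.split2_def)
    qed (auto simp: K.split2_def)
    let ?F = "\<lambda>(x, y). x - \<rho>" and ?G = "\<lambda>V. (V + \<rho>, \<rho> - V)"
    show "\<forall>t\<in>K.split2 u s. ?G (?F t) = t"
    proof clarify
      fix x y assume "(x, y) \<in> K.split2 u s"
      then have "x + y = 2 * \<rho>" using split2_iff \<rho> by auto
      then have "y = 2 * \<rho> - x" by (simp add: algebra_simps)
      then show "x - \<rho> + \<rho> = x \<and> \<rho> - (x - \<rho>) = y" by (simp add: algebra_simps)
    qed
    show "\<forall>V\<in>B. ?F (?G V) = V" by auto
    show "?F ` K.split2 u s \<subseteq> B"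
    proof clarify
      fix x y assume "(x, y) \<in> K.split2 u s"
      then have xy: "x \<in> K" "x * y = u" "x + y = 2 * \<rho>" using split2_iff \<rho> by auto
      have y: "y = 2 * \<rho> - x" using xy(3) by (simp add: algebra_simps)
      have "(x - \<rho>) * (x - \<rho>) = v" using xy(2) unfolding y v_def by (auto simp: algebra_simps)
      then show "x - \<rho> \<in> B" using K.diff_mem[OF xy(1) \<rho>(1)] K_le_L K.power_card by (auto simp: B_def)
    qed
    show "?G ` B \<subseteq> K.split2 u s"
    proof clarify
      fix V assume "V \<in> B"
      then have V: "V \<in> K" "V * V = v" using mem_K_iff by (auto simp: B_def)
      have "(V + \<rho>) * (\<rho> - V) = \<rho> * \<rho> - V * V" by (simp add: algebra_simps)
      then show "(V + \<rho>, \<rho> - V) \<in> K.split2 u s"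
        unfolding split2_iff using V \<rho> K.add_mem K.diff_mem by (auto simp: v_def algebra_simps)
    qed
  qed
  moreover have "card A + card B = 2"
  proof (cases "v = 0")
    case True
    have "(0::'r) ^ ?q = 0" using K.card_gt_1 by (simp add: zero_power)
    then have "A = {0}" "B = {0}" using True L.mult_eq_0 L.zero_mem by (auto simp: A_def B_def)
    then show ?thesis by simp
  next
    case False
    obtain g where g: "?q = 2 * g + 1" using K.odd_K by (rule oddE)
    \<comment> \<open>Shows that v is a square in \<open>L\<close> by Euler's criterion: the
      exponent (q^2 - 1)/2 is a multiple of q - 1 = 2 g, so the power of v is
      \<open>e\<close>.\<close>
    have cL: "card L = 2 * (2 * g * (g + 1)) + 1"
      unfolding card_L n g by (simp add: power2_eq_square algebra_simps)
    have vL: "v \<in> L" using vK K_le_L by auto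
    have "?q - 1 = 2 * g" using g by simp
    then have "v ^ (2 * g) = e" using K.power_card_minus_1_eq[OF vK False] by simp
    moreover have "v ^ (2 * g * (g + 1)) = (v ^ (2 * g)) ^ (g + 1)" by (rule power_mult)
    ultimately have "v ^ (2 * g * (g + 1)) = e ^ (g + 1)" by simp
    also have "\<dots> = e" by (rule K.e_power) simp
    finally have two: "card {w \<in> L. w * w = v} = 2"
      using L.card_square_roots(2)[OF vL cL] False by blast
    have "{w \<in> L. w * w = v} = A \<union> B"
    proof -
      have "w ^ ?q = w \<or> w ^ ?q = - w" if w: "w \<in> L" "w * w = v" for w
      proof -
        have "w ^ ?q * w ^ ?q = (w * w) ^ ?q" by (rule power_mult_distrib[symmetric])
        also have "\<dots> = w * w" unfolding w(2) using K.power_card[OF vK] .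
        finally show ?thesis using L.square_eq_iff[OF power_card_K_mem[OF w(1)] w(1)] by blast
      qed
      then show ?thesis by (auto simp: A_def B_def)
    qed
    moreover have "A \<inter> B = {}"
    proof -
      have False if "V \<in> A" "V \<in> B" for V
      proof -
        have V: "V \<in> L" "V * V = v" "- V = V" using that by (auto simp: A_def B_def)
        have "2 * V = 0" using V(3) by (metis add.right_inverse mult_2)
        then have "V = 0" using L.two_mult_eq_0 V by blast
        then show False using V(2) False by simp
      qed
      then show ?thesis by blast
    qed
    ultimately show ?thesis using two L.fin by (simp add: A_def B_def card_Un_disjoint)
  qed
  ultimately show ?thesis by simp
qed

text \<open>For n = 4 this is the field with q^2 elements between \<open>K\<close> and
  \<open>L\<close>.\<close>

definition middle :: "'r set" where
  "middle = {x \<in> L. x ^ (card K ^ 2) = x}"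

text \<open>Closure comes from the Frobenius map of order q^2. The size comes from counting roots of
  unity of order dividing q^2 - 1, a divisor of card L - 1 = (q^2 + 1) (q^2 - 1).\<close>

lemma middle_facts:
  assumes n: "n = 4"
  shows "odd_ring_subfield middle e p (2 * k)" "card middle = card K ^ 2" "K \<subseteq> middle" "middle \<subseteq> L"
proof -
  let ?Q = "card K ^ 2"
  have Q: "?Q = p ^ (2 * k)" unfolding K.card_K by (simp add: power_mult[symmetric] mult.commute)
  have Q1: "?Q > 1" using one_less_power[OF K.card_gt_1, of 2] by simp
  have oddQ: "odd ?Q" using K.odd_K by simp
  have frob: "(x + y) ^ ?Q = x ^ ?Q + y ^ ?Q" if "x \<in> L" for x y
    unfolding Q by (rule L.frobenius_add[OF K.prime_p L.card_K that])
  show sub: "middle \<subseteq> L" by (auto simp: middle_def)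
  show K: "K \<subseteq> middle"
  proof
    fix x assume x: "x \<in> K"
    then have "x ^ ?Q = x" using K.power_card by (simp add: power2_eq_square power_mult)
    then show "x \<in> middle" using x K_le_L by (auto simp: middle_def)
  qed
  have unit: "x ^ (?Q - 1) = e" if x: "x \<in> middle" "x \<noteq> 0" for x
  proof -
    have xL: "x \<in> L" "x ^ ?Q = x" using x by (auto simp: middle_def)
    have "x * x ^ (?Q - 1) = x ^ ?Q" using Q1 by (metis Suc_diff_1 gr_implies_not0 linorder_neqE_nat not_less0 power_Suc)
    then have "x * x ^ (?Q - 1) = x * e" using xL L.mult_e by simp
    moreover have "x ^ (?Q - 1) \<in> L" using xL Q1 by (intro L.power_mem) auto
    ultimately show ?thesis using L.mult_left_cancel[of x] xL x L.e_mem by blast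
  qed
  have M_eq: "middle = insert 0 {x \<in> L. x ^ (?Q - 1) = e}"
  proof (intro equalityI subsetI)
    fix x assume "x \<in> insert 0 {x \<in> L. x ^ (?Q - 1) = e}"
    then show "x \<in> middle"
    proof
      assume "x = 0"
      then show ?thesis using K K.zero_mem by auto
    next
      assume x: "x \<in> {x \<in> L. x ^ (?Q - 1) = e}"
      have "x ^ ?Q = x * x ^ (?Q - 1)" using Q1 by (metis Suc_diff_1 gr_implies_not0 linorder_neqE_nat not_less0 power_Suc)
      then show ?thesis using x L.mult_e by (auto simp: middle_def)
    qed
  qed (use unit sub in auto)
  have "?Q - 1 > 0" using Q1 by simp
  then have "0 \<notin> {x \<in> L. x ^ (?Q - 1) = e}" using L.e_neq_0 by (auto simp: zero_power)
  moreover have "card {x \<in> L. x ^ (?Q - 1) = e} = ?Q - 1"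
  proof (rule L.power_fibres(1)[of "?Q + 1"])
    have "card L = ?Q * ?Q" unfolding card_L n by (simp add: power2_eq_square eval_nat_numeral)
    then show "card L - 1 = (?Q + 1) * (?Q - 1)" using Q1 by (simp add: algebra_simps)
  qed
  ultimately show card_M: "card middle = ?Q"
    unfolding M_eq using L.fin Q1 by simp
  show "odd_ring_subfield middle e p (2 * k)"
  proof unfold_locales
    show "finite middle" using sub L.fin finite_subset by blast
    show "e \<in> middle" using K K.e_mem by auto
    show "e \<noteq> 0" by (rule L.e_neq_0)
    show "x - y \<in> middle" if "x \<in> middle" "y \<in> middle" for x y
      using frob[of x "- y"] that oddQ L.diff_mem by (auto simp: middle_def)
    show "x * y \<in> middle" if "x \<in> middle" "y \<in> middle" for x y
      using that L.mult_mem by (auto simp: middle_def power_mult_distrib)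
    show "e * x = x" if "x \<in> middle" for x using that L.e_mult sub by auto
    show "\<exists>y\<in>middle. x * y = e" if x: "x \<in> middle" "x \<noteq> 0" for x
    proof -
      have xL: "x \<in> L" "x ^ ?Q = x" using x by (auto simp: middle_def)
      note i = L.inv_in[OF xL(1) x(2)]
      have "x * L.inv_in x ^ ?Q = (x * L.inv_in x) ^ ?Q" using xL(2) by (simp add: power_mult_distrib)
      also have "\<dots> = x * L.inv_in x" unfolding i(2) by (rule L.e_power) (use Q1 in linarith)
      finally have eq: "x * L.inv_in x ^ ?Q = x * L.inv_in x" .
      have "?Q > 0" using Q1 by linarith
      from iffD1[OF L.mult_left_cancel[OF xL(1) x(2) L.power_mem[OF i(1) this] i(1)] eq]
      have "L.inv_in x ^ ?Q = L.inv_in x" .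
      then show ?thesis using i by (auto simp: middle_def)
    qed
    show "prime p" by (rule K.prime_p)
    show "card middle = p ^ (2 * k)" unfolding card_M Q ..
    show "odd (card middle)" unfolding card_M using oddQ .
  qed
qed

end

section \<open>Multiplicative convolutions\<close>

context odd_ring_subfield
begin

definition nonzero_pairs :: "('r \<times> 'r) set" where
  "nonzero_pairs = (K - {0}) \<times> (K - {0})"

lemma card_nonzero_pairs: "card nonzero_pairs = (card K - 1)\<^sup>2"
  using fin zero_mem by (simp add: nonzero_pairs_def card_cartesian_product power2_eq_square)

lemma finite_nonzero_pairs: "finite nonzero_pairs"
  using fin by (simp add: nonzero_pairs_def)

lemma inv_in_involution:
  assumes "a \<in> K" "a \<noteq> 0" "c \<in> K" "c \<noteq> 0"
  shows "inv_in (inv_in a * c) * c = a"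
proof -
  let ?b = "inv_in a * c"
  have b: "?b \<in> K" "?b \<noteq> 0" using inv_in[OF assms(1,2)] assms mult_mem mult_eq_0 by auto
  have "a * ?b = c" using mult_eq_iff_inv[OF assms(1,2) b(1) assms(3)] by simp
  then have "?b * a = c" by (simp add: mult.commute)
  then show ?thesis using mult_eq_iff_inv[OF b assms(1,3)] by simp
qed

lemma sum_nonzero_pairs_inv:
  assumes "c \<in> K" "d \<in> K" "c \<noteq> 0" "d \<noteq> 0"
  shows "(\<Sum>(a, b)\<in>nonzero_pairs. f (inv_in a * c) (inv_in b * d)) = (\<Sum>(a, b)\<in>nonzero_pairs. f a b)"
  using assms inv_in mult_mem mult_eq_0
  by (intro sum.reindex_bij_witness[where i = "\<lambda>(a, b). (inv_in a * c, inv_in b * d)"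
        and j = "\<lambda>(a, b). (inv_in a * c, inv_in b * d)"])
     (auto simp: nonzero_pairs_def inv_in_involution)

text \<open>Pairs with prescribed products are counted by the multiplicative convolution of the
  one-variable counts. It is used for T_4, with f and g on K^2, and for pairs of elements of the
  intermediate field.\<close>

lemma card_product_equations:
  assumes cd: "c \<in> K" "d \<in> K" "c \<noteq> 0" "d \<noteq> 0" and T: "finite T"
    and fg: "\<And>t. t \<in> T \<Longrightarrow> f t \<in> K \<and> g t \<in> K"
  shows "card {(t, t') \<in> T \<times> T. f t * f t' = c \<and> g t * g t' = d}
    = (\<Sum>(a, b)\<in>nonzero_pairs. card {t \<in> T. f t = a \<and> g t = b}
         * card {t \<in> T. f t = inv_in a * c \<and> g t = inv_in b * d})"
proof -
  define F where "F a b = {t \<in> T. f t = a \<and> g t = b}" for a b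
  have finF: "finite (F a b)" for a b using T by (simp add: F_def)
  have "{(t, t') \<in> T \<times> T. f t * f t' = c \<and> g t * g t' = d}
      = (\<Union>(a, b)\<in>nonzero_pairs. F a b \<times> F (inv_in a * c) (inv_in b * d))" (is "?A = ?B")
  proof (intro equalityI subsetI)
    fix x assume "x \<in> ?A"
    then obtain t t' where x: "x = (t, t')" "t \<in> T" "t' \<in> T" "f t * f t' = c" "g t * g t' = d" by auto
    have nz: "f t \<noteq> 0" "g t \<noteq> 0" using x cd by auto
    then have "f t' = inv_in (f t) * c" "g t' = inv_in (g t) * d"
      using mult_eq_iff_inv[of "f t" "f t'" c] mult_eq_iff_inv[of "g t" "g t'" d] fg x cd by auto
    then have "x \<in> F (f t) (g t) \<times> F (inv_in (f t) * c) (inv_in (g t) * d)" using x by (simp add: F_def)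
    moreover have "(f t, g t) \<in> nonzero_pairs" using nz fg x by (simp add: nonzero_pairs_def)
    ultimately show "x \<in> ?B" by blast
  next
    fix x assume "x \<in> ?B"
    then obtain a b t t' where x: "x = (t, t')" "(a, b) \<in> nonzero_pairs" "t \<in> F a b" "t' \<in> F (inv_in a * c) (inv_in b * d)"
      by auto
    then have t: "t \<in> T" "t' \<in> T" "f t = a" "g t = b" "f t' = inv_in a * c" "g t' = inv_in b * d"
      "a \<in> K" "a \<noteq> 0" "b \<in> K" "b \<noteq> 0"
      by (auto simp: F_def nonzero_pairs_def)
    then have "f t * f t' = c" "g t * g t' = d"
      using mult_eq_iff_inv[OF t(7,8), of "f t'" c] mult_eq_iff_inv[OF t(9,10), of "g t'" d] fg[OF t(2)] cd
      unfolding t(3,4) by blast+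
    then show "x \<in> ?A" using x by (auto simp: F_def)
  qed
  then have "card ?A = card ?B" by simp
  also have "\<dots> = (\<Sum>(a, b)\<in>nonzero_pairs. card (F a b) * card (F (inv_in a * c) (inv_in b * d)))"
    using finite_nonzero_pairs finF
    by (subst card_UN_disjoint) (auto simp: case_prod_unfold card_cartesian_product F_def)
  finally show ?thesis unfolding F_def .
qed

lemma sum_card_split2: "(\<Sum>(a, b)\<in>nonzero_pairs. card (split2 a b)) = (card K - 2)\<^sup>2"
proof -
  have "(\<Union>(a, b)\<in>nonzero_pairs. split2 a b) = (K - {0, - e}) \<times> (K - {0, - e})" (is "?A = ?B")
  proof (intro equalityI subsetI)
    fix t assume "t \<in> ?A"
    then show "t \<in> ?B" by (auto simp: split2_def nonzero_pairs_def)
  next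
    fix t assume t: "t \<in> ?B"
    obtain x y where xy: "t = (x, y)" by (cases t)
    have m: "x \<in> K" "x \<noteq> 0" "x + e \<in> K" "x + e \<noteq> 0" "y \<in> K" "y \<noteq> 0" "y + e \<in> K" "y + e \<noteq> 0"
      using t xy add_mem e_mem plus_e_neq_0 by auto
    then have "(x * y, (x + e) * (y + e)) \<in> nonzero_pairs" "t \<in> split2 (x * y) ((x + e) * (y + e))"
      using mult_mem mult_eq_0 by (auto simp: nonzero_pairs_def split2_def xy)
    then show "t \<in> ?A" by blast
  qed
  then have "card ?A = card ?B" by simp
  moreover have "card ?A = (\<Sum>(a, b)\<in>nonzero_pairs. card (split2 a b))"
    using finite_nonzero_pairs finite_split2
    by (subst card_UN_disjoint) (auto simp: case_prod_unfold split2_def)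
  moreover have "card ?B = (card K - 2)\<^sup>2" unfolding card_cartesian_product card_punctured power2_eq_square ..
  ultimately show ?thesis by simp
qed

lemma card_split4_product:
  assumes "c \<in> K" "d \<in> K" "c \<noteq> 0" "d \<noteq> 0"
  shows "card (split4 c d) = (\<Sum>(a, b)\<in>nonzero_pairs. card (split2 a b) * card (split2 (inv_in a * c) (inv_in b * d)))"
proof -
  let ?f = "\<lambda>(x, y). x * y" and ?g = "\<lambda>(x, y). (x + e) * (y + e)"
  have eq: "split2 a b = {t \<in> K \<times> K. ?f t = a \<and> ?g t = b}" for a b
    by (auto simp: split2_def)
  have "card (split4 c d) = card {(t, t') \<in> (K \<times> K) \<times> (K \<times> K). ?f t * ?f t' = c \<and> ?g t * ?g t' = d}"
    by (rule bij_betw_same_card[of "\<lambda>(w, z, x, y). ((w, z), (x, y))"], rule bij_betw_byWitness[where f' = "\<lambda>((w, z), (x, y)). (w, z, x, y)"])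
       (auto simp: split4_def mult.assoc)
  also have "\<dots> = (\<Sum>(a, b)\<in>nonzero_pairs. card (split2 a b) * card (split2 (inv_in a * c) (inv_in b * d)))"
    unfolding eq using assms fin mult_mem add_mem e_mem by (intro card_product_equations) auto
  finally show ?thesis .
qed

end

section \<open>Degree four\<close>

context odd_field_ext
begin

text \<open>By transitivity of the norm, S_4(c, d) is a sum of counts S_2 = 2 - T_2 for
  \<open>L\<close> over the middle field, over (q + 1)^2 pairs. The sum of these T_2 counts pairs in
  the middle field and is a convolution of the S_2 = 2 - T_2 for that field over \<open>K\<close>.
  Expanding the product gives 4 (q - 1)^2 - 4 (q - 2)^2 + T_4, and the formula is 2 (q + 1)^2 minus
  this.\<close>

lemma card_norm_set_4:
  assumes n: "n = 4" and cd: "c \<in> K" "d \<in> K" "c \<noteq> 0" "d \<noteq> 0"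
  shows "real (card (norm_set c d)) = 2 * real (card K) ^ 2 - 4 * real (card K) + 14 - real (card (K.split4 c d))"
proof -
  let ?q = "card K" and ?M = middle
  interpret M: odd_ring_subfield ?M e p "2 * k" using middle_facts(1)[OF n] .
  interpret KM: odd_field_ext K ?M e p k "2 * k" "2"
    using middle_facts[OF n] by unfold_locales auto
  interpret LM: odd_field_ext ?M L e p "2 * k" l "2"
    using middle_facts[OF n] card_L n by unfold_locales (auto simp: power_mult[symmetric])
  have eKM: "KM.norm_exp = 1 + ?q" unfolding KM.norm_exp_def by (simp add: numeral_2_eq_2)
  have eLM: "LM.norm_exp = 1 + ?q ^ 2" unfolding LM.norm_exp_def middle_facts(2)[OF n] by (simp add: numeral_2_eq_2)
  have exp: "norm_exp = LM.norm_exp * KM.norm_exp"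
    unfolding eKM eLM norm_exp_def by (simp add: n) (simp add: eval_nat_numeral algebra_simps)
  define A where "A c = {u \<in> ?M. u ^ KM.norm_exp = c}" for c
  have cardA: "card (A c) = ?q + 1" if "c \<in> K" "c \<noteq> 0" for c
    unfolding A_def using KM.card_norm_fibre[OF that] eKM by simp
  have finA: "finite (A c)" for c unfolding A_def using M.fin by simp
  have "norm_set c d = (\<Union>(u, s)\<in>A c \<times> A d. LM.norm_set u s)" (is "_ = ?B")
  proof (intro equalityI subsetI)
    fix W assume "W \<in> norm_set c d"
    then have W: "W \<in> L" "W ^ norm_exp = c" "(W + e) ^ norm_exp = d" by (auto simp: norm_set_def)
    then have "W \<in> LM.norm_set (W ^ LM.norm_exp) ((W + e) ^ LM.norm_exp)" by (simp add: LM.norm_set_def)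
    moreover have "W ^ LM.norm_exp \<in> A c" "(W + e) ^ LM.norm_exp \<in> A d"
      using W LM.norm_mem_K plus_e_mem by (auto simp: A_def exp power_mult)
    ultimately show "W \<in> ?B" by blast
  next
    fix W assume "W \<in> ?B"
    then show "W \<in> norm_set c d" by (auto simp: LM.norm_set_def norm_set_def A_def exp power_mult)
  qed
  then have "card (norm_set c d) = card ?B" by simp
  also have "\<dots> = (\<Sum>(u, s)\<in>A c \<times> A d. card (LM.norm_set u s))"
    using finA LM.finite_norm_set
    by (subst card_UN_disjoint) (auto simp: case_prod_unfold dest: LM.norm_set_unique)
  finally have S: "card (norm_set c d) = (\<Sum>(u, s)\<in>A c \<times> A d. card (LM.norm_set u s))" .
  have quad: "card (LM.norm_set u s) + card (M.split2 u s) = 2" if "(u, s) \<in> A c \<times> A d" for u s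
    using LM.quadratic_norm_set[of u s] that by (auto simp: A_def)
  have "card (norm_set c d) + (\<Sum>(u, s)\<in>A c \<times> A d. card (M.split2 u s)) = (\<Sum>t\<in>A c \<times> A d. 2)"
    unfolding S sum.distrib[symmetric] using quad by (intro sum.cong) auto
  also have "\<dots> = 2 * (?q + 1)\<^sup>2" using cardA cd by (simp add: card_cartesian_product power2_eq_square)
  finally have S_eq: "card (norm_set c d) + (\<Sum>(u, s)\<in>A c \<times> A d. card (M.split2 u s)) = 2 * (?q + 1)\<^sup>2" .
  let ?f = "\<lambda>x. x ^ KM.norm_exp" and ?g = "\<lambda>x. (x + e) ^ KM.norm_exp"
  \<comment> \<open>The hinge of the argument: \<open>R\<close> is counted once by the values of x y
    and (x + e) (y + e) in the middle field, and once by the norms of x and x + e in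
    \<open>K\<close>.\<close>
  define R where "R = {(x, y) \<in> ?M \<times> ?M. ?f x * ?f y = c \<and> ?g x * ?g y = d}"
  have "R = (\<Union>(u, s)\<in>A c \<times> A d. M.split2 u s)" (is "_ = ?C")
  proof (intro equalityI subsetI)
    fix t assume "t \<in> R"
    then obtain x y where t: "t = (x, y)" "x \<in> ?M" "y \<in> ?M" "?f x * ?f y = c" "?g x * ?g y = d"
      by (auto simp: R_def)
    then have "x * y \<in> A c" "(x + e) * (y + e) \<in> A d" "t \<in> M.split2 (x * y) ((x + e) * (y + e))"
      using M.mult_mem M.add_mem M.e_mem by (auto simp: A_def power_mult_distrib M.split2_def)
    then show "t \<in> ?C" by blast
  next
    fix t assume "t \<in> ?C"
    then show "t \<in> R" by (auto simp: R_def A_def M.split2_def power_mult_distrib)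
  qed
  then have "card R = card ?C" by simp
  also have "\<dots> = (\<Sum>(u, s)\<in>A c \<times> A d. card (M.split2 u s))"
    using finA M.finite_split2
    by (subst card_UN_disjoint) (auto simp: case_prod_unfold M.split2_def)
  finally have R1: "card R = (\<Sum>(u, s)\<in>A c \<times> A d. card (M.split2 u s))" .
  have norm_set_eq: "KM.norm_set a b = {x \<in> ?M. ?f x = a \<and> ?g x = b}" for a b
    by (simp add: KM.norm_set_def)
  have R2: "card R = (\<Sum>(a, b)\<in>K.nonzero_pairs. card (KM.norm_set a b) * card (KM.norm_set (K.inv_in a * c) (K.inv_in b * d)))"
    unfolding R_def norm_set_eq using cd M.fin KM.norm_mem_K KM.plus_e_mem
    by (intro K.card_product_equations) auto
  define t where "t a b = real (card (K.split2 a b))" for a b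
  have KMt: "real (card (KM.norm_set a b)) = 2 - t a b" if "a \<in> K" "b \<in> K" for a b
    using KM.quadratic_norm_set[OF refl that] unfolding t_def by linarith
  have "real (card R) = (\<Sum>(a, b)\<in>K.nonzero_pairs. (2 - t a b) * (2 - t (K.inv_in a * c) (K.inv_in b * d)))"
    unfolding R2 of_nat_sum
  proof (intro sum.cong refl, clarify)
    fix a b assume "(a, b) \<in> K.nonzero_pairs"
    then have "a \<in> K" "b \<in> K" "K.inv_in a * c \<in> K" "K.inv_in b * d \<in> K"
      using K.inv_in K.mult_mem cd by (auto simp: K.nonzero_pairs_def)
    then show "real (card (KM.norm_set a b) * card (KM.norm_set (K.inv_in a * c) (K.inv_in b * d)))
        = (2 - t a b) * (2 - t (K.inv_in a * c) (K.inv_in b * d))"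
      using KMt by simp
  qed
  also have "\<dots> = (\<Sum>(a, b)\<in>K.nonzero_pairs. 4 - 2 * t a b - 2 * t (K.inv_in a * c) (K.inv_in b * d)
       + t a b * t (K.inv_in a * c) (K.inv_in b * d))"
    by (intro sum.cong refl) (auto simp: algebra_simps)
  also have "\<dots> = 4 * card K.nonzero_pairs - 2 * (\<Sum>(a, b)\<in>K.nonzero_pairs. t a b)
      - 2 * (\<Sum>(a, b)\<in>K.nonzero_pairs. t (K.inv_in a * c) (K.inv_in b * d))
      + (\<Sum>(a, b)\<in>K.nonzero_pairs. t a b * t (K.inv_in a * c) (K.inv_in b * d))"
    by (simp add: case_prod_unfold sum.distrib sum_subtractf sum_distrib_left)
  also have "(\<Sum>(a, b)\<in>K.nonzero_pairs. t (K.inv_in a * c) (K.inv_in b * d)) = (\<Sum>(a, b)\<in>K.nonzero_pairs. t a b)"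
    using cd by (rule K.sum_nonzero_pairs_inv)
  also have "(\<Sum>(a, b)\<in>K.nonzero_pairs. t a b) = real ((?q - 2)\<^sup>2)"
    unfolding K.sum_card_split2[symmetric] t_def of_nat_sum by (simp add: case_prod_unfold)
  also have "(\<Sum>(a, b)\<in>K.nonzero_pairs. t a b * t (K.inv_in a * c) (K.inv_in b * d)) = real (card (K.split4 c d))"
    unfolding K.card_split4_product[OF cd] t_def of_nat_sum by (simp add: case_prod_unfold)
  finally have R3: "real (card R) = 4 * real ((?q - 1)\<^sup>2) - 4 * real ((?q - 2)\<^sup>2) + real (card (K.split4 c d))"
    unfolding K.card_nonzero_pairs by simp
  have sq: "real ((?q - 1)\<^sup>2) = (real ?q - 1)\<^sup>2" "real ((?q - 2)\<^sup>2) = (real ?q - 2)\<^sup>2"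
    using K.card_gt_1 by (simp_all add: of_nat_diff)
  have "real (card (norm_set c d) + card R) = real (2 * (?q + 1)\<^sup>2)" using S_eq unfolding R1 by simp
  then have "real (card (norm_set c d)) + real (card R) = 2 * (real ?q + 1)\<^sup>2" by simp
  then show ?thesis using R3 unfolding sq by (simp add: power2_eq_square algebra_simps)
qed

text \<open>In degree four 2 q^2 - T_4 is again q^2 up to the error of T_4; 63 = 45 + 18, where 18 q
  bounds the terms linear in q.\<close>

lemma card_norm_set_ge_4:
  assumes cd: "c \<in> K" "d \<in> K" "c \<noteq> 0" "d \<noteq> 0" and n: "n \<ge> 4"
  shows "\<bar>real (card (norm_set c d)) - real (card K) ^ (n - 2)\<bar> * sqrt (real (card K))
    \<le> 63 * real (card K) ^ (n - 2)"
proof (cases "n = 4")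
  case False
  then have "n \<ge> 5" using n by simp
  moreover have "0 \<le> real (card K) ^ (n - 2)" by simp
  ultimately show ?thesis using card_norm_set_ge_5[OF cd] by linarith
next
  case True
  define q s where "q = real (card K)" and "s = sqrt q"
  have q1: "q \<ge> 1" unfolding q_def using K.card_gt_1 by simp
  have s: "s * s = q" "s \<ge> 1" unfolding s_def using q1 by simp_all
  have "\<bar>real (card (norm_set c d)) - q ^ 2\<bar> \<le> \<bar>real (card (K.split4 c d)) - q ^ 2\<bar> + \<bar>14 - 4 * q\<bar>"
    unfolding card_norm_set_4[OF True cd] q_def[symmetric] by linarith
  also have "\<dots> \<le> 45 * (q * s) + 18 * q"
    using K.card_split4_bound[OF cd] q1 unfolding q_def s_def by (intro add_mono) auto
  finally have "\<bar>real (card (norm_set c d)) - q ^ 2\<bar> * s \<le> (45 * (q * s) + 18 * q) * s"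
    using s by (intro mult_right_mono) auto
  also have "\<dots> = 45 * (q * (s * s)) + 18 * (q * s)" by (simp add: algebra_simps)
  also have "\<dots> \<le> 45 * (q * q) + 18 * (q * q)"
  proof -
    have "s * 1 \<le> s * s" using s(2) by (intro mult_left_mono) auto
    then have "q * s \<le> q * q" using s(1) q1 by (intro mult_left_mono) auto
    then show ?thesis using s(1) by simp
  qed
  finally show ?thesis using True unfolding q_def s_def by (simp add: power2_eq_square)
qed

end

section \<open>Monic cubics, given by the elementary symmetric functions of their roots, and how
  they factor\<close>

definition cubic :: "'r::comm_ring_1 \<times> 'r \<times> 'r \<Rightarrow> 'r \<Rightarrow> 'r" where
  "cubic t x = (case t of (s1, s2, s3) \<Rightarrow> x * x * x - s1 * (x * x) + s2 * x - s3)"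

definition sym3 :: "'r::comm_ring_1 \<Rightarrow> 'r \<Rightarrow> 'r \<Rightarrow> 'r \<times> 'r \<times> 'r" where
  "sym3 x y z = (x + y + z, x * y + y * z + z * x, x * y * z)"

lemma cubic_sym3: "cubic (sym3 x y z) w = (w - x) * (w - y) * (w - z)"
  by (simp add: cubic_def sym3_def algebra_simps)

lemma sum_card_fibres:
  assumes "finite T" "finite A"
  shows "(\<Sum>t\<in>T. card {x \<in> A. f x = t}) = card {x \<in> A. f x \<in> T}"
proof -
  have "{x \<in> A. f x \<in> T} = (\<Union>t\<in>T. {x \<in> A. f x = t})" by auto
  also have "card \<dots> = (\<Sum>t\<in>T. card {x \<in> A. f x = t})"
    using assms by (intro card_UN_disjoint) auto
  finally show ?thesis by simp
qed

context ring_subfield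
begin

definition cubic_roots :: "'r \<times> 'r \<times> 'r \<Rightarrow> 'r set" where
  "cubic_roots t = {x \<in> K. cubic t x = 0}"

definition cubic_splittings :: "'r \<times> 'r \<times> 'r \<Rightarrow> ('r \<times> 'r \<times> 'r) set" where
  "cubic_splittings t = {(x, y, z) \<in> K \<times> K \<times> K. sym3 x y z = t}"

definition cubic_triple_roots :: "'r \<times> 'r \<times> 'r \<Rightarrow> 'r set" where
  "cubic_triple_roots t = {x \<in> K. sym3 x x x = t}"

text \<open>For a cubic, having no root means being irreducible. The indicator is a number so that
  it can be summed over families of cubics.\<close>

definition rootless :: "'r \<times> 'r \<times> 'r \<Rightarrow> nat" where
  "rootless t = (if cubic_roots t = {} then 1 else 0)"

lemma card_cubic_roots_le:
  assumes "t \<in> K \<times> K \<times> K" shows "card (cubic_roots t) \<le> 3"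
proof -
  obtain s1 s2 s3 where t: "t = (s1, s2, s3)" "s1 \<in> K" "s2 \<in> K" "s3 \<in> K" using assms by auto
  let ?p = "[:- s3, s2, - s1, e:]"
  have "coeffs_in K ?p" using t uminus_mem e_mem by (auto simp: coeffs_in_pCons coeffs_in_0)
  moreover have "?p \<noteq> 0" using e_neq_0 by simp
  ultimately have "card {x \<in> K. poly ?p x = 0} \<le> degree ?p" by (rule card_roots_le)
  moreover have eq: "poly ?p x = cubic t x" if "x \<in> K" for x
    using mult_e[OF that] unfolding t cubic_def by (simp add: algebra_simps)
  have "{x \<in> K. poly ?p x = 0} = cubic_roots t"
    unfolding cubic_roots_def by (intro Collect_cong conj_cong refl) (simp only: eq)
  ultimately show ?thesis using e_neq_0 by simp
qed

lemma sym3_eq_cases: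
  assumes "x \<in> K" "y \<in> K" "z \<in> K" "a \<in> K" "b \<in> K" "c \<in> K" "sym3 x y z = sym3 a b c"
  shows "(x, y, z) \<in> {(a, b, c), (a, c, b), (b, a, c), (b, c, a), (c, a, b), (c, b, a)}"
proof -
  have step: "(y, z) \<in> {(b, c), (c, b)}"
    if "y \<in> K" "z \<in> K" "b \<in> K" "c \<in> K" "sym3 a y z = sym3 a b c" for a b c y z
  proof -
    have 1: "y + z = b + c" "a * y + y * z + z * a = a * b + b * c + c * a"
      using that(5) by (auto simp: sym3_def add.assoc)
    have "y * z = (a * y + y * z + z * a) - a * (y + z)" by (simp add: algebra_simps)
    also have "\<dots> = (a * b + b * c + c * a) - a * (b + c)" unfolding 1 ..
    also have "\<dots> = b * c" by (simp add: algebra_simps)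
    finally have 2: "y * z = b * c" .
    have "(y - b) * (y - c) = y * y - y * (b + c) + b * c" by (simp add: algebra_simps)
    also have "\<dots> = 0" unfolding 1(1)[symmetric] 2[symmetric] by (simp add: algebra_simps)
    finally have "y = b \<or> y = c" using mult_eq_0[OF diff_mem[OF that(1,3)] diff_mem[OF that(1,4)]] by auto
    then show ?thesis using 1(1) by auto
  qed
  have "(x - a) * ((x - b) * (x - c)) = 0"
    using cubic_sym3[of x y z x] cubic_sym3[of a b c x] assms(7) by (simp add: mult.assoc)
  then have "x = a \<or> x = b \<or> x = c"
    using assms(1-6) mult_eq_0[of "x - a" "(x - b) * (x - c)"] mult_eq_0[of "x - b" "x - c"] diff_mem mult_mem by auto
  then show ?thesis
  proof (elim disjE)
    assume "x = a"
    then show ?thesis using step[of y z b c a] assms by blast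
  next
    assume x: "x = b"
    have "sym3 a b c = sym3 b a c" by (simp add: sym3_def algebra_simps)
    then have "sym3 b y z = sym3 b a c" using assms(7) x by simp
    then show ?thesis using step[of y z a c b] assms(1-6) x by blast
  next
    assume x: "x = c"
    have "sym3 a b c = sym3 c a b" by (simp add: sym3_def algebra_simps)
    then have "sym3 c y z = sym3 c a b" using assms(7) x by simp
    then show ?thesis using step[of y z a b c] assms(1-6) x by blast
  qed
qed

text \<open>A linear relation that holds for each of the five factorization types: irreducible 3 =
  3, one simple root 3 = 3, three distinct roots 9 = 3 + 6, a double root 6 = 3 + 3, a triple root 3
  + 1 = 3 + 1. It makes it possible to count irreducible cubics through roots and ordered
  splittings.\<close>

lemma cubic_count:
  assumes "t \<in> K \<times> K \<times> K"
  shows "3 * rootless t + 3 * card (cubic_roots t) + card (cubic_triple_roots t)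
    = 3 + card (cubic_splittings t)"
proof -
  have root: "x \<in> cubic_roots t" if "(x, y, z) \<in> cubic_splittings t" for x y z
    using that cubic_sym3[of x y z x] by (auto simp: cubic_splittings_def cubic_roots_def)
  have diag: "(x, x, x) \<in> cubic_splittings t" if "x \<in> cubic_triple_roots t" for x
    using that by (auto simp: cubic_splittings_def cubic_triple_roots_def)
  show ?thesis
  proof (cases "cubic_splittings t = {}")
    case True
    then have triple: "cubic_triple_roots t = {}" using diag by blast
    show ?thesis
    proof (cases "cubic_roots t = {}")
      case True
      then show ?thesis using triple \<open>cubic_splittings t = {}\<close> by (simp add: rootless_def)
    next
      case False
      then obtain a where a: "a \<in> K" "cubic t a = 0" by (auto simp: cubic_roots_def)
      obtain s1 s2 s3 where t: "t = (s1, s2, s3)" "s1 \<in> K" "s2 \<in> K" "s3 \<in> K" using assms by auto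
      have s3: "s3 = a * a * a - s1 * (a * a) + s2 * a" using a(2) by (simp add: t cubic_def)
      have "x = a" if x: "x \<in> K" "cubic t x = 0" for x
      proof (rule ccontr)
        assume "x \<noteq> a"
        have "(x - a) * (x * x + x * a + a * a - s1 * (x + a) + s2) = 0"
          using x(2) by (simp add: t s3 cubic_def algebra_simps)
        moreover have "x * x + x * a + a * a - s1 * (x + a) + s2 \<in> K"
          using x a t by (intro add_mem diff_mem mult_mem) auto
        ultimately have 0: "x * x + x * a + a * a - s1 * (x + a) + s2 = 0"
          using mult_eq_0[OF diff_mem[OF x(1) a(1)]] \<open>x \<noteq> a\<close> by auto
        \<comment> \<open>The third root, forced by the sum of the roots: two distinct roots in
          \<open>K\<close> already give a complete splitting, so a cubic that does not split has at
          most one root.\<close>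
        define y where "y = s1 - a - x"
        have "sym3 a x y = t"
        proof -
          have s2: "s2 = - (x * x + x * a + a * a - s1 * (x + a))" by (rule minus_unique[OF 0, symmetric])
          show ?thesis unfolding t s3 s2 sym3_def y_def by (simp add: algebra_simps)
        qed
        moreover have "y \<in> K" unfolding y_def using t a x diff_mem by auto
        ultimately have "(a, x, y) \<in> cubic_splittings t" using a x by (simp add: cubic_splittings_def)
        then show False using \<open>cubic_splittings t = {}\<close> by simp
      qed
      then have "cubic_roots t = {a}" unfolding cubic_roots_def using a by blast
      then show ?thesis using triple \<open>cubic_splittings t = {}\<close> by (simp add: rootless_def)
    qed
  next
    case False
    then obtain a b c where "(a, b, c) \<in> cubic_splittings t" by auto
    then have abc: "a \<in> K" "b \<in> K" "c \<in> K" "t = sym3 a b c" by (auto simp: cubic_splittings_def)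
    have perms: "sym3 a c b = sym3 a b c" "sym3 b a c = sym3 a b c" "sym3 b c a = sym3 a b c"
      "sym3 c a b = sym3 a b c" "sym3 c b a = sym3 a b c"
      by (auto simp: sym3_def algebra_simps)
    have splittings: "cubic_splittings t = {(a, b, c), (a, c, b), (b, a, c), (b, c, a), (c, a, b), (c, b, a)}"
    proof (intro equalityI subsetI)
      fix u assume "u \<in> cubic_splittings t"
      then obtain x y z where u: "u = (x, y, z)" "x \<in> K" "y \<in> K" "z \<in> K" "sym3 x y z = sym3 a b c"
        unfolding cubic_splittings_def abc(4) by blast
      show "u \<in> {(a, b, c), (a, c, b), (b, a, c), (b, c, a), (c, a, b), (c, b, a)}"
        unfolding u(1) using u(2-4) abc(1-3) u(5) by (rule sym3_eq_cases)
    next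
      fix u assume "u \<in> {(a, b, c), (a, c, b), (b, a, c), (b, c, a), (c, a, b), (c, b, a)}"
      then show "u \<in> cubic_splittings t"
        unfolding cubic_splittings_def abc(4) using abc(1-3) perms by blast
    qed
    have roots: "cubic_roots t = {a, b, c}"
    proof -
      have "(x - a) * (x - b) * (x - c) = 0 \<longleftrightarrow> x = a \<or> x = b \<or> x = c" if "x \<in> K" for x
        using that abc mult_eq_0[of "x - a" "x - b"] mult_eq_0[of "(x - a) * (x - b)" "x - c"] diff_mem mult_mem by auto
      then show ?thesis using abc by (auto simp: cubic_roots_def cubic_sym3)
    qed
    have triple: "cubic_triple_roots t = (if a = b \<and> b = c then {a} else {})"
    proof -
      have "x \<in> cubic_triple_roots t \<longleftrightarrow> (x, x, x) \<in> cubic_splittings t" for x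
        unfolding cubic_splittings_def cubic_triple_roots_def by blast
      then have m: "x \<in> cubic_triple_roots t \<longleftrightarrow> x = a \<and> x = b \<and> x = c" for x
        unfolding splittings insert_iff empty_iff prod.inject by blast
      show ?thesis by (intro equalityI subsetI) (auto simp: m split: if_splits)
    qed
    consider "a = b" "b = c" | "a = b" "b \<noteq> c" | "b = c" "a \<noteq> b" | "a = c" "a \<noteq> b" | "a \<noteq> b" "b \<noteq> c" "a \<noteq> c"
      by blast
    then show ?thesis
      unfolding rootless_def splittings roots triple
    proof cases
      case 5
      then have "b \<noteq> a" "c \<noteq> b" "c \<noteq> a" by simp_all
      with 5 show "3 * (if {a, b, c} = {} then 1 else 0) + 3 * card {a, b, c} + card (if a = b \<and> b = c then {a} else {})
          = 3 + card {(a, b, c), (a, c, b), (b, a, c), (b, c, a), (c, a, b), (c, b, a)}"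
        by simp
    qed (auto simp: card_insert_if)
  qed
qed



lemma finite_triples: "finite (K \<times> K \<times> K)"
  using fin by simp

lemma sum_cubic_count:
  assumes "T \<subseteq> K \<times> K \<times> K"
  shows "3 * (\<Sum>t\<in>T. rootless t) + 3 * (\<Sum>t\<in>T. card (cubic_roots t)) + (\<Sum>t\<in>T. card (cubic_triple_roots t))
    = 3 * card T + (\<Sum>t\<in>T. card (cubic_splittings t))"
proof -
  have "(\<Sum>t\<in>T. 3 * rootless t + 3 * card (cubic_roots t) + card (cubic_triple_roots t))
      = (\<Sum>t\<in>T. 3 + card (cubic_splittings t))"
    using cubic_count assms by (intro sum.cong refl) blast
  then show ?thesis by (simp add: sum.distrib sum_distrib_left)
qed

lemma sym3_mem: "x \<in> K \<Longrightarrow> y \<in> K \<Longrightarrow> z \<in> K \<Longrightarrow> sym3 x y z \<in> K \<times> K \<times> K"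
  by (auto simp: sym3_def intro!: add_mem mult_mem)

lemma sum_card_cubic_splittings:
  assumes "T \<subseteq> K \<times> K \<times> K"
  shows "(\<Sum>t\<in>T. card (cubic_splittings t)) = card {(x, y, z) \<in> K \<times> K \<times> K. sym3 x y z \<in> T}"
proof -
  have "finite T" using assms finite_triples finite_subset by blast
  moreover have "cubic_splittings t = {u \<in> K \<times> K \<times> K. (case u of (x, y, z) \<Rightarrow> sym3 x y z) = t}" for t
    by (auto simp: cubic_splittings_def)
  moreover have "{(x, y, z) \<in> K \<times> K \<times> K. sym3 x y z \<in> T}
      = {u \<in> K \<times> K \<times> K. (case u of (x, y, z) \<Rightarrow> sym3 x y z) \<in> T}" by auto
  ultimately show ?thesis
    using sum_card_fibres[of T "K \<times> K \<times> K" "\<lambda>(x, y, z). sym3 x y z"] finite_triples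
    by simp
qed

lemma sum_card_cubic_triple_roots:
  assumes "T \<subseteq> K \<times> K \<times> K"
  shows "(\<Sum>t\<in>T. card (cubic_triple_roots t)) = card {x \<in> K. sym3 x x x \<in> T}"
  unfolding cubic_triple_roots_def using assms finite_triples finite_subset fin
  by (intro sum_card_fibres) blast+

text \<open>Over all q^3 cubics the roots number q^3, since s1, s2 and the root determine s3; the
  ordered splittings number q^3 and the triple roots q. The relation \<open>cubic_count\<close>
  leaves q^3 - q.\<close>

lemma sum_rootless: "3 * (\<Sum>t\<in>K \<times> K \<times> K. rootless t) = card K ^ 3 - card K"
proof -
  let ?T = "K \<times> K \<times> K"
  have "(\<Sum>t\<in>?T. card (cubic_roots t)) = (\<Sum>t\<in>?T. card {x \<in> K. cubic t x = 0})"
    by (simp add: cubic_roots_def)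
  also have "\<dots> = card (Sigma ?T (\<lambda>t. {x \<in> K. cubic t x = 0}))" using fin by simp
  also have "\<dots> = card ?T"
  proof (rule bij_betw_same_card[OF bij_betw_byWitness])
    let ?F = "\<lambda>((s1, s2, s3), x). (s1, s2, x)"
    let ?G = "\<lambda>(s1, s2, x). ((s1, s2, x * x * x - s1 * (x * x) + s2 * x), x)"
    show "\<forall>u\<in>Sigma ?T (\<lambda>t. {x \<in> K. cubic t x = 0}). ?G (?F u) = u" by (auto simp: cubic_def)
    show "\<forall>u\<in>?T. ?F (?G u) = u" by auto
    show "?F ` Sigma ?T (\<lambda>t. {x \<in> K. cubic t x = 0}) \<subseteq> ?T" by auto
    show "?G ` ?T \<subseteq> Sigma ?T (\<lambda>t. {x \<in> K. cubic t x = 0})"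
      by (auto simp: cubic_def intro!: add_mem diff_mem mult_mem)
  qed
  finally have 1: "(\<Sum>t\<in>?T. card (cubic_roots t)) = card ?T" .
  have "{(x, y, z) \<in> ?T. sym3 x y z \<in> ?T} = ?T" using sym3_mem by auto
  then have 2: "(\<Sum>t\<in>?T. card (cubic_splittings t)) = card ?T"
    using sum_card_cubic_splittings[of ?T] by simp
  have "{x \<in> K. sym3 x x x \<in> ?T} = K" using sym3_mem by auto
  then have 3: "(\<Sum>t\<in>?T. card (cubic_triple_roots t)) = card K"
    using sum_card_cubic_triple_roots[of ?T] by simp
  have "card ?T = card K ^ 3" by (simp add: card_cartesian_product eval_nat_numeral)
  then show ?thesis using sum_cubic_count[of ?T] unfolding 1 2 3 by simp
qed

end

section \<open>Degree three\<close>

context odd_field_ext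
begin

text \<open>For n = 3 this is the characteristic polynomial of W over \<open>K\<close>.\<close>

definition conj_cubic :: "'r \<Rightarrow> 'r \<times> 'r \<times> 'r" where
  "conj_cubic W = sym3 W (W ^ card K) ((W ^ card K) ^ card K)"

lemma conj_facts:
  assumes n: "n = 3" and W: "W \<in> L"
  shows "W ^ card K \<in> L" "(W ^ card K) ^ card K \<in> L" "((W ^ card K) ^ card K) ^ card K = W"
proof -
  show 1: "W ^ card K \<in> L" using power_card_K_mem W by auto
  then show "(W ^ card K) ^ card K \<in> L" using power_card_K_mem by auto
  have "((W ^ card K) ^ card K) ^ card K = W ^ card L"
    unfolding card_L n by (simp add: power_mult[symmetric] eval_nat_numeral mult.assoc)
  then show "((W ^ card K) ^ card K) ^ card K = W" using L.power_card[OF W] by simp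
qed

lemma conj_cubic_mem: assumes n: "n = 3" and W: "W \<in> L" shows "conj_cubic W \<in> K \<times> K \<times> K"
proof -
  define X Y where "X = W ^ card K" and "Y = X ^ card K"
  have XY: "X \<in> L" "Y \<in> L" "Y ^ card K = W" using conj_facts[OF n W] by (auto simp: X_def Y_def)
  have fr: "W ^ card K = X" "X ^ card K = Y" by (simp_all add: X_def Y_def)
  have m: "W * X \<in> L" "X * Y \<in> L" "Y * W \<in> L" "W + X \<in> L" "W * X + X * Y \<in> L" using W XY L.mult_mem L.add_mem by auto
  have "(W + X + Y) ^ card K = W + X + Y"
    unfolding frobenius[OF m(4)] frobenius[OF W] fr XY(3) by (simp add: algebra_simps)
  then have 1: "W + X + Y \<in> K" using mem_K_iff m W XY L.add_mem by auto
  have "(W * X + X * Y + Y * W) ^ card K = W * X + X * Y + Y * W"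
    unfolding frobenius[OF m(5)] frobenius[OF m(1)] power_mult_distrib fr XY(3) by (simp add: algebra_simps)
  then have 2: "W * X + X * Y + Y * W \<in> K" using mem_K_iff m L.add_mem by auto
  have "(W * X * Y) ^ card K = W * X * Y"
    unfolding power_mult_distrib fr XY(3) by (simp add: algebra_simps)
  then have 3: "W * X * Y \<in> K" using mem_K_iff m XY L.mult_mem by auto
  show ?thesis using 1 2 3 by (simp add: conj_cubic_def sym3_def X_def Y_def)
qed

lemma cubic_conj_cubic: "cubic (conj_cubic W) x = (x - W) * (x - W ^ card K) * (x - (W ^ card K) ^ card K)"
  unfolding conj_cubic_def by (rule cubic_sym3)

lemma conj_cubic_rootless:
  assumes n: "n = 3" and W: "W \<in> L"
  shows "W \<notin> K \<longleftrightarrow> K.rootless (conj_cubic W) = 1"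
proof -
  have "K.cubic_roots (conj_cubic W) = {} \<longleftrightarrow> W \<notin> K"
  proof
    assume "K.cubic_roots (conj_cubic W) = {}"
    then show "W \<notin> K" using cubic_conj_cubic[of W W] by (auto simp: K.cubic_roots_def)
  next
    assume WK: "W \<notin> K"
    have False if x: "x \<in> K" "cubic (conj_cubic W) x = 0" for x
    proof -
      note c = conj_facts[OF n W]
      have xL: "x \<in> L" using x K_le_L by auto
      have "(x - W) * (x - W ^ card K) = 0 \<or> x - (W ^ card K) ^ card K = 0"
        using x(2) unfolding cubic_conj_cubic
        by (subst (asm) L.mult_eq_0) (use xL W c L.diff_mem L.mult_mem in auto)
      then have "x = W \<or> x = W ^ card K \<or> x = (W ^ card K) ^ card K"
        using L.mult_eq_0[of "x - W" "x - W ^ card K"] xL W c L.diff_mem by auto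
      \<comment> \<open>An element of \<open>K\<close> is fixed by Frobenius, so if it equals one
        conjugate of W it equals W.\<close>
      then have "x = W" using K.power_card[OF x(1)] c(3) by metis
      then show False using WK x by simp
    qed
    then show "K.cubic_roots (conj_cubic W) = {}" by (auto simp: K.cubic_roots_def)
  qed
  then show ?thesis by (auto simp: K.rootless_def)
qed

lemma card_conj_cubic_fibre_le:
  assumes n: "n = 3" and t: "t \<in> K \<times> K \<times> K"
  shows "card {W \<in> L. conj_cubic W = t} \<le> 3"
proof -
  have "{W \<in> L. conj_cubic W = t} \<subseteq> L.cubic_roots t"
    using cubic_conj_cubic by (auto simp: L.cubic_roots_def)
  then have "card {W \<in> L. conj_cubic W = t} \<le> card (L.cubic_roots t)"
    using L.fin by (intro card_mono) (auto simp: L.cubic_roots_def)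
  also have "\<dots> \<le> 3" using t K_le_L by (intro L.card_cubic_roots_le) auto
  finally show ?thesis .
qed

text \<open>
  Every rootless cubic over \<open>K\<close> has three roots in \<open>L\<close>: the \<open>q\<^sup>3 - q\<close> elements of \<open>L - K\<close> are distributed
  over the \<open>(q\<^sup>3 - q) / 3\<close> rootless cubics, at most three to each.
\<close>

lemma card_conj_cubic_fibre:
  assumes n: "n = 3" and t: "t \<in> K \<times> K \<times> K" "K.rootless t = 1"
  shows "card {W \<in> L. conj_cubic W = t} = 3"
proof (rule ccontr)
  let ?T = "{t \<in> K \<times> K \<times> K. K.rootless t = 1}"
  let ?c = "\<lambda>t. card {W \<in> L. conj_cubic W = t}"
  have finT: "finite ?T" using K.finite_triples by simp
  assume "?c t \<noteq> 3"
  then have "?c t < 3" using card_conj_cubic_fibre_le[OF n t(1)] by simp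
  then have "(\<Sum>t\<in>?T. ?c t) < (\<Sum>t\<in>?T. 3)"
    using card_conj_cubic_fibre_le[OF n] t finT by (intro sum_strict_mono_ex1) auto
  also have "(\<Sum>t\<in>?T. 3) = 3 * (\<Sum>t\<in>?T. K.rootless t)" by simp
  also have "(\<Sum>t\<in>?T. K.rootless t) = (\<Sum>t\<in>K \<times> K \<times> K. K.rootless t)"
    using K.finite_triples by (intro sum.mono_neutral_left) (auto simp: K.rootless_def)
  finally have less: "(\<Sum>t\<in>?T. ?c t) < card K ^ 3 - card K" unfolding K.sum_rootless .
  have "(\<Sum>t\<in>?T. ?c t) = card {W \<in> L. conj_cubic W \<in> ?T}"
    using finT L.fin by (rule sum_card_fibres)
  also have "{W \<in> L. conj_cubic W \<in> ?T} = L - K"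
    using conj_cubic_mem[OF n] conj_cubic_rootless[OF n] by auto
  also have "card (L - K) = card K ^ 3 - card K"
    using K_le_L K.fin by (simp add: card_Diff_subset card_L n)
  finally show False using less by simp
qed

text \<open>The norm of W is s3 and the norm of W + e is s3 + s2 + s1 + e. Both being prescribed
  fixes s3 and s1 + s2, which leaves a family of cubics with one free parameter s = s1.\<close>

lemma norm_set_conj_cubic:
  assumes n: "n = 3" and W: "W \<in> L"
  shows "W \<in> norm_set c d \<longleftrightarrow> (\<exists>s\<in>K. conj_cubic W = (s, d - c - e - s, c))"
proof -
  define X Y where "X = W ^ card K" and "Y = X ^ card K"
  have XY: "X \<in> L" "Y \<in> L" using conj_facts[OF n W] by (auto simp: X_def Y_def)
  have ne: "V ^ norm_exp = V * V ^ card K * (V ^ card K) ^ card K" for V :: 'r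
    unfolding norm_exp_def by (simp add: n eval_nat_numeral power_add power_mult)
  have eK: "e ^ card K = e" using K.power_card K.e_mem by auto
  have "(W + e) ^ norm_exp = (W + e) * (X + e) * (Y + e)"
    unfolding ne frobenius[OF W] X_def[symmetric] frobenius[OF XY(1)] Y_def[symmetric] eK
    by (simp add: eK frobenius[OF XY(1)] Y_def)
  moreover have "(W + e) * (X + e) * (Y + e) = W * X * Y + (W * X + X * Y + Y * W) + (W + X + Y) + e"
  proof -
    have E: "e * e = e" "e * W = W" "W * e = W" "e * X = X" "X * e = X" "e * Y = Y" "Y * e = Y"
      "\<And>u. e * (e * u) = e * u" "\<And>u. e * (W * u) = W * u" "\<And>u. e * (X * u) = X * u" "\<And>u. e * (Y * u) = Y * u"
      using W XY L.e_mult L.mult_e L.e_mem by (auto simp: mult.assoc[symmetric])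
    show ?thesis by (simp add: algebra_simps E)
  qed
  moreover have "W ^ norm_exp = W * X * Y" unfolding ne X_def Y_def ..
  ultimately have 1: "W \<in> norm_set c d \<longleftrightarrow>
      W * X * Y = c \<and> W * X * Y + (W * X + X * Y + Y * W) + (W + X + Y) + e = d"
    using W by (simp add: norm_set_def)
  have 2: "conj_cubic W = (W + X + Y, W * X + X * Y + Y * W, W * X * Y)"
    unfolding conj_cubic_def sym3_def X_def Y_def ..
  have 3: "W + X + Y \<in> K" using conj_cubic_mem[OF n W] unfolding 2 by auto
  have 4: "c + u + s + e = d \<longleftrightarrow> u = d - c - e - s" for u s by (auto simp: algebra_simps)
  show ?thesis unfolding 1 2 using 3 4 by auto
qed

text \<open>At most three W belong to each of the q cubics of the family, which gives the upper
  bound. Each irreducible cubic contributes exactly three, and summing \<open>cubic_count\<close>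
  over the family expresses three times their number as 3 q plus the splittings, at least T_3, minus
  three times the roots, at most 3 (q - 2), minus the triple roots, at most 3. The total is at least
  T_3.\<close>

lemma card_norm_set_3:
  assumes n: "n = 3" and cd: "c \<in> K" "d \<in> K" "c \<noteq> 0" "d \<noteq> 0"
  shows "card (norm_set c d) \<le> 3 * card K" and "card (K.split3 c d) \<le> card (norm_set c d)"
proof -
  define m where "m = d - c - e"
  define T where "T = (\<lambda>s. (s, m - s, c)) ` K"
  have mK: "m \<in> K" unfolding m_def using cd K.diff_mem K.e_mem by auto
  have TK: "T \<subseteq> K \<times> K \<times> K" unfolding T_def using mK cd K.diff_mem by auto
  have finT: "finite T" unfolding T_def using K.fin by simp
  have cardT: "card T = card K" unfolding T_def by (rule card_image) (auto simp: inj_on_def)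
  have "norm_set c d = {W \<in> L. conj_cubic W \<in> T}"
  proof (intro equalityI subsetI)
    fix W assume W: "W \<in> norm_set c d"
    then have "W \<in> L" by (simp add: norm_set_def)
    then show "W \<in> {W \<in> L. conj_cubic W \<in> T}"
      using W norm_set_conj_cubic[OF n] by (auto simp: T_def m_def)
  next
    fix W assume "W \<in> {W \<in> L. conj_cubic W \<in> T}"
    then show "W \<in> norm_set c d" using norm_set_conj_cubic[OF n, of W c d] by (auto simp: T_def m_def)
  qed
  then have S: "card (norm_set c d) = (\<Sum>t\<in>T. card {W \<in> L. conj_cubic W = t})"
    using sum_card_fibres[OF finT L.fin, of conj_cubic] by simp
  also have "\<dots> \<le> (\<Sum>t\<in>T. 3)" using card_conj_cubic_fibre_le[OF n] TK by (intro sum_mono) auto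
  finally show "card (norm_set c d) \<le> 3 * card K" using cardT by simp
  have "3 * (\<Sum>t\<in>T. K.rootless t) = (\<Sum>t\<in>T. 3 * K.rootless t)" by (rule sum_distrib_left)
  also have "\<dots> \<le> card (norm_set c d)"
    unfolding S
  proof (rule sum_mono)
    fix t assume "t \<in> T"
    then show "3 * K.rootless t \<le> card {W \<in> L. conj_cubic W = t}"
      using card_conj_cubic_fibre[OF n, of t] TK by (auto simp: K.rootless_def)
  qed
  finally have low: "3 * (\<Sum>t\<in>T. K.rootless t) \<le> card (norm_set c d)" .
  \<comment> \<open>The parameter s enters with coefficient x (x + e) up to sign, so each x other
    than 0 and -e is a root of at most one member of the family. At 0 and -e all members take the
    nonzero values -c and -d.\<close>
  have roots: "(\<Sum>t\<in>T. card (K.cubic_roots t)) \<le> card K - 2"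
  proof -
    have "(\<Sum>t\<in>T. card (K.cubic_roots t)) = (\<Sum>s\<in>K. card {x \<in> K. cubic (s, m - s, c) x = 0})"
      unfolding T_def by (subst sum.reindex) (auto simp: inj_on_def K.cubic_roots_def)
    also have "\<dots> = card (Sigma K (\<lambda>s. {x \<in> K. cubic (s, m - s, c) x = 0}))" using K.fin by simp
    also have "\<dots> \<le> card (K - {0, - e})"
    proof (rule card_inj_on_le[where f = snd])
      have eq: "cubic (s, m - s, c) x = x * x * x + m * x - c - s * (x * (x + e))" if "s \<in> K" "x \<in> K" for s x
        using K.mult_e[OF that(2)] unfolding cubic_def by (simp add: algebra_simps)
      have E: "e * e = e" "m * e = m" using K.e_mult K.mult_e mK K.e_mem by auto
      have ne: "x \<noteq> 0 \<and> x \<noteq> - e" if "s \<in> K" "x \<in> K" "cubic (s, m - s, c) x = 0" for s x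
        using that eq[OF that(1,2)] cd E by (auto simp: m_def)
      show "snd ` Sigma K (\<lambda>s. {x \<in> K. cubic (s, m - s, c) x = 0}) \<subseteq> K - {0, - e}"
        using ne by auto
      show "inj_on snd (Sigma K (\<lambda>s. {x \<in> K. cubic (s, m - s, c) x = 0}))"
      proof (rule inj_onI, clarsimp)
        fix s s' x
        assume a: "s \<in> K" "s' \<in> K" "x \<in> K" "cubic (s, m - s, c) x = 0" "cubic (s', m - s', c) x = 0"
        then have "s * (x * (x + e)) = s' * (x * (x + e))"
          unfolding eq[OF a(1,3)] eq[OF a(2,3)] by (simp only: right_minus_eq)
        then have 0: "(x * (x + e)) * s = (x * (x + e)) * s'" by (simp add: mult.commute)
        have "x + e \<in> K" "x + e \<noteq> 0" "x \<noteq> 0" using ne[OF a(1,3,4)] K.plus_e_neq_0 K.add_mem K.e_mem a by auto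
        then have "x * (x + e) \<in> K" "x * (x + e) \<noteq> 0" using K.mult_mem K.mult_eq_0 a by auto
        then show "s = s'" using K.mult_left_cancel 0 a by blast
      qed
      show "finite (K - {0, - e})" using K.fin by simp
    qed
    also have "\<dots> = card K - 2" by (rule K.card_punctured)
    finally show ?thesis .
  qed
  \<comment> \<open>A triple root x satisfies x^3 = c.\<close>
  have triple: "(\<Sum>t\<in>T. card (K.cubic_triple_roots t)) \<le> 3"
  proof -
    have "{x \<in> K. sym3 x x x \<in> T} \<subseteq> {x \<in> K. x ^ 3 = c}" by (auto simp: T_def sym3_def eval_nat_numeral mult.assoc)
    then have "card {x \<in> K. sym3 x x x \<in> T} \<le> card {x \<in> K. x ^ 3 = c}" using K.fin by (intro card_mono) auto
    also have "\<dots> \<le> 3" using K.card_power_roots_le[of 3 c] cd by simp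
    finally show ?thesis using K.sum_card_cubic_triple_roots[OF TK] by simp
  qed
  have splittings: "card (K.split3 c d) \<le> (\<Sum>t\<in>T. card (K.cubic_splittings t))"
    unfolding K.sum_card_cubic_splittings[OF TK]
  proof (rule card_mono)
    show "finite {(x, y, z) \<in> K \<times> K \<times> K. sym3 x y z \<in> T}"
      by (rule finite_subset[OF _ K.finite_triples]) auto
    show "K.split3 c d \<subseteq> {(x, y, z) \<in> K \<times> K \<times> K. sym3 x y z \<in> T}"
    proof (rule subsetI)
      fix u assume "u \<in> K.split3 c d"
      then obtain x y z where xyz: "u = (x, y, z)" "x \<in> K" "y \<in> K" "z \<in> K" "x * (y * z) = c" "(x + e) * ((y + e) * (z + e)) = d"
        by (auto simp: K.split3_def)
      have E: "e * e = e" "e * x = x" "x * e = x" "e * y = y" "y * e = y" "e * z = z" "z * e = z"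
        "\<And>u. e * (e * u) = e * u" "\<And>u. e * (x * u) = x * u" "\<And>u. e * (y * u) = y * u" "\<And>u. e * (z * u) = z * u"
        using xyz K.e_mult K.mult_e K.e_mem by (auto simp: mult.assoc[symmetric])
      have "d = c + (x * y + y * z + z * x) + (x + y + z) + e"
        unfolding xyz(6)[symmetric] xyz(5)[symmetric] by (simp add: algebra_simps E)
      then have "x * y + y * z + z * x = m - (x + y + z)" unfolding m_def by (simp add: algebra_simps)
      moreover have "x + y + z \<in> K" using xyz K.add_mem by auto
      ultimately have "sym3 x y z \<in> T" unfolding T_def sym3_def using xyz(5) by (auto simp: mult.assoc)
      then show "u \<in> {(x, y, z) \<in> K \<times> K \<times> K. sym3 x y z \<in> T}" using xyz by auto
    qed
  qed
  have "card K \<ge> 2" using K.card_gt_1 by simp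
  then show "card (K.split3 c d) \<le> card (norm_set c d)"
    using K.sum_cubic_count[OF TK] low roots triple splittings cardT by linarith
qed

end

section \<open>Common neighbours\<close>

context odd_field_ext
begin

definition vertices :: "('r \<times> 'r) set" where
  "vertices = L \<times> (K - {0})"

text \<open>Solutions of the equations alone: a member of \<open>D\<close> may occur among them,
  although a graph has no loops. The difference is dealt with when the graph enters.\<close>

definition common_nbrs :: "('r \<times> 'r) set \<Rightarrow> ('r \<times> 'r) set" where
  "common_nbrs D = {(X, x). X \<in> L \<and> x \<in> K - {0} \<and> (\<forall>(A, a)\<in>D. (A + X) ^ norm_exp = a * x)}"

lemma common_nbrs_subset: "common_nbrs D \<subseteq> vertices"
  by (auto simp: common_nbrs_def vertices_def)

lemma finite_vertices: "finite vertices"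
  using L.fin K.fin by (simp add: vertices_def)

text \<open>A common first coordinate would give a x = b x with x nonzero. So such sets are harmless
  for upper bounds and must be avoided for lower bounds.\<close>

lemma common_nbrs_fst_inj:
  assumes "D \<subseteq> vertices" "\<not> inj_on fst D" shows "common_nbrs D = {}"
proof -
  obtain A a b where D: "(A, a) \<in> D" "(A, b) \<in> D" "a \<noteq> b" using assms(2) unfolding inj_on_def by (metis prod.collapse prod_eq_iff)
  then have K: "a \<in> K" "b \<in> K" using assms(1) by (auto simp: vertices_def)
  have False if "(X, x) \<in> common_nbrs D" for X x
  proof -
    have x: "x \<in> K" "x \<noteq> 0" "(A + X) ^ norm_exp = a * x" "(A + X) ^ norm_exp = b * x"
      using that D by (auto simp: common_nbrs_def)
    then have "a * x = b * x" by simp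
    then have "x * a = x * b" by (simp add: mult.commute)
    then show False using K.mult_left_cancel[of x a b] K D x by blast
  qed
  then show ?thesis by auto
qed

text \<open>Any member of \<open>D\<close> determines the second coordinate of a common neighbour
  from the first.\<close>

lemma card_common_nbrs_colour:
  assumes "D \<subseteq> vertices" "D \<noteq> {}" "finite B"
  shows "card {y \<in> common_nbrs D. fst y \<in> B} \<le> card B"
proof (rule card_inj_on_le[where f = fst])
  obtain A a where D: "(A, a) \<in> D" using assms(2) by auto
  then have a: "a \<in> K" "a \<noteq> 0" using assms(1) by (auto simp: vertices_def)
  show "inj_on fst {y \<in> common_nbrs D. fst y \<in> B}"
  proof (rule inj_onI, clarsimp)
    fix X x x' assume "(X, x) \<in> common_nbrs D" "(X, x') \<in> common_nbrs D"
    then have "x \<in> K" "x' \<in> K" "(A + X) ^ norm_exp = a * x" "(A + X) ^ norm_exp = a * x'"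
      using D by (auto simp: common_nbrs_def)
    then have "x \<in> K" "x' \<in> K" "a * x = a * x'" by simp_all
    then show "x = x'" using K.mult_left_cancel a by blast
  qed
qed (use assms in auto)

lemma card_common_nbrs_0: "card (common_nbrs {}) = card K ^ n * (card K - 1)"
proof -
  have "common_nbrs {} = L \<times> (K - {0})" by (auto simp: common_nbrs_def)
  then show ?thesis using K.fin K.zero_mem by (simp add: card_cartesian_product card_L)
qed

text \<open>The equation for (A, a) is solved for x, which is nonzero exactly if A + X is, and x is
  eliminated from the other equations.\<close>

lemma card_common_nbrs_insert:
  assumes "(A, a) \<in> vertices" "D \<subseteq> vertices"
  shows "card (common_nbrs (insert (A, a) D))
    = card {X \<in> L. A + X \<noteq> 0 \<and> (\<forall>(B, b)\<in>D. (B + X) ^ norm_exp * a = b * (A + X) ^ norm_exp)}"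
proof (rule bij_betw_same_card[OF bij_betw_byWitness])
  let ?S = "{X \<in> L. A + X \<noteq> 0 \<and> (\<forall>(B, b)\<in>D. (B + X) ^ norm_exp * a = b * (A + X) ^ norm_exp)}"
  let ?F = "\<lambda>y. fst y" and ?G = "\<lambda>X. (X, K.inv_in a * (A + X) ^ norm_exp)"
  have A: "A \<in> L" "a \<in> K" "a \<noteq> 0" using assms by (auto simp: vertices_def)
  have N: "(B + X) ^ norm_exp \<in> K" if "B \<in> L" "X \<in> L" for B X
    using norm_mem_K L.add_mem that by auto
  have main: "(X, x) \<in> common_nbrs (insert (A, a) D) \<longleftrightarrow> X \<in> ?S \<and> x = K.inv_in a * (A + X) ^ norm_exp" for X x
  proof (cases "X \<in> L \<and> x \<in> K")
    case True
    then have X: "X \<in> L" "x \<in> K" by auto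
    have 1: "(A + X) ^ norm_exp = a * x \<longleftrightarrow> x = K.inv_in a * (A + X) ^ norm_exp"
      using K.mult_eq_iff_inv[OF A(2,3) X(2) N[OF A(1) X(1)]] by auto
    have 2: "x \<noteq> 0 \<longleftrightarrow> A + X \<noteq> 0" if "(A + X) ^ norm_exp = a * x"
      using that norm_eq_0[of "A + X"] K.mult_eq_0[OF A(2) X(2)] A X L.add_mem by auto
    have 3: "(B + X) ^ norm_exp = b * x \<longleftrightarrow> (B + X) ^ norm_exp * a = b * (A + X) ^ norm_exp"
      if "(A + X) ^ norm_exp = a * x" "(B, b) \<in> D" for B b
    proof -
      have B: "B \<in> L" "b \<in> K" using that(2) assms(2) by (auto simp: vertices_def)
      have "b * (A + X) ^ norm_exp = a * (b * x)" unfolding that(1) by (simp only: mult_ac)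
      then show ?thesis using K.mult_left_cancel[OF A(2,3) N[OF B(1) X(1)] K.mult_mem[OF B(2) X(2)]]
        by (simp add: mult.commute)
    qed
    have "(X, x) \<in> common_nbrs (insert (A, a) D) \<longleftrightarrow>
        (A + X) ^ norm_exp = a * x \<and> x \<noteq> 0 \<and> (\<forall>(B, b)\<in>D. (B + X) ^ norm_exp = b * x)"
      using X by (auto simp: common_nbrs_def)
    also have "\<dots> \<longleftrightarrow> (A + X) ^ norm_exp = a * x \<and> A + X \<noteq> 0 \<and>
        (\<forall>(B, b)\<in>D. (B + X) ^ norm_exp * a = b * (A + X) ^ norm_exp)"
      using 2 3 by blast
    also have "\<dots> \<longleftrightarrow> X \<in> ?S \<and> x = K.inv_in a * (A + X) ^ norm_exp" using 1 X(1) by blast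
    finally show ?thesis .
  next
    case False
    have "X \<in> L \<Longrightarrow> K.inv_in a * (A + X) ^ norm_exp \<in> K"
      using K.mult_mem K.inv_in[OF A(2,3)] N A by auto
    then show ?thesis using False by (auto simp: common_nbrs_def)
  qed
  show "\<forall>y\<in>common_nbrs (insert (A, a) D). ?G (?F y) = y"
  proof
    fix y assume "y \<in> common_nbrs (insert (A, a) D)"
    then show "?G (?F y) = y" using main[of "fst y" "snd y"] by (simp add: prod_eq_iff)
  qed
  show "\<forall>X\<in>?S. ?F (?G X) = X" by simp
  show "?F ` common_nbrs (insert (A, a) D) \<subseteq> ?S"
  proof
    fix X assume "X \<in> ?F ` common_nbrs (insert (A, a) D)"
    then obtain y where "y \<in> common_nbrs (insert (A, a) D)" "X = fst y" by blast
    then show "X \<in> ?S" using main[of "fst y" "snd y"] by simp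
  qed
  show "?G ` ?S \<subseteq> common_nbrs (insert (A, a) D)" using main by blast
qed

lemma card_common_nbrs_1:
  assumes "(A, a) \<in> vertices" shows "card (common_nbrs {(A, a)}) = card K ^ n - 1"
proof -
  have A: "A \<in> L" using assms by (auto simp: vertices_def)
  have "{X \<in> L. A + X \<noteq> 0} = L - {- A}" by (auto simp: add_eq_0_iff)
  then show ?thesis using card_common_nbrs_insert[OF assms, of "{}"] A L.uminus_mem L.fin card_L by simp
qed

text \<open>
  The substitution \<open>Y = (A + X)\<^sup>-\<^sup>1\<close> turns \<open>N(B + X) a = b N(A + X)\<close> into \<open>N(1 + (B - A) Y) a = b\<close>.
\<close>

lemma card_common_nbrs_inverse:
  assumes "(A, a) \<in> vertices" "D \<subseteq> vertices"
  shows "card (common_nbrs (insert (A, a) D))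
    = card {Y \<in> L. Y \<noteq> 0 \<and> (\<forall>(B, b)\<in>D. (e + (B - A) * Y) ^ norm_exp * a = b)}"
  unfolding card_common_nbrs_insert[OF assms]
proof (rule bij_betw_same_card[OF bij_betw_byWitness[where f = "\<lambda>X. L.inv_in (A + X)" and f' = "\<lambda>Y. L.inv_in Y - A"]])
  let ?S = "{X \<in> L. A + X \<noteq> 0 \<and> (\<forall>(B, b)\<in>D. (B + X) ^ norm_exp * a = b * (A + X) ^ norm_exp)}"
  let ?T = "{Y \<in> L. Y \<noteq> 0 \<and> (\<forall>(B, b)\<in>D. (e + (B - A) * Y) ^ norm_exp * a = b)}"
  let ?F = "\<lambda>X. L.inv_in (A + X)" and ?G = "\<lambda>Y. L.inv_in Y - A"
  have A: "A \<in> L" "a \<in> K" "a \<noteq> 0" using assms by (auto simp: vertices_def)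
  have key: "(\<forall>(B, b)\<in>D. (B + X) ^ norm_exp * a = b * (A + X) ^ norm_exp)
      \<longleftrightarrow> (\<forall>(B, b)\<in>D. (e + (B - A) * Y) ^ norm_exp * a = b)"
    if X: "X \<in> L" "A + X \<noteq> 0" and Y: "Y \<in> L" "(A + X) * Y = e" for X Y
  proof -
    have AX: "A + X \<in> L" using A X L.add_mem by auto
    have "(B + X) ^ norm_exp * a = b * (A + X) ^ norm_exp \<longleftrightarrow> (e + (B - A) * Y) ^ norm_exp * a = b"
      if "(B, b) \<in> D" for B b
    proof -
      have B: "B \<in> L" "b \<in> K" using that assms(2) by (auto simp: vertices_def)
      have Z: "e + (B - A) * Y \<in> L" using B A Y by (intro L.add_mem L.mult_mem L.diff_mem L.e_mem)
      have "B + X = (A + X) + (B - A)" by simp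
      also have "\<dots> = (A + X) * e + (B - A) * e" using L.mult_e[OF AX] L.mult_e[OF L.diff_mem[OF B(1) A(1)]] by simp
      also have "\<dots> = (A + X) * e + (B - A) * ((A + X) * Y)" unfolding Y(2) ..
      also have "\<dots> = (A + X) * (e + (B - A) * Y)" by (simp add: algebra_simps)
      finally have BX: "B + X = (A + X) * (e + (B - A) * Y)" .
      have "(B + X) ^ norm_exp * a = (A + X) ^ norm_exp * ((e + (B - A) * Y) ^ norm_exp * a)"
        unfolding BX by (simp add: power_mult_distrib mult.assoc)
      moreover have "b * (A + X) ^ norm_exp = (A + X) ^ norm_exp * b" by (rule mult.commute)
      moreover have "(A + X) ^ norm_exp \<in> K" "(A + X) ^ norm_exp \<noteq> 0" "(e + (B - A) * Y) ^ norm_exp * a \<in> K"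
        using norm_mem_K AX norm_eq_0 X Z A K.mult_mem by auto
      ultimately show ?thesis using K.mult_left_cancel[of "(A + X) ^ norm_exp" "(e + (B - A) * Y) ^ norm_exp * a" b] B
        by (simp only: simp_thms)
    qed
    then show ?thesis by (intro ball_cong) auto
  qed
  have inv_inv: "L.inv_in (L.inv_in Y) = Y" if "Y \<in> L" "Y \<noteq> 0" for Y
  proof -
    note i = L.inv_in[OF that]
    have "Y = L.inv_in (L.inv_in Y) * e" using L.mult_eq_iff_inv[OF i(1,4) that(1) L.e_mem] i(3) by simp
    then show ?thesis using L.mult_e[OF L.inv_in(1)[OF i(1,4)]] by simp
  qed
  show "\<forall>X\<in>?S. ?G (?F X) = X" using inv_inv A L.add_mem by auto
  show "\<forall>Y\<in>?T. ?F (?G Y) = Y" using inv_inv by auto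
  show "?F ` ?S \<subseteq> ?T"
  proof
    fix Y assume "Y \<in> ?F ` ?S"
    then obtain X where X: "X \<in> ?S" "Y = L.inv_in (A + X)" by blast
    then have AX: "A + X \<in> L" "A + X \<noteq> 0" "X \<in> L" using A L.add_mem by auto
    show "Y \<in> ?T" using L.inv_in[OF AX(1,2)] key[OF AX(3,2), of Y] X by simp
  qed
  show "?G ` ?T \<subseteq> ?S"
  proof
    fix X assume "X \<in> ?G ` ?T"
    then obtain Y where Y: "Y \<in> ?T" "X = L.inv_in Y - A" by blast
    then have YL: "Y \<in> L" "Y \<noteq> 0" by auto
    note i = L.inv_in[OF YL]
    have X: "X \<in> L" "A + X \<noteq> 0" "(A + X) * Y = e" using Y i A L.diff_mem by auto
    show "X \<in> ?S" using key[OF X(1,2) YL(1) X(3)] X Y by simp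
  qed
qed

text \<open>The affine map sending Y to Z = e + (B - A) Y identifies the solutions with a norm
  fibre, apart from the point Z = e, which corresponds to the excluded Y = 0.\<close>

lemma card_common_nbrs_2:
  assumes v: "(A, a) \<in> vertices" "(B, b) \<in> vertices" "A \<noteq> B"
  shows "card (common_nbrs {(A, a), (B, b)}) \<le> norm_exp" "norm_exp \<le> card (common_nbrs {(A, a), (B, b)}) + 1"
proof -
  have A: "A \<in> L" "a \<in> K" "a \<noteq> 0" "B \<in> L" "b \<in> K" "b \<noteq> 0" using v by (auto simp: vertices_def)
  define E where "E = B - A"
  have E: "E \<in> L" "E \<noteq> 0" unfolding E_def using v(3) A L.diff_mem by auto
  define c where "c = K.inv_in a * b"
  have c: "c \<in> K" "c \<noteq> 0" unfolding c_def using K.inv_in[OF A(2,3)] A K.mult_mem K.mult_eq_0 by auto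
  let ?T = "{Y \<in> L. Y \<noteq> 0 \<and> (e + E * Y) ^ norm_exp * a = b}"
  have iff: "(e + E * Y) ^ norm_exp * a = b \<longleftrightarrow> (e + E * Y) ^ norm_exp = c" if "Y \<in> L" for Y
  proof -
    have "(e + E * Y) ^ norm_exp \<in> K" using that E norm_mem_K L.add_mem L.e_mem L.mult_mem by auto
    from K.mult_eq_iff_inv[OF A(2,3) this A(5)] show ?thesis unfolding c_def by (simp add: mult.commute)
  qed
  have T: "card (common_nbrs {(A, a), (B, b)}) = card ?T"
    using card_common_nbrs_inverse[OF v(1), of "{(B, b)}"] v(2) by (simp add: E_def)
  let ?U = "{Z \<in> L. Z ^ norm_exp = c}"
  have U: "card ?U = norm_exp" using card_norm_fibre[OF c] .
  have inj: "inj_on (\<lambda>Y. e + E * Y) L" using L.mult_left_cancel[OF E] by (auto simp: inj_on_def)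
  have "card ?T \<le> card ?U"
    by (rule card_inj_on_le[where f = "\<lambda>Y. e + E * Y"])
       (use inj iff L.fin L.add_mem L.e_mem L.mult_mem E in \<open>auto intro: inj_on_subset\<close>)
  then show "card (common_nbrs {(A, a), (B, b)}) \<le> norm_exp" using T U by simp
  have "?U \<subseteq> insert e ((\<lambda>Y. e + E * Y) ` ?T)"
  proof
    fix Z assume Z: "Z \<in> ?U"
    show "Z \<in> insert e ((\<lambda>Y. e + E * Y) ` ?T)"
    proof (cases "Z = e")
      case False
      define Y where "Y = L.inv_in E * (Z - e)"
      have ZE: "Z - e \<in> L" using Z L.diff_mem L.e_mem by auto
      have Y: "Y \<in> L" unfolding Y_def using L.inv_in[OF E] ZE L.mult_mem by auto
      have EY: "E * Y = Z - e" using L.mult_eq_iff_inv[OF E Y ZE] Y_def by simp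
      then have "Y \<noteq> 0" using False by auto
      then have "Y \<in> ?T" using iff[OF Y] Y Z EY by simp
      moreover have "Z = e + E * Y" using EY by simp
      ultimately show ?thesis by blast
    qed simp
  qed
  then have "card ?U \<le> card (insert e ((\<lambda>Y. e + E * Y) ` ?T))"
    using L.fin by (intro card_mono) auto
  also have "\<dots> \<le> Suc (card ((\<lambda>Y. e + E * Y) ` ?T))" by (rule card_insert_le_m1) auto
  also have "\<dots> \<le> Suc (card ?T)" using L.fin by (intro Suc_leI le_imp_less_Suc card_image_le) auto
  finally show "norm_exp \<le> card (common_nbrs {(A, a), (B, b)}) + 1" using T U by simp
qed

text \<open>
  With \<open>1 + B Y = B (Y + 1/B)\<close> and \<open>Y + 1/B = D W\<close> for \<open>D = 1/C - 1/B\<close>, so that \<open>Y + 1/C = D (W + 1)\<close>, the two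
  norm equations become \<open>N(W) = c\<close>, \<open>N(W + 1) = d\<close>.
\<close>

lemma card_common_nbrs_3:
  assumes v: "(A, a) \<in> vertices" "(A1, b1) \<in> vertices" "(A2, b2) \<in> vertices" "A \<noteq> A1" "A \<noteq> A2" "A1 \<noteq> A2"
  obtains c d where "c \<in> K" "d \<in> K" "c \<noteq> 0" "d \<noteq> 0"
    "card (common_nbrs {(A, a), (A1, b1), (A2, b2)}) \<le> card (norm_set c d)"
    "card (norm_set c d) \<le> card (common_nbrs {(A, a), (A1, b1), (A2, b2)}) + 1"
proof -
  have A: "A \<in> L" "a \<in> K" "a \<noteq> 0" "A1 \<in> L" "b1 \<in> K" "b1 \<noteq> 0" "A2 \<in> L" "b2 \<in> K" "b2 \<noteq> 0"
    using v by (auto simp: vertices_def)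
  define B C where "B = A1 - A" and "C = A2 - A"
  have B: "B \<in> L" "B \<noteq> 0" unfolding B_def using v A L.diff_mem by auto
  have C: "C \<in> L" "C \<noteq> 0" unfolding C_def using v A L.diff_mem by auto
  have BC: "B \<noteq> C" unfolding B_def C_def using v by auto
  define B' C' where "B' = L.inv_in B" and "C' = L.inv_in C"
  have B': "B' \<in> L" "B * B' = e" using L.inv_in[OF B] by (auto simp: B'_def)
  have C': "C' \<in> L" "C * C' = e" using L.inv_in[OF C] by (auto simp: C'_def)
  define D where "D = C' - B'"
  have D: "D \<in> L" "D \<noteq> 0"
  proof -
    show "D \<in> L" unfolding D_def using B' C' L.diff_mem by auto
    show "D \<noteq> 0"
    proof
      assume "D = 0"
      then have "B * B' = C * B'" using B' C' by (simp add: D_def)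
      then have "B' * B = B' * C" by (simp add: mult.commute)
      moreover have "B' \<noteq> 0" using B'(2) L.e_neq_0 by auto
      ultimately show False using L.mult_left_cancel B'(1) B C BC by blast
    qed
  qed
  let ?N = "\<lambda>x. x ^ norm_exp"
  define g h where "g = ?N B * ?N D * a" and "h = ?N C * ?N D * a"
  have gh: "g \<in> K" "g \<noteq> 0" "h \<in> K" "h \<noteq> 0"
    unfolding g_def h_def using A B C D norm_mem_K norm_eq_0 K.mult_mem K.mult_eq_0 by auto
  define c d where "c = K.inv_in g * b1" and "d = K.inv_in h * b2"
  have cd: "c \<in> K" "c \<noteq> 0" "d \<in> K" "d \<noteq> 0"
    unfolding c_def d_def using K.inv_in[OF gh(1,2)] K.inv_in[OF gh(3,4)] A K.mult_mem K.mult_eq_0 by auto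
  let ?f = "\<lambda>W. D * W - B'"
  have f: "?f W \<in> L" if "W \<in> L" for W using that D B' L.mult_mem L.diff_mem by auto
  have f_iff: "(?N (e + B * ?f W) * a = b1 \<and> ?N (e + C * ?f W) * a = b2) \<longleftrightarrow> W \<in> norm_set c d" if W: "W \<in> L" for W
  proof -
    have 1: "e + B * ?f W = B * D * W"
    proof -
      have "e + B * ?f W = e - B * B' + B * D * W" by (simp add: algebra_simps)
      then show ?thesis using B' by simp
    qed
    have 2: "e + C * ?f W = C * D * (W + e)"
    proof -
      have "C * D * (W + e) = C * D * W + C * (D * e)" by (simp add: algebra_simps)
      also have "D * e = C' - B'" using L.mult_e[OF D(1)] by (simp add: D_def)
      also have "C * D * W + C * (C' - B') = C * C' + C * ?f W" by (simp add: algebra_simps)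
      finally show ?thesis using C' by simp
    qed
    have N1: "?N (e + B * ?f W) * a = g * ?N W" unfolding 1 g_def by (simp add: power_mult_distrib mult_ac)
    have N2: "?N (e + C * ?f W) * a = h * ?N (W + e)" unfolding 2 h_def by (simp add: power_mult_distrib mult_ac)
    have "?N W \<in> K" "?N (W + e) \<in> K" using norm_mem_K W plus_e_mem by auto
    then show ?thesis
      unfolding N1 N2 using K.mult_eq_iff_inv[OF gh(1,2) _ A(5)] K.mult_eq_iff_inv[OF gh(3,4) _ A(8)] W
      by (auto simp: norm_set_def c_def d_def)
  qed
  let ?T = "{Y \<in> L. Y \<noteq> 0 \<and> ?N (e + B * Y) * a = b1 \<and> ?N (e + C * Y) * a = b2}"
  have T: "card (common_nbrs {(A, a), (A1, b1), (A2, b2)}) = card ?T"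
    using card_common_nbrs_inverse[OF v(1), of "{(A1, b1), (A2, b2)}"] v(2,3) by (simp add: B_def C_def)
  have inj: "inj_on ?f L" using L.mult_left_cancel[OF D] by (auto simp: inj_on_def)
  have finT: "finite ?T" using L.fin by simp
  have "?T \<subseteq> ?f ` norm_set c d"
  proof
    fix Y assume Y: "Y \<in> ?T"
    define W where "W = L.inv_in D * (Y + B')"
    have YB: "Y + B' \<in> L" using Y B' L.add_mem by auto
    have W: "W \<in> L" unfolding W_def using L.inv_in[OF D] YB L.mult_mem by auto
    have "D * W = Y + B'" using L.mult_eq_iff_inv[OF D W YB] W_def by simp
    then have "Y = ?f W" by simp
    moreover then have "W \<in> norm_set c d" using f_iff[OF W] Y by simp
    ultimately show "Y \<in> ?f ` norm_set c d" by blast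
  qed
  then have "card ?T \<le> card (?f ` norm_set c d)" using finite_norm_set by (intro card_mono) auto
  also have "\<dots> \<le> card (norm_set c d)" using finite_norm_set by (rule card_image_le)
  finally have le1: "card ?T \<le> card (norm_set c d)" .
  have sub: "norm_set c d \<subseteq> L" by (auto simp: norm_set_def)
  have "?f ` norm_set c d \<subseteq> insert 0 ?T"
    using f f_iff sub by blast
  then have "card (?f ` norm_set c d) \<le> card (insert 0 ?T)" using finT by (intro card_mono) auto
  also have "\<dots> \<le> Suc (card ?T)" by (rule card_insert_le_m1) auto
  also have "card (?f ` norm_set c d) = card (norm_set c d)"
    using inj sub by (intro card_image) (rule inj_on_subset)
  finally have le2: "card (norm_set c d) \<le> card ?T + 1" by simp
  show thesis using that cd le1 le2 T by simp
qed


section \<open>Uniform estimates for sets of at most three vertices\<close>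

lemma card_le_3_cases:
  assumes "finite D" "card D \<le> 3"
  obtains "D = {}" | x where "D = {x}" | x y where "D = {x, y}" "x \<noteq> y"
    | x y z where "D = {x, y, z}" "x \<noteq> y" "x \<noteq> z" "y \<noteq> z"
proof -
  consider "card D = 0" | "card D = 1" | "card D = 2" | "card D = 3" using assms(2) by linarith
  then show thesis
  proof cases
    case 1
    then show ?thesis using assms(1) that(1) by simp
  next
    case 2
    then show ?thesis using that(2) by (auto simp: card_1_singleton_iff)
  next
    case 3
    then show ?thesis using that(3) by (auto simp: card_2_iff)
  next
    case 4
    then show ?thesis using that(4) by (auto simp: card_3_iff)
  qed
qed

lemma norm_exp_bounds:
  assumes "n \<ge> 2"
  shows "real (card K) ^ (n - 1) \<le> real norm_exp" "real norm_exp \<le> real (card K) ^ (n - 1) + 2 * real (card K) ^ (n - 2)"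
proof -
  define q where "q = real (card K)"
  have q3: "q \<ge> 3" unfolding q_def using card_K_ge_3 by simp
  obtain j where j: "n = Suc (Suc j)" using assms by (metis Suc_le_D numeral_2_eq_2 Suc_le_mono)
  have split: "real norm_exp = (\<Sum>i<Suc j. q ^ i) + q ^ Suc j"
    unfolding norm_exp_def by (simp add: j q_def)
  have "(\<Sum>i<Suc j. q ^ i) \<ge> 0" using q3 by (intro sum_nonneg) auto
  then show "real (card K) ^ (n - 1) \<le> real norm_exp" unfolding split using j by (simp add: q_def)
  have "(\<Sum>i<m. q ^ i) * 2 \<le> q ^ m" for m
  proof (induction m)
    case (Suc m)
    have "3 * q ^ m \<le> q * q ^ m" using q3 by (intro mult_right_mono) auto
    then show ?case using Suc by simp
  qed simp
  moreover have "0 \<le> q ^ j" using q3 by simp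
  ultimately have "(\<Sum>i<j. q ^ i) \<le> q ^ j" by (smt (verit))
  then have "(\<Sum>i<Suc j. q ^ i) \<le> 2 * q ^ j" by simp
  then show "real norm_exp \<le> real (card K) ^ (n - 1) + 2 * real (card K) ^ (n - 2)"
    unfolding split using j by (simp add: q_def)
qed

text \<open>
  Here \<open>n + 1\<close> is the parameter \<open>t\<close> of the projective norm graph, so that \<open>q ^ (n + 1 - card D)\<close> is the
  expected number of common neighbours.
\<close>

lemma common_nbrs_deviation:
  assumes D: "D \<subseteq> vertices" "inj_on fst D" "card D \<le> 3" and n: "n \<ge> 2" "card D = 3 \<longrightarrow> n \<ge> 4"
  shows "\<bar>real (card (common_nbrs D)) - real (card K) ^ (n + 1 - card D)\<bar> * sqrt (real (card K))
     \<le> 64 * real (card K) ^ (n + 1 - card D)"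
proof -
  define q s where "q = real (card K)" and "s = sqrt q"
  have q3: "q \<ge> 3" unfolding q_def using card_K_ge_3 by simp
  have s: "s * s = q" "s \<ge> 1" "s \<le> q"
  proof -
    show "s * s = q" "s \<ge> 1" unfolding s_def using q3 by simp_all
    then show "s \<le> q" using mult_left_mono[of 1 s s] by simp
  qed
  have step: "x * s \<le> x * q" if "x \<ge> 0" for x using s that by (intro mult_left_mono) auto
  have finD: "finite D" using D(1) finite_vertices finite_subset by blast
  have qpos: "q ^ m \<ge> 1" for m using q3 by simp
  obtain j where j: "n = Suc (Suc j)" using n(1) by (metis Suc_le_D numeral_2_eq_2 Suc_le_mono)
  show ?thesis
    unfolding q_def[symmetric] s_def[symmetric]
  proof (rule card_le_3_cases[OF finD D(3)])
    assume "D = {}"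
    moreover have "real (card (common_nbrs {})) = q ^ n * (q - 1)"
      unfolding card_common_nbrs_0 q_def using K.card_gt_1 by (simp add: of_nat_diff)
    ultimately have "real (card (common_nbrs D)) - q ^ (n + 1 - card D) = - (q ^ n)" by (simp add: algebra_simps)
    then have "\<bar>real (card (common_nbrs D)) - q ^ (n + 1 - card D)\<bar> = q ^ n" using q3 by simp
    moreover have "q ^ n * s \<le> q ^ n * q" using step qpos[of n] by simp
    moreover have "0 \<le> q ^ n * q" using q3 by simp
    ultimately show "\<bar>real (card (common_nbrs D)) - q ^ (n + 1 - card D)\<bar> * s \<le> 64 * q ^ (n + 1 - card D)"
      using \<open>D = {}\<close> by (simp add: mult.commute)
  next
    fix x assume Dx: "D = {x}"
    then have "card (common_nbrs D) = card K ^ n - 1" using card_common_nbrs_1[of "fst x" "snd x"] D by simp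
    moreover have "card K ^ n \<ge> 1" using K.card_gt_1 by simp
    ultimately have "real (card (common_nbrs D)) = q ^ n - 1" unfolding q_def by (simp add: of_nat_diff)
    then have "\<bar>real (card (common_nbrs D)) - q ^ (n + 1 - card D)\<bar> = 1" using Dx by simp
    moreover have "q \<le> q ^ n" using q3 n power_increasing[of 1 n q] by simp
    ultimately show "\<bar>real (card (common_nbrs D)) - q ^ (n + 1 - card D)\<bar> * s \<le> 64 * q ^ (n + 1 - card D)"
      using s Dx by simp
  next
    fix x y assume Dxy: "D = {x, y}" "x \<noteq> y"
    then have "fst x \<noteq> fst y" using D(2) by (auto simp: inj_on_def)
    then have "card (common_nbrs D) \<le> norm_exp" "norm_exp \<le> card (common_nbrs D) + 1"
      using card_common_nbrs_2[of "fst x" "snd x" "fst y" "snd y"] D(1) Dxy by simp_all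
    then have "\<bar>real (card (common_nbrs D)) - q ^ (n - 1)\<bar> \<le> 2 * q ^ (n - 2)"
      using norm_exp_bounds[OF n(1)] qpos[of "n - 2"] unfolding q_def[symmetric] by linarith
    then have "\<bar>real (card (common_nbrs D)) - q ^ (n - 1)\<bar> * s \<le> 2 * q ^ (n - 2) * s"
      using s by (intro mult_right_mono) auto
    also have "\<dots> \<le> 2 * q ^ (n - 2) * q" using step q3 by simp
    also have "\<dots> = 2 * q ^ (n - 1)" using j by simp
    finally have "\<bar>real (card (common_nbrs D)) - q ^ (n - 1)\<bar> * s \<le> 64 * q ^ (n - 1)" using qpos[of "n - 1"] by linarith
    then show "\<bar>real (card (common_nbrs D)) - q ^ (n + 1 - card D)\<bar> * s \<le> 64 * q ^ (n + 1 - card D)"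
      using Dxy j by simp
  next
    fix x y z assume Dxyz: "D = {x, y, z}" "x \<noteq> y" "x \<noteq> z" "y \<noteq> z"
    then have card: "card D = 3" by simp
    have "fst x \<noteq> fst y" "fst x \<noteq> fst z" "fst y \<noteq> fst z" using D(2) Dxyz by (auto simp: inj_on_def)
    then obtain c d where cd: "c \<in> K" "d \<in> K" "c \<noteq> 0" "d \<noteq> 0"
      "card (common_nbrs D) \<le> card (norm_set c d)" "card (norm_set c d) \<le> card (common_nbrs D) + 1"
      using card_common_nbrs_3[of "fst x" "snd x" "fst y" "snd y" "fst z" "snd z"] D(1) Dxyz(1) by auto
    have n4: "n \<ge> 4" using n(2) card by simp
    have "\<bar>real (card (common_nbrs D)) - q ^ (n - 2)\<bar> \<le> \<bar>real (card (norm_set c d)) - q ^ (n - 2)\<bar> + 1"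
      using cd(5,6) by linarith
    then have "\<bar>real (card (common_nbrs D)) - q ^ (n - 2)\<bar> * s \<le> (\<bar>real (card (norm_set c d)) - q ^ (n - 2)\<bar> + 1) * s"
      using s by (intro mult_right_mono) auto
    also have "\<dots> = \<bar>real (card (norm_set c d)) - q ^ (n - 2)\<bar> * s + s" by (simp add: algebra_simps)
    also have "\<dots> \<le> 63 * q ^ (n - 2) + q ^ (n - 2)"
    proof (rule add_mono)
      show "\<bar>real (card (norm_set c d)) - q ^ (n - 2)\<bar> * s \<le> 63 * q ^ (n - 2)"
        using card_norm_set_ge_4[OF cd(1-4) n4] by (simp add: q_def s_def)
      have "q \<le> q ^ (n - 2)" using q3 n4 power_increasing[of 1 "n - 2" q] by simp
      then show "s \<le> q ^ (n - 2)" using s by linarith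
    qed
    finally have "\<bar>real (card (common_nbrs D)) - q ^ (n - 2)\<bar> * s \<le> 64 * q ^ (n - 2)" by simp
    moreover have "n + 1 - card D = n - 2" using card by simp
    ultimately show "\<bar>real (card (common_nbrs D)) - q ^ (n + 1 - card D)\<bar> * s \<le> 64 * q ^ (n + 1 - card D)"
      by simp
  qed
qed

text \<open>Both bounds come from \<open>card_norm_set_3\<close>; 43 is 42 for the estimate of T_3
  and 1 for the excluded value Y = 0.\<close>

lemma common_nbrs_bounds_3:
  assumes D: "D \<subseteq> vertices" "inj_on fst D" "card D = 3" and n: "n = 3"
  shows "real (card (common_nbrs D)) \<le> 3 * real (card K)"
    and "real (card K) - 43 * sqrt (real (card K)) \<le> real (card (common_nbrs D))"
proof -
  obtain x y z where Dxyz: "D = {x, y, z}" "x \<noteq> y" "x \<noteq> z" "y \<noteq> z" using D(3) unfolding card_3_iff by blast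
  have "fst x \<noteq> fst y" "fst x \<noteq> fst z" "fst y \<noteq> fst z" using D(2) Dxyz by (auto simp: inj_on_def)
  then obtain c d where cd: "c \<in> K" "d \<in> K" "c \<noteq> 0" "d \<noteq> 0"
    "card (common_nbrs D) \<le> card (norm_set c d)" "card (norm_set c d) \<le> card (common_nbrs D) + 1"
    using card_common_nbrs_3[of "fst x" "snd x" "fst y" "snd y" "fst z" "snd z"] D(1) Dxyz(1) by auto
  have s: "sqrt (real (card K)) \<ge> 1" using K.card_gt_1 by simp
  show "real (card (common_nbrs D)) \<le> 3 * real (card K)" using card_norm_set_3(1)[OF n cd(1-4)] cd(5) by linarith
  show "real (card K) - 43 * sqrt (real (card K)) \<le> real (card (common_nbrs D))"
    using card_norm_set_3(2)[OF n cd(1-4)] K.card_split3_ge[OF cd(1-4)] cd(6) s by linarith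
qed

text \<open>Sets with a repeated first coordinate are included, because they have no common
  neighbours.\<close>

lemma card_common_nbrs_upper:
  assumes D: "D \<subseteq> vertices" "card D \<le> 3" and n: "n \<ge> 2" "card D = 3 \<longrightarrow> n \<ge> 3"
  shows "real (card (common_nbrs D)) \<le> 65 * real (card K) ^ (n + 1 - card D)"
    and "(card D = 3 \<longrightarrow> n \<ge> 4) \<Longrightarrow>
      real (card (common_nbrs D)) \<le> (1 + 64 / sqrt (real (card K))) * real (card K) ^ (n + 1 - card D)"
proof -
  let ?Q = "real (card K) ^ (n + 1 - card D)" and ?s = "sqrt (real (card K))"
  have s: "?s \<ge> 1" using K.card_gt_1 by simp
  show up: "real (card (common_nbrs D)) \<le> (1 + 64 / ?s) * ?Q" if "card D = 3 \<longrightarrow> n \<ge> 4"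
  proof (cases "inj_on fst D")
    case True
    have "\<bar>real (card (common_nbrs D)) - ?Q\<bar> \<le> 64 * ?Q / ?s"
      using common_nbrs_deviation[OF D(1) True D(2) n(1) that] s by (simp add: pos_le_divide_eq)
    then show ?thesis by (simp add: algebra_simps)
  next
    case False
    then have "common_nbrs D = {}" using common_nbrs_fst_inj D by blast
    then show ?thesis by simp
  qed
  show "real (card (common_nbrs D)) \<le> 65 * ?Q"
  proof (cases "card D = 3 \<longrightarrow> n \<ge> 4")
    case True
    have "64 / ?s \<le> 64" using s by (simp add: divide_le_eq)
    then have "(1 + 64 / ?s) * ?Q \<le> 65 * ?Q" by (intro mult_right_mono) auto
    then show ?thesis using up[OF True] by linarith
  next
    case False
    then have c: "card D = 3" "n = 3" using n by auto
    show ?thesis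
    proof (cases "inj_on fst D")
      case True
      then show ?thesis using common_nbrs_bounds_3(1)[OF D(1) True c] c by simp
    next
      case False
      then have "common_nbrs D = {}" using common_nbrs_fst_inj D by blast
      then show ?thesis by simp
    qed
  qed
qed

text \<open>\<open>B\<close> will be the set of first coordinates already used by a partial
  embedding. For nonempty \<open>D\<close> each of them excludes at most one common neighbour; for
  empty \<open>D\<close> it excludes fewer than q, which is still negligible against q^(n+1). Being
  one-sided, the bound covers n = 3 with three vertices as well.\<close>

lemma card_common_nbrs_lower:
  assumes D: "D \<subseteq> vertices" "inj_on fst D" "card D \<le> 3" and n: "n \<ge> 2" "card D = 3 \<longrightarrow> n \<ge> 3" and B: "finite B"
  shows "(1 - (64 + real (card B)) / sqrt (real (card K))) * real (card K) ^ (n + 1 - card D)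
    \<le> real (card {y \<in> common_nbrs D. fst y \<notin> B})"
proof -
  define q s Q where "q = real (card K)" and "s = sqrt q" and "Q = q ^ (n + 1 - card D)"
  have q3: "q \<ge> 3" unfolding q_def using card_K_ge_3 by simp
  have s: "s * s = q" "s \<ge> 1" "s \<le> q"
  proof -
    show "s * s = q" "s \<ge> 1" unfolding s_def using q3 by simp_all
    then show "s \<le> q" using mult_left_mono[of 1 s s] by simp
  qed
  have Q: "q \<le> Q" unfolding Q_def using q3 power_increasing[of 1 "n + 1 - card D" q] n D(3) by auto
  have 1: "(Q - real (card (common_nbrs D))) * s \<le> 64 * Q"
  proof (cases "card D = 3 \<longrightarrow> n \<ge> 4")
    case True
    have "(Q - real (card (common_nbrs D))) * s \<le> \<bar>real (card (common_nbrs D)) - Q\<bar> * s"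
      using s by (intro mult_right_mono) auto
    then show ?thesis
      using common_nbrs_deviation[OF D n(1) True] unfolding q_def[symmetric] s_def[symmetric] Q_def[symmetric] by linarith
  next
    case False
    then have c: "card D = 3" "n = 3" using n by auto
    then have "Q = q" by (simp add: Q_def)
    then have "(Q - real (card (common_nbrs D))) * s \<le> (43 * s) * s"
      using common_nbrs_bounds_3(2)[OF D(1,2) c] s unfolding q_def[symmetric] s_def[symmetric]
      by (intro mult_right_mono) auto
    also have "\<dots> = 43 * q" using s(1) by (simp add: mult.assoc)
    also have "\<dots> \<le> 64 * Q" using Q q3 by simp
    finally show ?thesis .
  qed
  have 2: "real (card {y \<in> common_nbrs D. fst y \<in> B}) * s \<le> real (card B) * Q"
  proof (cases "D = {}")
    case True
    have "{y \<in> common_nbrs D. fst y \<in> B} \<subseteq> B \<times> (K - {0})" by (auto simp: common_nbrs_def)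
    then have "card {y \<in> common_nbrs D. fst y \<in> B} \<le> card (B \<times> (K - {0}))"
      using B K.fin by (intro card_mono) auto
    also have "\<dots> \<le> card B * card K" using K.fin by (simp add: card_cartesian_product card_mono)
    finally have "real (card {y \<in> common_nbrs D. fst y \<in> B}) \<le> real (card B) * q"
      unfolding q_def by (metis of_nat_le_iff of_nat_mult)
    then have "real (card {y \<in> common_nbrs D. fst y \<in> B}) * s \<le> (real (card B) * q) * q"
      using s q3 by (intro mult_mono) auto
    also have "\<dots> = real (card B) * q ^ 2" by (simp add: power2_eq_square)
    also have "\<dots> \<le> real (card B) * Q"
      unfolding Q_def using q3 n True by (intro mult_left_mono power_increasing) auto
    finally show ?thesis .
  next
    case False
    have "real (card {y \<in> common_nbrs D. fst y \<in> B}) * s \<le> real (card B) * s"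
      using card_common_nbrs_colour[OF D(1) False B] s by (intro mult_right_mono) auto
    also have "\<dots> \<le> real (card B) * Q" using s Q by (intro mult_left_mono) auto
    finally show ?thesis .
  qed
  have "card (common_nbrs D) = card ({y \<in> common_nbrs D. fst y \<notin> B} \<union> {y \<in> common_nbrs D. fst y \<in> B})"
    by (rule arg_cong[of _ _ card]) auto
  also have "\<dots> \<le> card {y \<in> common_nbrs D. fst y \<notin> B} + card {y \<in> common_nbrs D. fst y \<in> B}" by (rule card_Un_le)
  finally have "(real (card (common_nbrs D)) - real (card {y \<in> common_nbrs D. fst y \<in> B})) * s
      \<le> real (card {y \<in> common_nbrs D. fst y \<notin> B}) * s"
    using s by (intro mult_right_mono) linarith+
  then have "Q * s - (64 + real (card B)) * Q \<le> real (card {y \<in> common_nbrs D. fst y \<notin> B}) * s"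
    using 1 2 by (simp add: algebra_simps)
  moreover have "Q * s - (64 + real (card B)) * Q = ((1 - (64 + real (card B)) / s) * Q) * s"
    using s(2) by (simp add: field_simps)
  ultimately have "((1 - (64 + real (card B)) / s) * Q) * s \<le> real (card {y \<in> common_nbrs D. fst y \<notin> B}) * s" by simp
  then show ?thesis using s(2) unfolding Q_def s_def q_def by simp
qed

end

section \<open>Embedding record-based fields\<close>

text \<open>
  The product of all commutative rings carried by subsets of \<open>'a\<close>, together with \<open>\<int>\<close> to ensure
  \<open>0 \<noteq> 1\<close>. Every field on \<open>'a\<close> embeds in it as a factor, so that polynomials over record-based
  fields can be replaced by the polynomials of the type class.
\<close>

typedef 'a cring_product =
  "{(m :: int, f :: 'a ring \<Rightarrow> 'a). \<forall>R. (cring R \<longrightarrow> f R \<in> carrier R) \<and> (\<not> cring R \<longrightarrow> f R = undefined)}"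
proof
  show "(0, \<lambda>R. if cring R then \<zero>\<^bsub>R\<^esub> else undefined)
      \<in> {(m, f). \<forall>R. (cring R \<longrightarrow> f R \<in> carrier R) \<and> (\<not> cring R \<longrightarrow> f R = undefined)}"
    by (auto simp: cring.cring_simprules)
qed

lemma cring_l_one: "cring R \<Longrightarrow> x \<in> carrier R \<Longrightarrow> \<one>\<^bsub>R\<^esub> \<otimes>\<^bsub>R\<^esub> x = x"
  by (rule cring.cring_simprules)

setup_lifting type_definition_cring_product

instantiation cring_product :: (type) comm_ring_1
begin

lift_definition zero_cring_product :: "'a cring_product"
  is "(0, \<lambda>R. if cring R then \<zero>\<^bsub>R\<^esub> else undefined)"
  by (auto simp: cring.cring_simprules)

lift_definition one_cring_product :: "'a cring_product"
  is "(1, \<lambda>R. if cring R then \<one>\<^bsub>R\<^esub> else undefined)"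
  by (auto simp: cring.cring_simprules)

lift_definition plus_cring_product :: "'a cring_product \<Rightarrow> 'a cring_product \<Rightarrow> 'a cring_product"
  is "\<lambda>(m, f) (n, g). (m + n, \<lambda>R. if cring R then f R \<oplus>\<^bsub>R\<^esub> g R else undefined)"
  by (auto simp: cring.cring_simprules)

lift_definition times_cring_product :: "'a cring_product \<Rightarrow> 'a cring_product \<Rightarrow> 'a cring_product"
  is "\<lambda>(m, f) (n, g). (m * n, \<lambda>R. if cring R then f R \<otimes>\<^bsub>R\<^esub> g R else undefined)"
  by (auto simp: cring.cring_simprules)

lift_definition uminus_cring_product :: "'a cring_product \<Rightarrow> 'a cring_product"
  is "\<lambda>(m, f). (- m, \<lambda>R. if cring R then \<ominus>\<^bsub>R\<^esub> f R else undefined)"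
  by (auto simp: cring.cring_simprules)

lift_definition minus_cring_product :: "'a cring_product \<Rightarrow> 'a cring_product \<Rightarrow> 'a cring_product"
  is "\<lambda>(m, f) (n, g). (m - n, \<lambda>R. if cring R then f R \<ominus>\<^bsub>R\<^esub> g R else undefined)"
  by (auto simp: cring.cring_simprules)

instance
proof
  fix a b c :: "'a cring_product"
  show "a * b * c = a * (b * c)"
    by transfer (auto simp: fun_eq_iff cring.cring_simprules mult.assoc)
  show "a * b = b * a"
    by transfer (auto simp: fun_eq_iff cring.cring_simprules mult.commute)
  show "1 * a = a"
    by transfer (auto simp: fun_eq_iff cring_l_one)
  show "a + b + c = a + (b + c)"
    by transfer (auto simp: fun_eq_iff cring.cring_simprules)
  show "a + b = b + a"
    by transfer (auto simp: fun_eq_iff cring.cring_simprules)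
  show "0 + a = a"
    by transfer (auto simp: fun_eq_iff cring.cring_simprules)
  show "- a + a = 0"
    by transfer (auto simp: fun_eq_iff cring.cring_simprules)
  show "a - b = a + - b"
    by transfer (auto simp: fun_eq_iff a_minus_def)
  show "(a + b) * c = a * c + b * c"
    by transfer (auto simp: fun_eq_iff cring.cring_simprules algebra_simps)
  show "(0::'a cring_product) \<noteq> 1"
    by transfer auto
qed

end

text \<open>The embedding into the factor \<open>R\<close>, with 0 in all other factors and in the
  integer component. It respects sums and products but sends the unit of \<open>R\<close> to an
  idempotent different from 1, which is the \<open>e\<close> of the locales.\<close>

lift_definition component :: "'a ring \<Rightarrow> 'a \<Rightarrow> 'a cring_product"
  is "\<lambda>R x. (0, \<lambda>S. if cring S then (if S = R \<and> x \<in> carrier R then x else \<zero>\<^bsub>S\<^esub>) else undefined)"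
  by (auto simp: cring.cring_simprules)

lemma component_add:
  assumes "cring R" "x \<in> carrier R" "y \<in> carrier R"
  shows "component R (x \<oplus>\<^bsub>R\<^esub> y) = component R x + component R y"
  using assms by transfer (auto simp: fun_eq_iff cring.cring_simprules)

lemma component_mult:
  assumes "cring R" "x \<in> carrier R" "y \<in> carrier R"
  shows "component R (x \<otimes>\<^bsub>R\<^esub> y) = component R x * component R y"
  using assms by transfer (auto simp: fun_eq_iff cring.cring_simprules)

lemma component_minus:
  assumes "cring R" "x \<in> carrier R" "y \<in> carrier R"
  shows "component R (x \<ominus>\<^bsub>R\<^esub> y) = component R x - component R y"
  using assms by transfer (auto simp: fun_eq_iff cring.cring_simprules a_minus_def)

lemma component_zero: assumes "cring R" shows "component R \<zero>\<^bsub>R\<^esub> = 0"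
  using assms by transfer (auto simp: fun_eq_iff cring.cring_simprules)

lemma component_inj: assumes "cring R" shows "inj_on (component R) (carrier R)"
proof (rule inj_onI)
  fix x y assume xy: "x \<in> carrier R" "y \<in> carrier R" "component R x = component R y"
  then have "(\<lambda>S. if cring S then (if S = R \<and> x \<in> carrier R then x else \<zero>\<^bsub>S\<^esub>) else undefined)
      = (\<lambda>S. if cring S then (if S = R \<and> y \<in> carrier R then y else \<zero>\<^bsub>S\<^esub>) else undefined)"
    by transfer simp
  from fun_cong[OF this, of R] show "x = y" using assms xy by simp
qed

lemma component_power:
  assumes "cring R" "x \<in> carrier R" "n > 0"
  shows "component R (x [^]\<^bsub>R\<^esub> (n::nat)) = component R x ^ n"
  using assms(3)
proof (induction n)
  case (Suc n)
  interpret cring R by (rule assms(1))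
  show ?case
  proof (cases "n = 0")
    case True
    then show ?thesis using assms(2) by (simp add: nat_pow_Suc)
  next
    case False
    then show ?thesis using Suc assms component_mult[OF assms(1), of "x [^]\<^bsub>R\<^esub> n" x]
      by (simp add: nat_pow_Suc mult.commute)
  qed
qed simp

lemma ring_subfield_component:
  assumes L: "field L" and k: "subfield k L" and fin: "finite k"
  shows "ring_subfield (component L ` k) (component L \<one>\<^bsub>L\<^esub>)"
proof -
  interpret L: field L by (rule L)
  interpret k: subfield k L by (rule k)
  have cr: "cring L" by unfold_locales
  have sub: "k \<subseteq> carrier L" by (rule k.subset)
  have inj: "inj_on (component L) (carrier L)" by (rule component_inj[OF cr])
  show ?thesis
  proof
    show "finite (component L ` k)" using fin by simp
    show "component L \<one>\<^bsub>L\<^esub> \<in> component L ` k" using k.one_closed by simp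
    show "component L \<one>\<^bsub>L\<^esub> \<noteq> 0"
      using inj_onD[OF inj, of "\<one>\<^bsub>L\<^esub>" "\<zero>\<^bsub>L\<^esub>"] component_zero[OF cr] by auto
    show "x - y \<in> component L ` k" if xy: "x \<in> component L ` k" "y \<in> component L ` k" for x y
    proof -
      obtain a b where ab: "x = component L a" "y = component L b" "a \<in> k" "b \<in> k" using xy by auto
      then have "x - y = component L (a \<ominus>\<^bsub>L\<^esub> b)" using component_minus[OF cr] sub by auto
      moreover have "a \<ominus>\<^bsub>L\<^esub> b \<in> k" using ab subringE(5,7)[OF subfieldE(1)[OF k]] by (simp add: a_minus_def)
      ultimately show ?thesis by blast
    qed
    show "x * y \<in> component L ` k" if xy: "x \<in> component L ` k" "y \<in> component L ` k" for x y
    proof -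
      obtain a b where ab: "x = component L a" "y = component L b" "a \<in> k" "b \<in> k" using xy by auto
      then have "x * y = component L (a \<otimes>\<^bsub>L\<^esub> b)" using component_mult[OF cr] sub by auto
      moreover have "a \<otimes>\<^bsub>L\<^esub> b \<in> k" using ab by (simp add: k.m_closed)
      ultimately show ?thesis by blast
    qed
    show "component L \<one>\<^bsub>L\<^esub> * x = x" if x: "x \<in> component L ` k" for x
    proof -
      obtain a where a: "x = component L a" "a \<in> k" using x by auto
      then show ?thesis using component_mult[OF cr, of "\<one>\<^bsub>L\<^esub>" a] sub by auto
    qed
    show "\<exists>y\<in>component L ` k. x * y = component L \<one>\<^bsub>L\<^esub>" if x: "x \<in> component L ` k" "x \<noteq> 0" for x
    proof -
      obtain a where a: "x = component L a" "a \<in> k" using x by auto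
      then have "a \<in> k - {\<zero>\<^bsub>L\<^esub>}" using x component_zero[OF cr] by auto
      then have i: "inv\<^bsub>L\<^esub> a \<in> k" "a \<otimes>\<^bsub>L\<^esub> inv\<^bsub>L\<^esub> a = \<one>\<^bsub>L\<^esub>"
        using L.subfield_m_inv[OF k] by auto
      then have "x * component L (inv\<^bsub>L\<^esub> a) = component L \<one>\<^bsub>L\<^esub>"
        using a component_mult[OF cr, of a "inv\<^bsub>L\<^esub> a"] sub by auto
      then show ?thesis using i by blast
    qed
  qed
qed

lemma odd_field_ext_component:
  assumes q: "q \<in> odd_prime_powers" and ext: "finite_field_ext q t L k" and t: "t \<ge> 2"
  shows "\<exists>p a b. odd_field_ext (component L ` k) (component L ` carrier L) (component L \<one>\<^bsub>L\<^esub>) p a b (t - 1)"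
proof -
  have L: "field L" "subfield k L" "card (carrier L) = q ^ (t - 1)" "card k = q"
    using ext by (auto simp: finite_field_ext_def)
  interpret L: field L by (rule L(1))
  have cr: "cring L" by unfold_locales
  have inj: "inj_on (component L) (carrier L)" by (rule component_inj[OF cr])
  have sub: "k \<subseteq> carrier L" using subfieldE(3)[OF L(2)] .
  obtain p a where p: "prime p" "a > 0" "q = p ^ a" and odd: "odd q"
    using q by (auto simp: odd_prime_powers_def primepow_def)
  have q0: "q > 0" using p by (simp add: prime_gt_0_nat)
  have fin: "finite (carrier L)" "finite k" using L(3,4) q0 by (auto intro: card_ge_0_finite)
  have cK: "card (component L ` k) = q" using L(4) inj sub by (metis card_image inj_on_subset)
  have cL: "card (component L ` carrier L) = q ^ (t - 1)" using L(3) inj by (simp add: card_image)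
  interpret K': ring_subfield "component L ` k" "component L \<one>\<^bsub>L\<^esub>"
    by (rule ring_subfield_component[OF L(1,2) fin(2)])
  interpret L': ring_subfield "component L ` carrier L" "component L \<one>\<^bsub>L\<^esub>"
    by (rule ring_subfield_component[OF L(1) L.carrier_is_subfield fin(1)])
  have "odd_field_ext (component L ` k) (component L ` carrier L) (component L \<one>\<^bsub>L\<^esub>) p a (a * (t - 1)) (t - 1)"
  proof
    show "prime p" by (rule p(1))
    show "card (component L ` k) = p ^ a" using cK p by simp
    show "odd (card (component L ` k))" using cK odd by simp
    show "card (component L ` carrier L) = p ^ (a * (t - 1))" using cL p by (simp add: power_mult)
    show "odd (card (component L ` carrier L))" using cL odd by simp
    show "component L ` k \<subseteq> component L ` carrier L" using sub by blast
    show "card (component L ` carrier L) = card (component L ` k) ^ (t - 1)" using cK cL by simp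
    show "t - 1 > 0" using t by simp
  qed
  then show ?thesis by blast
qed

definition norm_common_nbrs :: "nat \<Rightarrow> nat \<Rightarrow> 'a ring \<Rightarrow> 'a set \<Rightarrow> ('a \<times> 'a) set \<Rightarrow> ('a \<times> 'a) set" where
  "norm_common_nbrs q t L k D = {(X, x). X \<in> carrier L \<and> x \<in> k - {\<zero>\<^bsub>L\<^esub>} \<and>
     (\<forall>(A, a)\<in>D. field_norm q t L (A \<oplus>\<^bsub>L\<^esub> X) = a \<otimes>\<^bsub>L\<^esub> x)}"

text \<open>The estimates are transported along \<open>\<Phi>\<close>, which applies
  \<open>component L\<close> to both coordinates and maps the vertices and the common neighbours
  bijectively onto their counterparts in the locale.\<close>

lemma norm_common_nbrs_bounds:
  assumes q: "q \<in> odd_prime_powers" and ext: "finite_field_ext q t L k"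
    and D: "D \<subseteq> carrier L \<times> (k - {\<zero>\<^bsub>L\<^esub>})" "card D \<le> 3" and t: "t \<ge> 3" "card D = 3 \<longrightarrow> t \<ge> 4"
  shows "finite (norm_common_nbrs q t L k D)"
    and "real (card (norm_common_nbrs q t L k D)) \<le> 65 * real q ^ (t - card D)"
    and "(card D = 3 \<longrightarrow> t \<ge> 5) \<Longrightarrow>
      real (card (norm_common_nbrs q t L k D)) \<le> (1 + 64 / sqrt (real q)) * real q ^ (t - card D)"
    and "inj_on fst D \<Longrightarrow> finite B \<Longrightarrow> B \<subseteq> carrier L \<Longrightarrow>
      (1 - (64 + real (card B)) / sqrt (real q)) * real q ^ (t - card D)
        \<le> real (card {y \<in> norm_common_nbrs q t L k D. fst y \<notin> B})"
proof -
  have L: "field L" "subfield k L" "card (carrier L) = q ^ (t - 1)" "card k = q"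
    using ext by (auto simp: finite_field_ext_def)
  interpret L: field L by (rule L(1))
  have cr: "cring L" by unfold_locales
  have inj: "inj_on (component L) (carrier L)" by (rule component_inj[OF cr])
  have sub: "k \<subseteq> carrier L" using subfieldE(3)[OF L(2)] .
  obtain p a b where
    "odd_field_ext (component L ` k) (component L ` carrier L) (component L \<one>\<^bsub>L\<^esub>) p a b (t - 1)"
    using odd_field_ext_component[OF q ext] t by auto
  then interpret E: odd_field_ext "component L ` k" "component L ` carrier L" "component L \<one>\<^bsub>L\<^esub>" p a b "t - 1" .
  let ?\<iota> = "component L"
  define \<Phi> where "\<Phi> = map_prod ?\<iota> ?\<iota>"
  have cK: "card (?\<iota> ` k) = q" using L(4) inj sub by (metis card_image inj_on_subset)
  have ne: "E.norm_exp = (\<Sum>i<t - 1. q ^ i)" unfolding E.norm_exp_def cK ..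
  have norm: "?\<iota> (field_norm q t L x) = ?\<iota> x ^ E.norm_exp" if "x \<in> carrier L" for x
    unfolding field_norm_def ne[symmetric] using component_power[OF cr that E.norm_exp_pos] .
  have zero: "?\<iota> x = 0 \<longleftrightarrow> x = \<zero>\<^bsub>L\<^esub>" if "x \<in> carrier L" for x
    using inj_onD[OF inj, of x "\<zero>\<^bsub>L\<^esub>"] component_zero[OF cr] that by auto
  let ?V = "carrier L \<times> (k - {\<zero>\<^bsub>L\<^esub>})"
  have injV: "inj_on \<Phi> ?V"
    unfolding \<Phi>_def using inj sub by (auto simp: inj_on_def)
  have imgV: "\<Phi> ` ?V = E.vertices"
  proof -
    have "?\<iota> ` (k - {\<zero>\<^bsub>L\<^esub>}) = ?\<iota> ` k - {0}" using zero sub by auto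
    then show ?thesis unfolding \<Phi>_def E.vertices_def by (metis map_prod_surj_on)
  qed
  have eq: "field_norm q t L (A \<oplus>\<^bsub>L\<^esub> X) = a \<otimes>\<^bsub>L\<^esub> x \<longleftrightarrow> (?\<iota> A + ?\<iota> X) ^ E.norm_exp = ?\<iota> a * ?\<iota> x"
    if "A \<in> carrier L" "X \<in> carrier L" "a \<in> k" "x \<in> k" for A X a x
  proof -
    have ax: "a \<in> carrier L" "x \<in> carrier L" using that sub by auto
    moreover have "field_norm q t L (A \<oplus>\<^bsub>L\<^esub> X) \<in> carrier L" using that by (simp add: field_norm_def)
    ultimately have "field_norm q t L (A \<oplus>\<^bsub>L\<^esub> X) = a \<otimes>\<^bsub>L\<^esub> x
        \<longleftrightarrow> ?\<iota> (field_norm q t L (A \<oplus>\<^bsub>L\<^esub> X)) = ?\<iota> (a \<otimes>\<^bsub>L\<^esub> x)"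
      using inj by (auto simp: inj_on_def)
    then show ?thesis
      using that norm[of "A \<oplus>\<^bsub>L\<^esub> X"] component_add[OF cr, of A X] component_mult[OF cr ax] by simp
  qed
  have img: "\<Phi> ` norm_common_nbrs q t L k D = E.common_nbrs (\<Phi> ` D)"
  proof (intro equalityI subsetI)
    fix y assume "y \<in> \<Phi> ` norm_common_nbrs q t L k D"
    then obtain X x where y: "y = (?\<iota> X, ?\<iota> x)" "(X, x) \<in> norm_common_nbrs q t L k D" by (auto simp: \<Phi>_def)
    have Xx: "X \<in> carrier L" "x \<in> k" "x \<noteq> \<zero>\<^bsub>L\<^esub>" using y(2) by (auto simp: norm_common_nbrs_def)
    have "(?\<iota> A + ?\<iota> X) ^ E.norm_exp = ?\<iota> a * ?\<iota> x" if "(A, a) \<in> D" for A a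
    proof -
      have "A \<in> carrier L" "a \<in> k" using that D(1) by auto
      moreover have "field_norm q t L (A \<oplus>\<^bsub>L\<^esub> X) = a \<otimes>\<^bsub>L\<^esub> x" using y(2) that by (auto simp: norm_common_nbrs_def)
      ultimately show ?thesis using eq Xx by blast
    qed
    then show "y \<in> E.common_nbrs (\<Phi> ` D)" using y Xx zero sub unfolding E.common_nbrs_def \<Phi>_def by auto
  next
    fix y assume y: "y \<in> E.common_nbrs (\<Phi> ` D)"
    then have "y \<in> \<Phi> ` ?V" using E.common_nbrs_subset imgV by auto
    then obtain X x where Xx: "y = (?\<iota> X, ?\<iota> x)" "X \<in> carrier L" "x \<in> k" "x \<noteq> \<zero>\<^bsub>L\<^esub>" by (auto simp: \<Phi>_def)
    have "field_norm q t L (A \<oplus>\<^bsub>L\<^esub> X) = a \<otimes>\<^bsub>L\<^esub> x" if "(A, a) \<in> D" for A a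
    proof -
      have "A \<in> carrier L" "a \<in> k" using that D(1) by auto
      moreover have "(?\<iota> A, ?\<iota> a) \<in> \<Phi> ` D" using that by (force simp: \<Phi>_def)
      then have "(?\<iota> A + ?\<iota> X) ^ E.norm_exp = ?\<iota> a * ?\<iota> x"
        using y unfolding Xx(1) E.common_nbrs_def by fastforce
      ultimately show ?thesis using eq Xx by blast
    qed
    then have "(X, x) \<in> norm_common_nbrs q t L k D" using Xx by (auto simp: norm_common_nbrs_def)
    then show "y \<in> \<Phi> ` norm_common_nbrs q t L k D" using Xx(1) by (force simp: \<Phi>_def)
  qed
  have subV: "norm_common_nbrs q t L k D \<subseteq> ?V" by (auto simp: norm_common_nbrs_def)
  have card_sub: "card (\<Phi> ` S) = card S" if "S \<subseteq> ?V" for S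
    using injV that by (meson card_image inj_on_subset)
  have card_nbrs: "card (E.common_nbrs (\<Phi> ` D)) = card (norm_common_nbrs q t L k D)"
    using card_sub[OF subV] img by simp
  have cD: "card (\<Phi> ` D) = card D" using card_sub[OF D(1)] .
  have V': "\<Phi> ` D \<subseteq> E.vertices" using D(1) imgV by blast
  have t': "t - 1 + 1 - card D = t - card D" using t by simp
  have finV: "finite ?V"
  proof -
    have "finite (\<Phi> ` ?V)" unfolding imgV by (rule E.finite_vertices)
    then show ?thesis using injV finite_imageD by blast
  qed
  have c: "2 \<le> t - 1" "card D = 3 \<longrightarrow> 3 \<le> t - 1" using t by auto
  show "finite (norm_common_nbrs q t L k D)" using subV finV finite_subset by blast
  show "real (card (norm_common_nbrs q t L k D)) \<le> 65 * real q ^ (t - card D)"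
    using E.card_common_nbrs_upper(1)[OF V' _ c(1), unfolded cD card_nbrs cK t', OF D(2) c(2)] .
  show "real (card (norm_common_nbrs q t L k D)) \<le> (1 + 64 / sqrt (real q)) * real q ^ (t - card D)"
    if "card D = 3 \<longrightarrow> t \<ge> 5"
    using E.card_common_nbrs_upper(2)[OF V' _ c(1), unfolded cD card_nbrs cK t', OF D(2) c(2)] that by fastforce
  assume injD: "inj_on fst D" and B: "finite B" "B \<subseteq> carrier L"
  have injD': "inj_on fst (\<Phi> ` D)"
  proof (rule inj_onI, clarsimp simp: \<Phi>_def)
    fix A a A' a' assume "(A, a) \<in> D" "(A', a') \<in> D" "?\<iota> A = ?\<iota> A'"
    then have "A = A'" using inj D(1) by (auto dest: inj_onD)
    then show "?\<iota> a = ?\<iota> a'" using injD \<open>(A, a) \<in> D\<close> \<open>(A', a') \<in> D\<close> by (force simp: inj_on_def)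
  qed
  have "\<Phi> ` {y \<in> norm_common_nbrs q t L k D. fst y \<notin> B} = {y \<in> E.common_nbrs (\<Phi> ` D). fst y \<notin> ?\<iota> ` B}"
  proof -
    have fst: "fst (\<Phi> y) \<in> ?\<iota> ` B \<longleftrightarrow> fst y \<in> B" if "y \<in> norm_common_nbrs q t L k D" for y
    proof -
      have "fst y \<in> carrier L" using that subV by (cases y) auto
      then have "?\<iota> (fst y) \<in> ?\<iota> ` B \<longleftrightarrow> fst y \<in> B" using inj_on_image_mem_iff[OF inj _ B(2)] by blast
      moreover have "fst (\<Phi> y) = ?\<iota> (fst y)" by (cases y) (simp add: \<Phi>_def)
      ultimately show ?thesis by simp
    qed
    show ?thesis unfolding img[symmetric] using fst by blast
  qed
  then have "card {y \<in> E.common_nbrs (\<Phi> ` D). fst y \<notin> ?\<iota> ` B} = card {y \<in> norm_common_nbrs q t L k D. fst y \<notin> B}"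
    using card_sub[of "{y \<in> norm_common_nbrs q t L k D. fst y \<notin> B}"] subV by auto
  moreover have "card (?\<iota> ` B) = card B" using inj B(2) by (meson card_image inj_on_subset)
  ultimately show "(1 - (64 + real (card B)) / sqrt (real q)) * real q ^ (t - card D)
        \<le> real (card {y \<in> norm_common_nbrs q t L k D. fst y \<notin> B})"
    using E.card_common_nbrs_lower[OF V' injD' _ c(1), of "?\<iota> ` B", unfolded cD cK t', OF D(2) c(2)] B by simp
qed

section \<open>Counting copies of a degenerate graph\<close>

definition remove_vertex :: "'v ugraph \<Rightarrow> 'v \<Rightarrow> 'v ugraph" where
  "remove_vertex H x = (verts H - {x}, {e \<in> edges H. x \<notin> e})"

definition nbrs :: "'v ugraph \<Rightarrow> 'v \<Rightarrow> 'v set" where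
  "nbrs H x = {u \<in> verts H. {x, u} \<in> edges H}"

definition graph_common_nbrs :: "'w ugraph \<Rightarrow> 'w set \<Rightarrow> 'w set" where
  "graph_common_nbrs G D = {y \<in> verts G. \<forall>d\<in>D. {d, y} \<in> edges G}"

lemma finite_edges: "simple_graph H \<Longrightarrow> finite (edges H)"
  by (rule finite_subset[of _ "Pow (verts H)"]) (auto simp: simple_graph_def)

lemma simple_graph_remove_vertex: "simple_graph H \<Longrightarrow> simple_graph (remove_vertex H x)"
  by (auto simp: simple_graph_def remove_vertex_def)

lemma degenerate_remove_vertex: "degenerate r H \<Longrightarrow> degenerate r (remove_vertex H x)"
  unfolding degenerate_def subgraph_def remove_vertex_def fst_conv snd_conv by blast

lemma nbrs_subset: assumes "simple_graph H" shows "nbrs H x \<subseteq> verts H - {x}"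
proof
  fix u assume "u \<in> nbrs H x"
  then have "u \<in> verts H" "card {x, u} = 2" using assms by (auto simp: nbrs_def simple_graph_def)
  then show "u \<in> verts H - {x}" by auto
qed

lemma card_nbrs: assumes "simple_graph H" "x \<in> verts H" shows "card (nbrs H x) = vertex_degree H x"
  unfolding vertex_degree_def
proof (rule bij_betw_same_card)
  show "bij_betw (\<lambda>u. {x, u}) (nbrs H x) {e \<in> edges H. x \<in> e}"
  proof (rule bij_betw_imageI)
    show "inj_on (\<lambda>u. {x, u}) (nbrs H x)" using nbrs_subset[OF assms(1)] by (auto simp: inj_on_def doubleton_eq_iff)
    show "(\<lambda>u. {x, u}) ` nbrs H x = {e \<in> edges H. x \<in> e}"
    proof (intro equalityI subsetI)
      fix e assume e: "e \<in> {e \<in> edges H. x \<in> e}"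
      then have "e \<subseteq> verts H" "card e = 2" using assms by (auto simp: simple_graph_def)
      then obtain a b where "e = {a, b}" by (auto simp: card_2_iff)
      then obtain u where "e = {x, u}" using e by auto
      then show "e \<in> (\<lambda>u. {x, u}) ` nbrs H x" using e \<open>e \<subseteq> verts H\<close> by (auto simp: nbrs_def)
    qed (auto simp: nbrs_def)
  qed
qed

lemma card_edges_remove_vertex:
  assumes "simple_graph H"
  shows "card (edges H) = card (edges (remove_vertex H x)) + vertex_degree H x"
proof -
  have "edges H = edges (remove_vertex H x) \<union> {e \<in> edges H. x \<in> e}" by (auto simp: remove_vertex_def)
  then have "card (edges H) = card (edges (remove_vertex H x) \<union> {e \<in> edges H. x \<in> e})" by simp
  also have "\<dots> = card (edges (remove_vertex H x)) + vertex_degree H x"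
    unfolding vertex_degree_def using finite_edges[OF assms]
    by (intro card_Un_disjoint) (auto simp: remove_vertex_def)
  finally show ?thesis .
qed

lemma degenerate_ex_vertex:
  assumes "simple_graph H" "degenerate r H" "verts H \<noteq> {}"
  obtains x where "x \<in> verts H" "vertex_degree H x \<le> r"
  using assms unfolding degenerate_def subgraph_def by blast

lemma finite_labeled_copies:
  assumes "simple_graph H" "finite (verts G)" shows "finite (labeled_copies H G)"
  by (rule finite_subset[of _ "verts H \<rightarrow>\<^sub>E verts G"])
     (use assms in \<open>auto simp: labeled_copies_def simple_graph_def intro!: finite_PiE\<close>)

text \<open>The colour will be the first coordinate, so that these copies use vertices with pairwise
  distinct first coordinates.\<close>

definition coloured_copies :: "('w \<Rightarrow> 'c) \<Rightarrow> 'v ugraph \<Rightarrow> 'w ugraph \<Rightarrow> ('v \<Rightarrow> 'w) set" where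
  "coloured_copies col H G = {\<phi> \<in> labeled_copies H G. inj_on (col \<circ> \<phi>) (verts H)}"

text \<open>A copy of H is a copy of H - x together with an image of x among the common neighbours
  of the images of the neighbours of x.\<close>

lemma card_labeled_copies_le:
  assumes H: "simple_graph H" "x \<in> verts H" and G: "finite (verts G)"
    and bound: "\<And>\<psi>. \<psi> \<in> labeled_copies (remove_vertex H x) G \<Longrightarrow> real (card (graph_common_nbrs G (\<psi> ` nbrs H x))) \<le> b"
  shows "real (card (labeled_copies H G)) \<le> real (card (labeled_copies (remove_vertex H x) G)) * b"
proof -
  let ?H = "remove_vertex H x" and ?C = "\<lambda>\<psi>. graph_common_nbrs G (\<psi> ` nbrs H x)"
  let ?f = "\<lambda>\<phi>. (restrict \<phi> (verts H - {x}), \<phi> x)"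
  have finC: "finite (?C \<psi>)" for \<psi> using G by (auto simp: graph_common_nbrs_def)
  have fin: "finite (labeled_copies ?H G)"
    using finite_labeled_copies[OF simple_graph_remove_vertex[OF H(1)] G] .
  have "card (labeled_copies H G) \<le> card (Sigma (labeled_copies ?H G) ?C)"
  proof (rule card_inj_on_le[where f = ?f])
    show "inj_on ?f (labeled_copies H G)"
    proof (rule inj_onI)
      fix \<phi> \<phi>' assume a: "\<phi> \<in> labeled_copies H G" "\<phi>' \<in> labeled_copies H G" "?f \<phi> = ?f \<phi>'"
      show "\<phi> = \<phi>'"
      proof (rule PiE_ext)
        show "\<phi> \<in> verts H \<rightarrow>\<^sub>E verts G" "\<phi>' \<in> verts H \<rightarrow>\<^sub>E verts G" using a by (auto simp: labeled_copies_def)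
        fix u assume "u \<in> verts H"
        then show "\<phi> u = \<phi>' u" using a(3) by (cases "u = x") (auto dest: fun_cong[of _ _ u])
      qed
    qed
    show "?f ` labeled_copies H G \<subseteq> Sigma (labeled_copies ?H G) ?C"
    proof (intro image_subsetI SigmaI)
      fix \<phi> assume \<phi>: "\<phi> \<in> labeled_copies H G"
      have V: "u \<in> verts H - {x}" if "{u, w} \<in> edges ?H" for u w
        using that H by (auto simp: remove_vertex_def simple_graph_def)
      have "{restrict \<phi> (verts H - {x}) u, restrict \<phi> (verts H - {x}) w} \<in> edges G" if e: "{u, w} \<in> edges ?H" for u w
      proof -
        have "u \<in> verts H - {x}" "w \<in> verts H - {x}" using V[of u w] V[of w u] e by (simp_all add: insert_commute)
        moreover have "{u, w} \<in> edges H" using e by (simp add: remove_vertex_def)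
        ultimately show ?thesis using \<phi> by (simp add: labeled_copies_def)
      qed
      moreover have "restrict \<phi> (verts H - {x}) \<in> verts ?H \<rightarrow>\<^sub>E verts G"
        using \<phi> by (auto simp: labeled_copies_def remove_vertex_def)
      moreover have "inj_on (restrict \<phi> (verts H - {x})) (verts ?H)"
        using \<phi> by (auto simp: labeled_copies_def remove_vertex_def inj_on_def)
      ultimately show "restrict \<phi> (verts H - {x}) \<in> labeled_copies ?H G" by (simp add: labeled_copies_def)
      have "restrict \<phi> (verts H - {x}) ` nbrs H x = \<phi> ` nbrs H x"
        using nbrs_subset[OF H(1), of x] by (intro image_cong) auto
      moreover have "\<phi> x \<in> verts G" using \<phi> H(2) by (auto simp: labeled_copies_def)
      moreover have "{\<phi> u, \<phi> x} \<in> edges G" if "u \<in> nbrs H x" for u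
        using \<phi> that by (auto simp: labeled_copies_def nbrs_def insert_commute)
      ultimately show "\<phi> x \<in> ?C (restrict \<phi> (verts H - {x}))" by (auto simp: graph_common_nbrs_def)
    qed
    show "finite (Sigma (labeled_copies ?H G) ?C)" using fin finC by auto
  qed
  also have "card (Sigma (labeled_copies ?H G) ?C) = (\<Sum>\<psi>\<in>labeled_copies ?H G. card (?C \<psi>))"
    using fin finC by simp
  finally have "real (card (labeled_copies H G)) \<le> (\<Sum>\<psi>\<in>labeled_copies ?H G. real (card (?C \<psi>)))"
    by (simp flip: of_nat_sum)
  also have "\<dots> \<le> (\<Sum>\<psi>\<in>labeled_copies ?H G. b)" using bound by (rule sum_mono)
  finally show ?thesis by simp
qed

text \<open>Any common neighbour of a new colour extends the copy: the new colour makes the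
  extension injective as well.\<close>

lemma card_coloured_copies_ge:
  assumes H: "simple_graph H" "x \<in> verts H" and G: "finite (verts G)"
    and bound: "\<And>\<psi>. \<psi> \<in> coloured_copies col (remove_vertex H x) G \<Longrightarrow>
      b \<le> real (card {y \<in> graph_common_nbrs G (\<psi> ` nbrs H x). col y \<notin> col ` \<psi> ` (verts H - {x})})"
  shows "real (card (coloured_copies col (remove_vertex H x) G)) * b \<le> real (card (coloured_copies col H G))"
proof -
  let ?H = "remove_vertex H x"
  let ?C = "\<lambda>\<psi>. {y \<in> graph_common_nbrs G (\<psi> ` nbrs H x). col y \<notin> col ` \<psi> ` (verts H - {x})}"
  let ?f = "\<lambda>(\<psi>, y). \<psi>(x := y)"
  let ?S = "Sigma (coloured_copies col ?H G) ?C"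
  have finC: "finite (?C \<psi>)" for \<psi> using G by (auto simp: graph_common_nbrs_def)
  have fin: "finite (coloured_copies col ?H G)"
    using finite_labeled_copies[OF simple_graph_remove_vertex[OF H(1)] G, of x] by (auto simp: coloured_copies_def)
  have VH: "verts ?H = verts H - {x}" by (simp add: remove_vertex_def)
  have fin': "finite (coloured_copies col H G)"
    using finite_labeled_copies[OF H(1) G] by (auto simp: coloured_copies_def)
  have "card ?S \<le> card (coloured_copies col H G)"
  proof (rule card_inj_on_le[where f = ?f])
    show "inj_on ?f ?S"
    proof (rule inj_onI, clarify)
      fix \<psi> y \<psi>' y' assume a: "\<psi> \<in> coloured_copies col ?H G" "\<psi>' \<in> coloured_copies col ?H G" "\<psi>(x := y) = \<psi>'(x := y')"
      have "y = y'" using fun_cong[OF a(3), of x] by simp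
      moreover have "\<psi> u = \<psi>' u" for u
      proof (cases "u = x")
        case True
        have "x \<notin> verts ?H" by (simp add: VH)
        then show ?thesis using a(1,2) True by (auto simp: coloured_copies_def labeled_copies_def PiE_def extensional_def)
      next
        case False
        then show ?thesis using fun_cong[OF a(3), of u] by simp
      qed
      ultimately show "\<psi> = \<psi>' \<and> y = y'" by auto
    qed
    show "?f ` ?S \<subseteq> coloured_copies col H G"
    proof (rule image_subsetI)
      fix z assume "z \<in> ?S"
      then obtain \<psi> y where z: "z = (\<psi>, y)" "\<psi> \<in> coloured_copies col ?H G" "y \<in> ?C \<psi>" by auto
      have \<psi>: "\<psi> \<in> labeled_copies ?H G" "inj_on (col \<circ> \<psi>) (verts H - {x})" using z(2) VH by (auto simp: coloured_copies_def)
      let ?\<phi> = "\<psi>(x := y)"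
      have y: "y \<in> verts G" "\<And>u. u \<in> nbrs H x \<Longrightarrow> {\<psi> u, y} \<in> edges G" "\<And>u. u \<in> verts H - {x} \<Longrightarrow> col y \<noteq> col (\<psi> u)"
        using z(3) by (auto simp: graph_common_nbrs_def)
      have PiE: "?\<phi> \<in> verts H \<rightarrow>\<^sub>E verts G"
        using \<psi>(1) y(1) H(2) VH by (auto simp: labeled_copies_def PiE_def extensional_def Pi_def)
      have inj: "inj_on (col \<circ> ?\<phi>) (verts H)"
      proof (rule inj_onI)
        fix u w assume uw: "u \<in> verts H" "w \<in> verts H" "(col \<circ> ?\<phi>) u = (col \<circ> ?\<phi>) w"
        consider "u = x" "w = x" | "u = x" "w \<noteq> x" | "u \<noteq> x" "w = x" | "u \<noteq> x" "w \<noteq> x" by blast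
        then show "u = w"
        proof cases
          case 2
          then show ?thesis using y(3)[of w] uw by simp
        next
          case 3
          then show ?thesis using y(3)[of u] uw by simp
        next
          case 4
          then show ?thesis using inj_onD[OF \<psi>(2), of u w] uw by simp
        qed simp
      qed
      have edges: "{?\<phi> u, ?\<phi> w} \<in> edges G" if e: "{u, w} \<in> edges H" for u w
      proof -
        have uw: "u \<in> verts H" "w \<in> verts H" "u \<noteq> w" using e H(1) by (auto simp: simple_graph_def)
        consider "u = x" | "w = x" | "u \<noteq> x" "w \<noteq> x" by blast
        then show ?thesis
        proof cases
          case 1
          then have "w \<in> nbrs H x" using e uw by (simp add: nbrs_def)
          then show ?thesis using y(2) 1 uw by (auto simp: insert_commute)
        next
          case 2
          then have "u \<in> nbrs H x" using e uw by (simp add: nbrs_def insert_commute)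
          then show ?thesis using y(2) 2 uw by auto
        next
          case 3
          then have "{u, w} \<in> edges ?H" using e by (simp add: remove_vertex_def)
          then show ?thesis using \<psi>(1) 3 by (simp add: labeled_copies_def)
        qed
      qed
      have "inj_on ?\<phi> (verts H)" using inj by (rule inj_on_imageI2)
      then show "?f z \<in> coloured_copies col H G"
        using PiE inj edges unfolding z(1) by (simp add: coloured_copies_def labeled_copies_def)
    qed
  qed (rule fin')
  moreover have "card ?S = (\<Sum>\<psi>\<in>coloured_copies col ?H G. card (?C \<psi>))"
    using fin finC by simp
  ultimately have "(\<Sum>\<psi>\<in>coloured_copies col ?H G. real (card (?C \<psi>))) \<le> real (card (coloured_copies col H G))"
    by (simp flip: of_nat_sum)
  moreover have "(\<Sum>\<psi>\<in>coloured_copies col ?H G. b) \<le> (\<Sum>\<psi>\<in>coloured_copies col ?H G. real (card (?C \<psi>)))"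
    using bound by (rule sum_mono)
  ultimately show ?thesis by simp
qed

lemma labeled_copies_empty:
  assumes "simple_graph H" "verts H = {}"
  shows "labeled_copies H G = {\<lambda>_. undefined}" "edges H = {}"
proof -
  show "edges H = {}" using assms by (auto simp: simple_graph_def)
  then show "labeled_copies H G = {\<lambda>_. undefined}" using assms by (auto simp: labeled_copies_def)
qed

text \<open>A vertex x of degree at most r is removed at each step and contributes the factor b Q^t
  / Q^(deg x); the degrees at the moment of removal add up to the number of edges.\<close>

lemma degenerate_upper_bound:
  assumes "simple_graph H" "degenerate r H" and G: "finite (verts G)" and Q: "Q > 0" "b \<ge> 0"
    and bound: "\<And>D. D \<subseteq> verts G \<Longrightarrow> card D \<le> r \<Longrightarrow> real (card (graph_common_nbrs G D)) \<le> b * (Q ^ t / Q ^ card D)"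
  shows "real (card (labeled_copies H G)) \<le> b ^ card (verts H) * (Q ^ (t * card (verts H)) / Q ^ card (edges H))"
  using assms(1,2)
proof (induction "card (verts H)" arbitrary: H)
  case 0
  then have "verts H = {}" by (auto simp: simple_graph_def)
  then show ?case using labeled_copies_empty(1)[OF 0(2), of G] labeled_copies_empty(2)[OF 0(2)] by simp
next
  case (Suc v)
  then have "verts H \<noteq> {}" by auto
  then obtain x where x: "x \<in> verts H" "vertex_degree H x \<le> r" using degenerate_ex_vertex Suc.prems by blast
  let ?H = "remove_vertex H x" and ?d = "vertex_degree H x"
  have finV: "finite (verts H)" using Suc.prems by (simp add: simple_graph_def)
  have cV: "card (verts ?H) = v" using Suc.hyps(2) x finV by (simp add: remove_vertex_def)
  have IH: "real (card (labeled_copies ?H G)) \<le> b ^ v * (Q ^ (t * v) / Q ^ card (edges ?H))"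
    using Suc.hyps(1)[of ?H] cV simple_graph_remove_vertex degenerate_remove_vertex Suc.prems by metis
  have "real (card (labeled_copies H G)) \<le> real (card (labeled_copies ?H G)) * (b * (Q ^ t / Q ^ ?d))"
  proof (rule card_labeled_copies_le[OF Suc.prems(1) x(1) G])
    fix \<psi> assume \<psi>: "\<psi> \<in> labeled_copies ?H G"
    have sub: "nbrs H x \<subseteq> verts ?H" using nbrs_subset[OF Suc.prems(1)] by (simp add: remove_vertex_def)
    then have "\<psi> ` nbrs H x \<subseteq> verts G" using \<psi> by (auto simp: labeled_copies_def)
    moreover have "inj_on \<psi> (nbrs H x)" using \<psi> sub by (auto simp: labeled_copies_def intro: inj_on_subset)
    then have "card (\<psi> ` nbrs H x) = ?d" using card_nbrs[OF Suc.prems(1) x(1)] by (simp add: card_image)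
    ultimately show "real (card (graph_common_nbrs G (\<psi> ` nbrs H x))) \<le> b * (Q ^ t / Q ^ ?d)"
      using bound[of "\<psi> ` nbrs H x"] x(2) by simp
  qed
  also have "\<dots> \<le> b ^ v * (Q ^ (t * v) / Q ^ card (edges ?H)) * (b * (Q ^ t / Q ^ ?d))"
    using IH Q by (intro mult_right_mono) auto
  also have "\<dots> = b ^ Suc v * (Q ^ (t * Suc v) / Q ^ card (edges H))"
    unfolding card_edges_remove_vertex[OF Suc.prems(1), of x] by (simp add: power_add)
  finally show ?case unfolding Suc.hyps(2)[symmetric] .
qed

text \<open>The same induction, with \<open>B\<close> the set of colours already used. The number
  \<open>N\<close> stays fixed while H shrinks, so that one constant \<open>b\<close> serves all
  steps.\<close>

lemma degenerate_lower_bound: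
  assumes "simple_graph H" "degenerate r H" "card (verts H) \<le> N" and G: "finite (verts G)" and Q: "Q > 0" "b \<ge> 0"
    and bound: "\<And>D B. D \<subseteq> verts G \<Longrightarrow> card D \<le> r \<Longrightarrow> inj_on col D \<Longrightarrow> finite B \<Longrightarrow> B \<subseteq> col ` verts G \<Longrightarrow> card B \<le> N \<Longrightarrow>
      col ` D \<subseteq> B \<Longrightarrow> b * (Q ^ t / Q ^ card D) \<le> real (card {y \<in> graph_common_nbrs G D. col y \<notin> B})"
  shows "b ^ card (verts H) * (Q ^ (t * card (verts H)) / Q ^ card (edges H)) \<le> real (card (coloured_copies col H G))"
  using assms(1-3)
proof (induction "card (verts H)" arbitrary: H)
  case 0
  then have V: "verts H = {}" by (auto simp: simple_graph_def)
  then have "coloured_copies col H G = {\<lambda>_. undefined}"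
    using labeled_copies_empty(1)[OF 0(2) V, of G] V unfolding coloured_copies_def by simp
  then show ?case using labeled_copies_empty(2)[OF 0(2) V] V by simp
next
  case (Suc v)
  then have "verts H \<noteq> {}" by auto
  then obtain x where x: "x \<in> verts H" "vertex_degree H x \<le> r" using degenerate_ex_vertex Suc.prems by blast
  let ?H = "remove_vertex H x" and ?d = "vertex_degree H x"
  have finV: "finite (verts H)" using Suc.prems by (simp add: simple_graph_def)
  have cV: "card (verts ?H) = v" using Suc.hyps(2) x finV by (simp add: remove_vertex_def)
  have "card (verts ?H) \<le> N" using cV Suc.hyps(2) Suc.prems(3) by simp
  then have IH: "b ^ v * (Q ^ (t * v) / Q ^ card (edges ?H)) \<le> real (card (coloured_copies col ?H G))"
    using Suc.hyps(1)[of ?H] cV simple_graph_remove_vertex degenerate_remove_vertex Suc.prems by metis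
  have "b ^ Suc v * (Q ^ (t * Suc v) / Q ^ card (edges H))
      = b ^ v * (Q ^ (t * v) / Q ^ card (edges ?H)) * (b * (Q ^ t / Q ^ ?d))"
    unfolding card_edges_remove_vertex[OF Suc.prems(1), of x] by (simp add: power_add)
  also have "\<dots> \<le> real (card (coloured_copies col ?H G)) * (b * (Q ^ t / Q ^ ?d))"
    using IH Q by (intro mult_right_mono) auto
  also have "\<dots> \<le> real (card (coloured_copies col H G))"
  proof (rule card_coloured_copies_ge[OF Suc.prems(1) x(1) G])
    fix \<psi> assume \<psi>: "\<psi> \<in> coloured_copies col ?H G"
    let ?V = "verts H - {x}"
    have VH: "verts ?H = ?V" by (simp add: remove_vertex_def)
    have sub: "nbrs H x \<subseteq> ?V" using nbrs_subset[OF Suc.prems(1)] .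
    have \<psi>V: "\<psi> ` ?V \<subseteq> verts G" using \<psi> VH by (auto simp: coloured_copies_def labeled_copies_def)
    have injc: "inj_on (col \<circ> \<psi>) ?V" using \<psi> VH by (auto simp: coloured_copies_def)
    have inj: "inj_on \<psi> ?V" using \<psi> VH by (auto simp: coloured_copies_def labeled_copies_def)
    have "card (\<psi> ` nbrs H x) = ?d"
      using card_nbrs[OF Suc.prems(1) x(1)] inj sub by (metis card_image inj_on_subset)
    moreover have "inj_on col (\<psi> ` nbrs H x)"
      using injc sub by (meson comp_inj_on_iff inj inj_on_subset)
    moreover have "card (col ` \<psi> ` ?V) \<le> N"
      using card_image_le[of ?V "col \<circ> \<psi>"] finV cV VH Suc.hyps(2) Suc.prems(3) by (simp add: image_comp)
    ultimately show "b * (Q ^ t / Q ^ ?d) \<le> real (card {y \<in> graph_common_nbrs G (\<psi> ` nbrs H x). col y \<notin> col ` \<psi> ` ?V})"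
      using bound[of "\<psi> ` nbrs H x" "col ` \<psi> ` ?V"] x(2) sub \<psi>V finV by (auto simp: image_mono)
  qed
  finally show ?case unfolding Suc.hyps(2)[symmetric] .
qed

lemma card_coloured_copies_le:
  assumes "simple_graph H" "finite (verts G)"
  shows "card (coloured_copies col H G) \<le> card (labeled_copies H G)"
  using finite_labeled_copies[OF assms] by (intro card_mono) (auto simp: coloured_copies_def)

section \<open>Application to the projective norm graph and asymptotics\<close>

lemma verts_proj_norm_graph: "verts (proj_norm_graph q t L k) = carrier L \<times> (k - {\<zero>\<^bsub>L\<^esub>})"
  by (simp add: proj_norm_graph_def Let_def)

lemma edge_proj_norm_graph:
  assumes "field L" "k \<subseteq> carrier L" "d \<in> verts (proj_norm_graph q t L k)" "y \<in> verts (proj_norm_graph q t L k)"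
  shows "{d, y} \<in> edges (proj_norm_graph q t L k) \<longleftrightarrow>
    d \<noteq> y \<and> field_norm q t L (fst d \<oplus>\<^bsub>L\<^esub> fst y) = snd d \<otimes>\<^bsub>L\<^esub> snd y"
proof -
  interpret field L by (rule assms(1))
  obtain A a B b where dy: "d = (A, a)" "y = (B, b)" by (metis surj_pair)
  have m: "A \<in> carrier L" "a \<in> carrier L" "B \<in> carrier L" "b \<in> carrier L"
    using assms dy by (auto simp: verts_proj_norm_graph)
  have comm: "B \<oplus>\<^bsub>L\<^esub> A = A \<oplus>\<^bsub>L\<^esub> B" "b \<otimes>\<^bsub>L\<^esub> a = a \<otimes>\<^bsub>L\<^esub> b" using m by (simp_all add: a_comm m_comm)
  show ?thesis
    using assms(3,4) comm unfolding dy
    by (auto simp: proj_norm_graph_def Let_def doubleton_eq_iff)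
qed

text \<open>Graph neighbourhoods differ from the solution sets only by loops. These can only help in
  the upper bounds, and the lower bound never meets them.\<close>

lemma proj_norm_graph_bounds:
  fixes L :: "'b ring"
  assumes H: "simple_graph H" "degenerate r H" and q: "q \<in> odd_prime_powers" and ext: "finite_field_ext q t L k"
    and r: "r \<le> 3" and t: "t \<ge> 3" "r = 3 \<longrightarrow> t \<ge> 4"
  defines "M \<equiv> real q ^ (t * card (verts H)) / real q ^ card (edges H)"
  shows "real (num_copies H (proj_norm_graph q t L k)) \<le> 65 ^ card (verts H) * M"
    and "(r = 3 \<longrightarrow> t \<ge> 5) \<Longrightarrow>
      real (num_copies H (proj_norm_graph q t L k)) \<le> (1 + 64 / sqrt (real q)) ^ card (verts H) * M"
    and "sqrt (real q) \<ge> 64 + real (card (verts H)) \<Longrightarrow>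
      (1 - (64 + real (card (verts H))) / sqrt (real q)) ^ card (verts H) * M
        \<le> real (num_copies H (proj_norm_graph q t L k))"
proof -
  let ?G = "proj_norm_graph q t L k"
  have L: "field L" "subfield k L" using ext by (auto simp: finite_field_ext_def)
  have sub: "k \<subseteq> carrier L" using subfieldE(3)[OF L(2)] .
  have V: "verts ?G = carrier L \<times> (k - {\<zero>\<^bsub>L\<^esub>})" by (rule verts_proj_norm_graph)
  have q0: "q > 0" using q by (auto simp: odd_prime_powers_def intro: Nat.gr0I)
  have fin: "finite (verts ?G)"
  proof -
    have "finite (carrier L)" "finite k" using ext q0 by (auto simp: finite_field_ext_def intro: card_ge_0_finite)
    then show ?thesis unfolding V by simp
  qed
  have edge: "{d, y} \<in> edges ?G \<longleftrightarrow> d \<noteq> y \<and> field_norm q t L (fst d \<oplus>\<^bsub>L\<^esub> fst y) = snd d \<otimes>\<^bsub>L\<^esub> snd y"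
    if "d \<in> verts ?G" "y \<in> verts ?G" for d y
    using edge_proj_norm_graph[OF L(1) sub that] .
  have nbrs_sub: "graph_common_nbrs ?G D \<subseteq> norm_common_nbrs q t L k D" if D: "D \<subseteq> verts ?G" for D
  proof
    fix y assume y: "y \<in> graph_common_nbrs ?G D"
    then have yV: "y \<in> verts ?G" by (simp add: graph_common_nbrs_def)
    have "field_norm q t L (fst d \<oplus>\<^bsub>L\<^esub> fst y) = snd d \<otimes>\<^bsub>L\<^esub> snd y" if "d \<in> D" for d
      using edge[of d y] y yV D that by (auto simp: graph_common_nbrs_def)
    then show "y \<in> norm_common_nbrs q t L k D" using yV unfolding V by (force simp: norm_common_nbrs_def)
  qed
  \<comment> \<open>A solution whose first coordinate avoids those of \<open>D\<close> is different
    from every member of \<open>D\<close>, so it is a genuine neighbour.\<close>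
  have nbrs_sup: "{y \<in> norm_common_nbrs q t L k D. fst y \<notin> B} \<subseteq> {y \<in> graph_common_nbrs ?G D. fst y \<notin> B}"
    if D: "D \<subseteq> verts ?G" "fst ` D \<subseteq> B" for D B
  proof
    fix y assume y: "y \<in> {y \<in> norm_common_nbrs q t L k D. fst y \<notin> B}"
    then have yV: "y \<in> verts ?G" unfolding V by (auto simp: norm_common_nbrs_def)
    have "{d, y} \<in> edges ?G" if d: "d \<in> D" for d
    proof -
      have "fst d \<in> B" using D(2) d by auto
      then have "d \<noteq> y" using y by auto
      moreover have "field_norm q t L (fst d \<oplus>\<^bsub>L\<^esub> fst y) = snd d \<otimes>\<^bsub>L\<^esub> snd y"
        using y d by (auto simp: norm_common_nbrs_def split: prod.splits)
      ultimately show ?thesis using edge[of d y] D(1) d yV by auto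
    qed
    then show "y \<in> {y \<in> graph_common_nbrs ?G D. fst y \<notin> B}" using y yV by (simp add: graph_common_nbrs_def)
  qed
  have exp: "real q ^ (t - card D) = real q ^ t / real q ^ card D" if "card D \<le> r" for D :: "('b \<times> 'b) set"
    using that r t(1) q0 by (simp add: power_diff)
  note bounds = norm_common_nbrs_bounds[OF q ext]
  have cr: "card D \<le> 3" "card D = 3 \<longrightarrow> t \<ge> 4" if "card D \<le> r" for D :: "('b \<times> 'b) set"
    using that r t by auto
  have le: "card (graph_common_nbrs ?G D) \<le> card (norm_common_nbrs q t L k D)"
    if D: "D \<subseteq> verts ?G" "card D \<le> r" for D
    using nbrs_sub[OF D(1)] bounds(1)[of D] D cr[OF D(2)] t(1) unfolding V by (intro card_mono) auto
  show "real (num_copies H ?G) \<le> 65 ^ card (verts H) * M"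
    unfolding num_copies_def M_def
  proof (rule degenerate_upper_bound[OF H fin])
    fix D assume D: "D \<subseteq> verts ?G" "card D \<le> r"
    show "real (card (graph_common_nbrs ?G D)) \<le> 65 * (real q ^ t / real q ^ card D)"
      using le[OF D] bounds(2)[OF D(1)[unfolded V] cr(1)[OF D(2)] t(1) cr(2)[OF D(2)]] exp[OF D(2)] by linarith
  qed (use q0 in auto)
  show "real (num_copies H ?G) \<le> (1 + 64 / sqrt (real q)) ^ card (verts H) * M" if t5: "r = 3 \<longrightarrow> t \<ge> 5"
    unfolding num_copies_def M_def
  proof (rule degenerate_upper_bound[OF H fin])
    fix D assume D: "D \<subseteq> verts ?G" "card D \<le> r"
    have "card D = 3 \<longrightarrow> t \<ge> 5" using D(2) r t5 by auto
    then show "real (card (graph_common_nbrs ?G D)) \<le> (1 + 64 / sqrt (real q)) * (real q ^ t / real q ^ card D)"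
      using le[OF D] bounds(3)[OF D(1)[unfolded V] cr(1)[OF D(2)] t(1) cr(2)[OF D(2)]]
      unfolding exp[OF D(2)] by fastforce
  qed (use q0 in auto)
  assume large: "sqrt (real q) \<ge> 64 + real (card (verts H))"
  let ?b = "1 - (64 + real (card (verts H))) / sqrt (real q)"
  have s: "sqrt (real q) > 0" using q0 by simp
  have b: "?b \<ge> 0" using large s by (simp add: divide_le_eq)
  have "?b ^ card (verts H) * M \<le> real (card (coloured_copies fst H ?G))"
    unfolding M_def
  proof (rule degenerate_lower_bound[OF H order_refl fin _ b])
    fix D and B :: "'b set"
    assume D: "D \<subseteq> verts ?G" "card D \<le> r" "inj_on fst D"
      and B: "finite B" "B \<subseteq> fst ` verts ?G" "card B \<le> card (verts H)" "fst ` D \<subseteq> B"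
    have "B \<subseteq> carrier L" using B(2) unfolding V by (auto split: if_splits)
    note lower = bounds(4)[OF D(1)[unfolded V] cr(1)[OF D(2)] t(1) cr(2)[OF D(2)] D(3) B(1) this]
    have "?b * real q ^ (t - card D) \<le> (1 - (64 + real (card B)) / sqrt (real q)) * real q ^ (t - card D)"
      using B(3) s by (intro mult_right_mono) (auto intro!: divide_right_mono)
    also note lower
    also have "real (card {y \<in> norm_common_nbrs q t L k D. fst y \<notin> B})
        \<le> real (card {y \<in> graph_common_nbrs ?G D. fst y \<notin> B})"
      using nbrs_sup[OF D(1) B(4)] fin by (intro of_nat_mono card_mono) (auto simp: graph_common_nbrs_def)
    finally show "?b * (real q ^ t / real q ^ card D) \<le> real (card {y \<in> graph_common_nbrs ?G D. fst y \<notin> B})"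
      unfolding exp[OF D(2)] .
  qed (use q0 in auto)
  also have "\<dots> \<le> real (num_copies H ?G)"
    unfolding num_copies_def using card_coloured_copies_le[OF H(1) fin] by simp
  finally show "?b ^ card (verts H) * M \<le> real (num_copies H ?G)" .
qed

text \<open>Convexity: on [0, 1] the power lies below its chord.\<close>

lemma one_plus_mult_power_le:
  fixes x c :: real assumes "0 \<le> x" "x \<le> 1" "c \<ge> 0"
  shows "(1 + c * x) ^ n \<le> 1 + ((1 + c) ^ n - 1) * x"
proof (induction n)
  case (Suc n)
  define K where "K = (1 + c) ^ n - 1"
  have K: "K \<ge> 0" unfolding K_def using assms by simp
  have "(1 + c * x) ^ Suc n \<le> (1 + c * x) * (1 + K * x)"
    using Suc assms unfolding K_def by (simp add: mult_left_mono)
  also have "\<dots> = 1 + (c + K) * x + c * K * (x * x)" by (simp add: algebra_simps)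
  also have "\<dots> \<le> 1 + (c + K) * x + c * K * x"
  proof -
    have "x * x \<le> x * 1" using assms by (intro mult_left_mono) auto
    then show ?thesis using K assms by (intro add_left_mono mult_left_mono) auto
  qed
  also have "\<dots> = 1 + ((1 + c) ^ Suc n - 1) * x" by (simp add: K_def algebra_simps)
  finally show ?case .
qed simp

lemma eventually_at_top_opp:
  assumes "\<And>q. q \<in> odd_prime_powers \<Longrightarrow> q \<ge> N \<Longrightarrow> P q" shows "eventually P at_top_opp"
  unfolding at_top_opp_def eventually_inf_principal using assms
  by (auto simp: eventually_at_top_linorder)

theorem mainTheorem3:
  fixes H :: "'v ugraph" and v e t :: nat
    and L :: "nat \<Rightarrow> 'a ring" and k :: "nat \<Rightarrow> 'a set"
    and X_H :: "nat \<Rightarrow> real"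
  assumes "simple_graph H"
    and "card (verts H) = v" and "card (edges H) = e"
    and "\<And>q. q \<in> odd_prime_powers \<Longrightarrow> finite_field_ext q t (L q) (k q)"
    and "X_H = (\<lambda>q. real (num_copies H (proj_norm_graph q t (L q) (k q))))"
  shows "(degenerate 3 H \<and> t \<ge> 4 \<longrightarrow>
            X_H \<in> \<Theta>[at_top_opp](\<lambda>q. real q powr (real t * real v - real e))) \<and>
         ((degenerate 3 H \<and> t \<ge> 5) \<or> (degenerate 2 H \<and> t \<ge> 3) \<longrightarrow>
            (\<lambda>q. \<bar>X_H q - real q powr (real t * real v - real e)\<bar>)
              \<in> O[at_top_opp](\<lambda>q. real q powr (real t * real v - real e - 1 / 2)))"
proof (intro conjI impI)
  define M where "M q = real q powr (real t * real v - real e)" for q :: nat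
  have M_eq: "M q = real q ^ (t * v) / real q ^ e" if "q > 0" for q
    using that unfolding M_def by (simp add: powr_diff powr_realpow flip: of_nat_mult)
  have M0: "M q \<ge> 0" for q by (simp add: M_def)
  \<comment> \<open>From \<open>N\<close> on, (64 + v) / sqrt q is at most 1/2, which keeps the base
    of the lower bound at least 1/2.\<close>
  define N where "N = (2 * (64 + v))\<^sup>2"
  have large: "q > 0" "sqrt (real q) \<ge> 2 * (64 + real v)" if "q \<ge> N" for q
  proof -
    have "N > 0" by (simp add: N_def)
    then show "q > 0" using that by simp
    have "real N \<le> real q" using that by simp
    then have "(2 * (64 + real v))\<^sup>2 \<le> real q" by (simp add: N_def)
    then show "sqrt (real q) \<ge> 2 * (64 + real v)" by (rule real_le_rsqrt)
  qed
  have lower: "(1 - (64 + real v) / sqrt (real q)) ^ v * M q \<le> X_H q"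
    if q: "q \<in> odd_prime_powers" "q \<ge> N" and r: "degenerate r H" "r \<le> 3" "t \<ge> 3" "r = 3 \<longrightarrow> t \<ge> 4" for q r
    using proj_norm_graph_bounds(3)[OF assms(1) r(1) q(1) assms(4)[OF q(1)] r(2,3,4)] large[OF q(2)]
    unfolding assms(2,3) M_eq[OF large(1)[OF q(2)], symmetric] assms(5) by simp
  show "X_H \<in> \<Theta>[at_top_opp](\<lambda>q. real q powr (real t * real v - real e))" if dt: "degenerate 3 H \<and> t \<ge> 4"
    unfolding M_def[symmetric]
  proof (rule bigthetaI')
    show "eventually (\<lambda>q. (1 / 2) ^ v * norm (M q) \<le> norm (X_H q) \<and> norm (X_H q) \<le> 65 ^ v * norm (M q)) at_top_opp"
    proof (rule eventually_at_top_opp[of N])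
      fix q assume q: "q \<in> odd_prime_powers" "q \<ge> N"
      have X0: "X_H q \<ge> 0" by (simp add: assms(5))
      have "(64 + real v) / sqrt (real q) \<le> 1 / 2" using large[OF q(2)] by (simp add: divide_le_eq)
      then have "(1 / 2) ^ v * M q \<le> (1 - (64 + real v) / sqrt (real q)) ^ v * M q"
        using M0 by (intro mult_right_mono power_mono) auto
      also have "\<dots> \<le> X_H q" using lower[OF q, of 3] dt by simp
      finally have "(1 / 2) ^ v * M q \<le> X_H q" .
      moreover have "X_H q \<le> 65 ^ v * M q"
        using proj_norm_graph_bounds(1)[OF assms(1) conjunct1[OF dt] q(1) assms(4)[OF q(1)]] dt
        unfolding assms(2,3) M_eq[OF large(1)[OF q(2)], symmetric] assms(5) by simp
      ultimately show "(1 / 2) ^ v * norm (M q) \<le> norm (X_H q) \<and> norm (X_H q) \<le> 65 ^ v * norm (M q)"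
        using X0 M0 by simp
    qed
  qed auto
  show "(\<lambda>q. \<bar>X_H q - real q powr (real t * real v - real e)\<bar>)
      \<in> O[at_top_opp](\<lambda>q. real q powr (real t * real v - real e - 1 / 2))"
    if dt: "(degenerate 3 H \<and> t \<ge> 5) \<or> (degenerate 2 H \<and> t \<ge> 3)"
  proof -
    \<comment> \<open>The two alternatives are treated together; the conditions on t in terms of r
      say when three equations may occur.\<close>
    obtain r where r: "degenerate r H" "r \<le> 3" "t \<ge> 3" "r = 3 \<longrightarrow> t \<ge> 4" "r = 3 \<longrightarrow> t \<ge> 5"
    proof (cases "degenerate 3 H \<and> t \<ge> 5")
      case True
      then show ?thesis using that[of 3] by simp
    next
      case False
      then have "degenerate 2 H" "t \<ge> 3" using dt by auto
      then show ?thesis using that[of 2] by simp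
    qed
    \<comment> \<open>The first entry serves the upper estimate, (1 + 64 x)^v \<le> 1 + (65^v - 1)
      x, the second the lower one by Bernoulli's inequality, each with x = 1 / sqrt q.\<close>
    define C where "C = max (65 ^ v) (real v * (64 + real v))"
    have "eventually (\<lambda>q. norm \<bar>X_H q - M q\<bar> \<le> C * norm (real q powr (real t * real v - real e - 1 / 2))) at_top_opp"
    proof (rule eventually_at_top_opp[of N])
      fix q assume q: "q \<in> odd_prime_powers" "q \<ge> N"
      define x where "x = 1 / sqrt (real q)"
      have s: "sqrt (real q) \<ge> 2 * (64 + real v)" "q > 0" using large[OF q(2)] by auto
      have x: "0 \<le> x" "x \<le> 1" "(64 + real v) * x \<le> 1" using s by (simp_all add: x_def divide_le_eq)
      have Mx: "real q powr (real t * real v - real e - 1 / 2) = M q * x"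
        using s(2) unfolding M_def x_def by (simp add: powr_diff powr_half_sqrt)
      have "X_H q \<le> (1 + 64 * x) ^ v * M q"
        using proj_norm_graph_bounds(2)[OF assms(1) r(1) q(1) assms(4)[OF q(1)] r(2-5)]
        unfolding assms(2,3) M_eq[OF s(2), symmetric] assms(5) x_def by simp
      also have "\<dots> \<le> (1 + ((1 + 64) ^ v - 1) * x) * M q"
        using one_plus_mult_power_le[OF x(1,2), of 64 v] M0 by (intro mult_right_mono) auto
      also have "\<dots> \<le> (1 + C * x) * M q"
        using M0 x by (intro mult_right_mono add_left_mono) (auto simp: C_def)
      finally have 1: "X_H q - M q \<le> C * (M q * x)" by (simp add: algebra_simps)
      have "1 - C * x \<le> 1 - real v * ((64 + real v) * x)"
        using x mult_right_mono[of "real v * (64 + real v)" C x] by (simp add: C_def mult.assoc)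
      also have "\<dots> \<le> (1 - (64 + real v) * x) ^ v"
        using Bernoulli_inequality[of "- ((64 + real v) * x)" v] x by simp
      finally have "(1 - C * x) * M q \<le> (1 - (64 + real v) * x) ^ v * M q" using M0 by (intro mult_right_mono)
      also have "\<dots> \<le> X_H q" using lower[OF q r(1-4)] by (simp add: x_def)
      finally have 2: "M q - X_H q \<le> C * (M q * x)" by (simp add: algebra_simps)
      show "norm \<bar>X_H q - M q\<bar> \<le> C * norm (real q powr (real t * real v - real e - 1 / 2))"
        unfolding Mx using 1 2 M0[of q] x by (simp add: abs_mult)
    qed
    then show ?thesis unfolding M_def by (rule bigoI)
  qed
qed

end
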